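(* Let $\alpha>2$, let $X=(x_{ij})$ be the $N\times n$ random matrix described in the context, with tail exponent $\alpha$, and suppose that $\mathbb E x_{11}^2=1$ and that $x_{11}$ is symmetrically distributed. For any $K>0$ there exist constants $\epsilon_{\mathsf a},\delta_{\mathsf a}\in(0,1/2)$ such that both of the following hold. (i) With probability at least $1-O(n^{-K})$: for $\epsilon\in(0,\epsilon_{\mathsf a})$, $\|\mathfrak u_I\|_2\ge\delta_{\mathsf a}$ for all $I\subset\{1,\dots,n\}$ with $|I|=\lceil(1-\epsilon)n\rceil$, where $\mathfrak u$ is the unit right singular vector of $X$ corresponding to its smallest singular value. (ii) For every $k=k(n)$ with $k=o(n)$, with probability at least $1-O(n^{-K})$: for $\epsilon\in(0,\epsilon_{\mathsf a})$, $\|\mathfrak u^{(k)}_I\|_2\ge\delta_{\mathsf a}$ for all $I\subset\{1,\dots,n\}$ with $|I|=\lceil(1-\epsilon)n\rceil$, where $\mathfrak u^{(k)}$ is the unit right singular vector of $X$ corresponding to its $k$-th smallest singular value.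
   Context: Model: $\mathsf a>1$ is a constant, $N=\lceil \mathsf a n\rceil$, and $X=(x_{ij})$ is an $N\times n$ real random matrix with i.i.d. entries whose law does not depend on $n$ and satisfies, for some constants $\alpha,C_\ell,C_u,T_0>0$, $C_\ell t^{-\alpha}\le \mathbb P\{|x_{11}|>t\}\le C_u t^{-\alpha}$ for all $t\ge T_0$. "Symmetrically distributed" means $x_{11}$ and $-x_{11}$ have the same law. Notation: for $x\in\mathbb R^n$ and $I\subseteq\{1,\dots,n\}$, $x_I\in\mathbb R^{|I|}$ is obtained by deleting the components with indices in $I^c$; unit vectors are with respect to $\|\cdot\|_2$. The model ($\mathsf a$ and the law of $x_{11}$) is fixed and asymptotics are as $n\to\infty$; constants do not depend on $n$. *)

theory Defs
  imports "HOL-Probability.Probability" "Jordan_Normal_Form.Char_Poly"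
begin

text \<open>
  Matrices and vectors are those of \<open>Jordan_Normal_Form\<close>, so that the dimensions may vary
  with \<open>n\<close>. Row and column indices start at 0; the index set \<open>{1,\<dots>,n}\<close> is \<open>{..<n}\<close>.
\<close>

definition power_law_tail :: "real measure \<Rightarrow> real \<Rightarrow> bool" where
  "power_law_tail \<mu> \<alpha> \<longleftrightarrow>
     (\<exists>C\<^sub>l>0. \<exists>C\<^sub>u>0. \<exists>T\<^sub>0>0. \<forall>t\<ge>T\<^sub>0.
        C\<^sub>l * t powr (- \<alpha>) \<le> measure \<mu> {x. \<bar>x\<bar> > t} \<and>
        measure \<mu> {x. \<bar>x\<bar> > t} \<le> C\<^sub>u * t powr (- \<alpha>))"

definition symmetric_law :: "real measure \<Rightarrow> bool" where
  "symmetric_law \<mu> \<longleftrightarrow> distr \<mu> borel (\<lambda>x. - x) = \<mu>"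

definition iid_matrix ::
    "'w measure \<Rightarrow> real measure \<Rightarrow> nat \<Rightarrow> nat \<Rightarrow> ('w \<Rightarrow> real mat) \<Rightarrow> bool" where
  "iid_matrix \<Omega> \<mu> N n X \<longleftrightarrow>
     prob_space \<Omega> \<and>
     (\<forall>\<omega>\<in>space \<Omega>. X \<omega> \<in> carrier_mat N n) \<and>
     prob_space.indep_vars \<Omega> (\<lambda>_. borel) (\<lambda>(i, j) \<omega>. X \<omega> $$ (i, j)) ({..<N} \<times> {..<n}) \<and>
     (\<forall>i<N. \<forall>j<n. distr \<Omega> borel (\<lambda>\<omega>. X \<omega> $$ (i, j)) = \<mu>)"

text \<open>
  Singular values of a matrix with at least as many rows as columns: the square roots of the
  eigenvalues of \<open>A\<^sup>T A\<close>, with multiplicity, in increasing order. The \<open>k\<close>-th smallest one is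
  counted from \<open>k = 1\<close> and is meaningful for \<open>1 \<le> k \<le> dim_col A\<close>.
\<close>

definition singular_values :: "real mat \<Rightarrow> real list" where
  "singular_values A =
     sorted_list_of_multiset (image_mset sqrt (proots (char_poly (transpose_mat A * A))))"

definition kth_smallest_singular_value :: "real mat \<Rightarrow> nat \<Rightarrow> real" where
  "kth_smallest_singular_value A k = singular_values A ! (k - 1)"

definition l2_norm :: "real vec \<Rightarrow> real" where
  "l2_norm v = L2_set (\<lambda>i. v $ i) {..<dim_vec v}"

definition unit_right_singular_vector :: "real mat \<Rightarrow> real \<Rightarrow> real vec \<Rightarrow> bool" where
  "unit_right_singular_vector A s u \<longleftrightarrow>
     eigenvector (transpose_mat A * A) u (s\<^sup>2) \<and> l2_norm u = 1"

text \<open>The vector obtained from \<open>v\<close> by deleting the components with indices outside \<open>I\<close>.\<close>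

definition subvector :: "real vec \<Rightarrow> nat set \<Rightarrow> real vec" where
  "subvector v I = vec_of_list (nths (list_of_vec v) I)"

lemma l2_norm_subvector:
  assumes "I \<subseteq> {..<dim_vec v}"
  shows "l2_norm (subvector v I) = L2_set (\<lambda>i. v $ i) I"
proof -
  have *: "(\<Sum>x\<leftarrow>nths xs I. f x) = (\<Sum>i | i \<in> I \<and> i < length xs. f (xs ! i))"
    for f :: "real \<Rightarrow> real" and xs :: "real list" and I
  proof (induction xs rule: rev_induct)
    case (snoc x xs)
    have e: "{i. i \<in> I \<and> i < length (xs @ [x])} =
       {i. i \<in> I \<and> i < length xs} \<union> (if length xs \<in> I then {length xs} else {})"
      by (auto simp: less_Suc_eq)
    show ?case
      unfolding e using snoc
      by (subst sum.union_disjoint) (auto simp: nths_append nth_append intro!: sum.cong)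
  qed simp
  have "(\<Sum>i<dim_vec (subvector v I). (subvector v I $ i)\<^sup>2)
      = (\<Sum>x\<leftarrow>nths (list_of_vec v) I. x\<^sup>2)"
    by (simp add: subvector_def sum_list_sum_nth atLeast0LessThan vec_of_list_index)
  also have "\<dots> = (\<Sum>i | i \<in> I \<and> i < dim_vec v. (list_of_vec v ! i)\<^sup>2)"
    by (simp add: *)
  also have "\<dots> = (\<Sum>i\<in>I. (v $ i)\<^sup>2)"
    using assms by (intro sum.cong) (auto simp: list_of_vec_index)
  finally show ?thesis by (simp add: l2_norm_def L2_set_def)
qed

text \<open>
  \<open>P n\<close> holds with probability at least \<open>1 - O(n\<^sup>-\<^sup>K)\<close>. Measurability of the event described
  by \<open>P n\<close> is not presupposed: it contains a measurable event of that probability.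
\<close>

definition holds_with_prob_1_minus_O ::
    "(nat \<Rightarrow> 'w measure) \<Rightarrow> real \<Rightarrow> (nat \<Rightarrow> 'w \<Rightarrow> bool) \<Rightarrow> bool" where
  "holds_with_prob_1_minus_O \<Omega> K P \<longleftrightarrow>
     (\<exists>E. (\<forall>n. E n \<in> sets (\<Omega> n) \<and> (\<forall>\<omega>\<in>E n. P n \<omega>)) \<and>
          (\<lambda>n. 1 - measure (\<Omega> n) (E n)) \<in> O(\<lambda>n. real n powr (- K)))"

text \<open>
  For all \<open>\<epsilon> < \<epsilon>\<^sub>a\<close> no unit right singular vector of the \<open>k\<close>-th smallest singular value has
  norm below \<open>\<delta>\<^sub>a\<close> on a set of \<open>\<lceil>(1 - \<epsilon>) n\<rceil>\<close> coordinates. If the singular value is not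
  simple, all unit vectors of its singular space are meant.
\<close>

definition singular_vector_delocalized :: "real \<Rightarrow> real \<Rightarrow> nat \<Rightarrow> real mat \<Rightarrow> nat \<Rightarrow> bool" where
  "singular_vector_delocalized \<epsilon>\<^sub>a \<delta>\<^sub>a n A k \<longleftrightarrow>
     (\<forall>\<epsilon>. 0 < \<epsilon> \<and> \<epsilon> < \<epsilon>\<^sub>a \<longrightarrow>
        (\<forall>u. unit_right_singular_vector A (kth_smallest_singular_value A k) u \<longrightarrow>
           (\<forall>I\<subseteq>{..<n}. int (card I) = \<lceil>(1 - \<epsilon>) * real n\<rceil> \<longrightarrow>
              l2_norm (subvector u I) \<ge> \<delta>\<^sub>a)))"

end

theory Submission
  imports Defs "HOL-Real_Asymp.Real_Asymp"
begin

text \<open>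
  Write \<open>r\<^sub>i\<close> for the rows of \<open>X\<close>. A unit vector \<open>u\<close> with norm below \<open>\<delta>\<close> off a set of \<open>\<epsilon> n\<close>
  coordinates has \<open>l\<^sup>1\<close> norm at most \<open>(\<delta> + \<surd>\<epsilon>) \<surd>n\<close>. With probability exponentially close to 1,
  all unit vectors of \<open>l\<^sup>1\<close> norm at most \<open>\<kappa> \<surd>n\<close> satisfy \<open>|X u|\<^sup>2 \<ge> (1 - c/2) N\<close>, whereas the
  \<open>k\<close>-th smallest singular value satisfies \<open>s\<^sup>2 \<le> (1 - c) N\<close> when \<open>k\<close> is a small multiple
  of \<open>n\<close>; so \<open>u\<close> is not a singular vector for it. The operator norm of \<open>X\<close>, which heavy tails
  make too large, is never used.

  Lower bound: \<open>\<langle>r\<^sub>i, u\<rangle>\<^sup>2\<close> is bounded below by \<open>2 (1 - cos (t \<langle>r\<^sub>i, u\<rangle>)) / t\<^sup>2\<close>, which is bounded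
  and Lipschitz and whose mean is computed from the characteristic function of the entries.
  Hoeffding's inequality is applied on the grid \<open>(h / \<surd>n) \<int>\<^sup>n\<close>: an unbiased rounding of \<open>u\<close>
  costs little on average over the rows of norm \<open>O(\<surd>n)\<close>, and it keeps the \<open>l\<^sup>1\<close> norm, so that
  only \<open>exp (o(1) n)\<close> grid points occur as \<open>\<kappa> \<rightarrow> 0\<close>.

  Upper bound: on the orthogonal complement of the first \<open>n/2\<close> rows only \<open>N - n/2\<close> rows
  act, and by independence the mean of \<open>|X v|\<^sup>2\<close> over unit vectors there is about \<open>N - n/2\<close>.
  The few rows whose projection is too long are added to the span, and the trace of
  \<open>X\<^sup>T X\<close> on the remaining subspace bounds its small eigenvalues.
\<close>

section \<open>The spectral theorem for real symmetric matrices\<close>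

unbundle no inner_syntax and no vec_syntax

text \<open>A complex root \<open>c\<close> of the characteristic polynomial has an eigenvector with
  real part \<open>x\<close> and imaginary part \<open>y\<close>. By symmetry, pairing
  \<open>y\<close> with \<open>A x\<close> gives the same as pairing \<open>x\<close> with
  \<open>A y\<close>, so \<open>Im c\<close> times the total squared length is 0. Hence
  \<open>c\<close> is real, and whichever of \<open>x\<close>, \<open>y\<close> is nonzero can be
  normalised.\<close>

lemma symmetric_mat_real_eigenvector:
  fixes A :: "real mat"
  assumes A: "A \<in> carrier_mat n n" and sym: "transpose_mat A = A" and n: "n > 0"
  obtains v e where "v \<in> carrier_vec n" "v \<bullet> v = 1" "A *\<^sub>v v = e \<cdot>\<^sub>v v"
proof -
  note result = that
  have symA: "A $$ (i,j) = A $$ (j,i)" if "i < n" "j < n" for i j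
    using sym A that by (metis carrier_matD index_transpose_mat(1))
  define C where "C = map_mat complex_of_real A"
  have C: "C \<in> carrier_mat n n" using A by (simp add: C_def)
  obtain as where as: "char_poly C = (\<Prod> a \<leftarrow> as. [:- a, 1:])" "length as = n"
    using char_poly_factorized[OF C] by auto
  then obtain c cs where "as = c # cs" using n by (cases as) auto
  then have "poly (char_poly C) c = 0" by (simp add: as)
  then obtain w where w: "eigenvector C w c"
    using eigenvalue_root_char_poly[OF C] unfolding eigenvalue_def by auto
  then have wc: "w \<in> carrier_vec n" "w \<noteq> 0\<^sub>v n" "C *\<^sub>v w = c \<cdot>\<^sub>v w"
    using C by (auto simp: eigenvector_def)
  define x where "x i = Re (w $ i)" for i
  define y where "y i = Im (w $ i)" for i
  have ev: "(\<Sum>j<n. complex_of_real (A $$ (i,j)) * w $ j) = c * w $ i" if "i < n" for i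
  proof -
    have "(C *\<^sub>v w) $ i = (c \<cdot>\<^sub>v w) $ i" using wc by simp
    then show ?thesis using that A wc
      by (auto simp: C_def scalar_prod_def atLeast0LessThan intro!: sum.cong)
  qed
  have Ax: "(\<Sum>j<n. A $$ (i,j) * x j) = Re c * x i - Im c * y i" if "i < n" for i
    using arg_cong[OF ev[OF that], of Re] by (simp add: x_def y_def)
  have Ay: "(\<Sum>j<n. A $$ (i,j) * y j) = Re c * y i + Im c * x i" if "i < n" for i
    using arg_cong[OF ev[OF that], of Im] by (simp add: x_def y_def)
  have "(\<Sum>i<n. y i * (\<Sum>j<n. A $$ (i,j) * x j)) = (\<Sum>j<n. x j * (\<Sum>i<n. A $$ (j,i) * y i))"
    unfolding sum_distrib_left by (subst sum.swap, intro sum.cong refl) (auto simp: symA)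
  then have "(\<Sum>i<n. y i * (Re c * x i - Im c * y i)) = (\<Sum>i<n. x i * (Re c * y i + Im c * x i))"
    by (simp add: Ax Ay)
  then have "Im c * (\<Sum>i<n. x i * x i + y i * y i) = 0"
    by (simp add: algebra_simps sum.distrib sum_subtractf sum_distrib_left)
  moreover have "(\<Sum>i<n. x i * x i + y i * y i) > 0"
  proof -
    obtain i where i: "i < n" "w $ i \<noteq> 0" using wc by (metis carrier_vecD eq_vecI index_zero_vec)
    then have "x i * x i + y i * y i > 0"
      by (simp add: x_def y_def complex_eq_iff sum_squares_gt_zero_iff)
    then show ?thesis using i by (intro sum_pos2[of _ i]) auto
  qed
  ultimately have c: "Im c = 0" by simp
  have *: thesis if z: "\<And>i. i < n \<Longrightarrow> (\<Sum>j<n. A $$ (i,j) * z j) = Re c * z i"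
    and nz: "(\<Sum>i<n. z i * z i) \<noteq> 0" for z :: "nat \<Rightarrow> real"
  proof -
    define s where "s = sqrt (\<Sum>i<n. z i * z i)"
    have s: "s * s = (\<Sum>i<n. z i * z i)" "s \<noteq> 0" using nz by (auto simp: s_def sum_nonneg)
    define v where "v = vec n (\<lambda>i. z i / s)"
    show thesis
    proof (rule result)
      show v: "v \<in> carrier_vec n" by (simp add: v_def)
      show "v \<bullet> v = 1" using s
        by (simp add: v_def scalar_prod_def atLeast0LessThan sum_divide_distrib[symmetric]) (metis mult_eq_0_iff)
      show "A *\<^sub>v v = Re c \<cdot>\<^sub>v v"
        using A z by (intro eq_vecI)
          (auto simp: v_def scalar_prod_def atLeast0LessThan sum_divide_distrib[symmetric])
    qed
  qed
  show thesis
  proof (cases "(\<Sum>i<n. x i * x i) = 0")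
    case False then show thesis using * Ax c by auto
  next
    case True
    then have "(\<Sum>i<n. y i * y i) \<noteq> 0"
      using \<open>(\<Sum>i<n. x i * x i + y i * y i) > 0\<close> by (simp add: sum.distrib)
    then show thesis using * Ay c by auto
  qed
qed

text \<open>The reflection exchanging \<open>v\<close> with the first basis vector \<open>e\<close>:
  \<open>1 - 2 d d^T / D\<close> with \<open>d = v - e\<close> and \<open>D\<close> the squared
  length of \<open>d\<close>. If \<open>v\<close> is that basis vector, then \<open>D = 0\<close>,
  and division by 0 turns the formula into the identity matrix.\<close>

lemma householder:
  fixes v :: "real vec"
  assumes v: "v \<in> carrier_vec n" "v \<bullet> v = 1" and n: "n > 0"
  obtains W where "W \<in> carrier_mat n n" "transpose_mat W = W" "W * W = 1\<^sub>m n" "col W 0 = v"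
proof -
  define e :: "nat \<Rightarrow> real" where "e = (\<lambda>i. if i = 0 then 1 else 0)"
  define d where "d i = v $ i - e i" for i
  define D where "D = (\<Sum>i<n. d i * d i)"
  define W where "W = mat n n (\<lambda>(i,j). (if i = j then 1 else 0) - 2 * d i * d j / D)"
  have vv: "(\<Sum>i<n. v $ i * v $ i) = 1"
    using v by (simp add: scalar_prod_def atLeast0LessThan)
  have se: "(\<Sum>i<n. e i * f i) = f 0" for f :: "nat \<Rightarrow> real"
    using n by (simp add: e_def if_distrib[of "\<lambda>x. x * _"] sum.delta cong: if_cong)
  have D: "D = 2 - 2 * v $ 0"
  proof -
    have "D = (\<Sum>i<n. v $ i * v $ i) - 2 * (\<Sum>i<n. e i * v $ i) + (\<Sum>i<n. e i * e i)"
      by (simp add: D_def d_def algebra_simps sum.distrib sum_subtractf sum_distrib_left)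
    then show ?thesis by (simp add: vv se) (simp add: e_def)
  qed
  have d0: "d 0 = - D / 2" by (simp add: D d_def e_def)
  have dD0: "d i = 0" if "D = 0" "i < n" for i
    using that by (auto simp: D_def sum_nonneg_eq_0_iff)
  show thesis
  proof
    show "W \<in> carrier_mat n n" by (simp add: W_def)
    show "transpose_mat W = W" by (intro eq_matI) (auto simp: W_def)
    show "col W 0 = v"
    proof (intro eq_vecI)
      fix i assume "i < dim_vec v"
      then have i: "i < n" using v by simp
      have "e i - 2 * d i * d 0 / D = v $ i"
      proof (cases "D = 0")
        case False
        have "e i - 2 * d i * (- D / 2) / D = e i + d i" using False by simp
        then show ?thesis unfolding d0 by (simp add: d_def)
      qed (use dD0[OF _ i] in \<open>auto simp: d_def\<close>)
      then show "col W 0 $ i = v $ i" using i n by (simp add: W_def e_def)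
    qed (use v in \<open>simp add: W_def\<close>)
    show "W * W = 1\<^sub>m n"
    proof (intro eq_matI)
      fix i j assume "i < dim_row (1\<^sub>m n :: real mat)" "j < dim_col (1\<^sub>m n :: real mat)"
      then have ij: "i < n" "j < n" by auto
      have "(W * W) $$ (i,j) = (\<Sum>k<n. ((if i = k then 1 else 0) - 2 * d i * d k / D) *
         ((if k = j then 1 else 0) - 2 * d k * d j / D))"
        using ij by (simp add: W_def scalar_prod_def atLeast0LessThan)
      also have "\<dots> = (\<Sum>k<n. (if i = k then 1 else 0) * (if k = j then 1 else 0))
          - (\<Sum>k<n. if i = k then 2 * d k * d j / D else 0)
          - (\<Sum>k<n. if k = j then 2 * d i * d k / D else 0)
          + (\<Sum>k<n. d k * d k) * (4 * d i * d j / D^2)"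
        unfolding sum_distrib_right sum_subtractf[symmetric] sum.distrib[symmetric]
        by (rule sum.cong[OF refl], cases "D = 0") (auto simp: power2_eq_square field_simps)
      also have "\<dots> = (if i = j then 1 else 0) - 4 * d i * d j / D + D * (4 * d i * d j / D^2)"
        using ij by (auto simp: D_def[symmetric] if_distrib[of "\<lambda>x. x * _"] sum.delta sum.delta' cong: if_cong)
      also have "\<dots> = (1\<^sub>m n) $$ (i,j)" using ij by (cases "D = 0") (auto simp: power2_eq_square)
      finally show "(W * W) $$ (i,j) = (1\<^sub>m n) $$ (i,j)" .
    qed (auto simp: W_def)
  qed
qed

text \<open>Induction on the dimension. A reflection \<open>W\<close> carries an eigenvector to the
  first basis vector, so \<open>W A W\<close> is block diagonal by symmetry, and the induction
  hypothesis diagonalises its lower block.\<close>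

lemma spectral_real_symmetric:
  fixes A :: "real mat"
  assumes "A \<in> carrier_mat n n" "transpose_mat A = A"
  shows "\<exists>Q D. Q \<in> carrier_mat n n \<and> D \<in> carrier_mat n n \<and> diagonal_mat D
    \<and> transpose_mat Q * Q = 1\<^sub>m n \<and> A = Q * D * transpose_mat Q"
  using assms
proof (induction n arbitrary: A)
  case 0
  then show ?case by (intro exI[of _ A]) (auto simp: diagonal_mat_def intro!: eq_matI)
next
  case (Suc n)
  note A = Suc.prems(1)
  obtain v e where v: "v \<in> carrier_vec (Suc n)" "v \<bullet> v = 1" "A *\<^sub>v v = e \<cdot>\<^sub>v v"
    using symmetric_mat_real_eigenvector[OF Suc.prems] by auto
  obtain W where W: "W \<in> carrier_mat (Suc n) (Suc n)" "transpose_mat W = W" "W * W = 1\<^sub>m (Suc n)"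
      "col W 0 = v"
    using householder[OF v(1,2)] by auto
  define B where "B = W * A * W"
  have B: "B \<in> carrier_mat (Suc n) (Suc n)" using W A by (auto simp: B_def)
  have symB: "transpose_mat B = B"
    unfolding B_def using W(1) A
    by (simp add: transpose_mult[of _ "Suc n" "Suc n" _ "Suc n"] W(2) Suc.prems(2)
        assoc_mult_mat[of _ "Suc n" "Suc n" _ "Suc n" _ "Suc n"])
  have Bsym: "B $$ (i,j) = B $$ (j,i)" if "i < Suc n" "j < Suc n" for i j
    using symB B that by (metis carrier_matD index_transpose_mat(1))
  have colB: "col B 0 = e \<cdot>\<^sub>v unit_vec (Suc n) 0"
  proof -
    have "col B 0 = (W * A) *\<^sub>v v" 
      unfolding B_def W(4)[symmetric] using W(1) A by (intro col_mult2[of _ "Suc n" "Suc n" _ "Suc n"]) auto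
    also have "\<dots> = W *\<^sub>v (A *\<^sub>v v)" using W(1) A v(1) by (rule assoc_mult_mat_vec)
    also have "\<dots> = e \<cdot>\<^sub>v (W *\<^sub>v v)" unfolding v(3) using W v by (simp add: mult_mat_vec[of _ "Suc n" "Suc n"])
    also have "W *\<^sub>v v = col (W * W) 0"
      using W by (subst col_mult2[of _ "Suc n" "Suc n" _ "Suc n"]) auto
    finally show ?thesis using W by simp
  qed
  have B0: "B $$ (i,0) = (if i = 0 then e else 0)" if "i < Suc n" for i
    using arg_cong[OF colB, of "\<lambda>w. w $ i"] that B by auto
  define B' where "B' = mat n n (\<lambda>(i,j). B $$ (Suc i, Suc j))"
  have B': "B' \<in> carrier_mat n n" by (simp add: B'_def)
  have "transpose_mat B' = B'" by (intro eq_matI) (auto simp: B'_def Bsym)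
  from Suc.IH[OF B' this] obtain Q' D' where
    Q': "Q' \<in> carrier_mat n n" "D' \<in> carrier_mat n n" "diagonal_mat D'"
      "transpose_mat Q' * Q' = 1\<^sub>m n" "B' = Q' * D' * transpose_mat Q'" by blast
  let ?O = "0\<^sub>m 1 n :: real mat" and ?P = "0\<^sub>m n 1 :: real mat"
  define R where "R = four_block_mat (1\<^sub>m 1) ?O ?P Q'"
  define D where "D = four_block_mat (e \<cdot>\<^sub>m 1\<^sub>m 1) ?O ?P D'"
  have R: "R \<in> carrier_mat (Suc n) (Suc n)" and D: "D \<in> carrier_mat (Suc n) (Suc n)"
    using Q' by (auto simp: R_def D_def)
  have tR: "transpose_mat R = four_block_mat (1\<^sub>m 1) ?O ?P (transpose_mat Q')"
    unfolding R_def using Q' by (subst transpose_four_block_mat) auto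
  have RR: "transpose_mat R * R = 1\<^sub>m (Suc n)"
    unfolding tR unfolding R_def using Q'
    by (subst mult_four_block_mat[of _ 1 1 _ n _ n _ _ 1 _ n]) auto
  have BR: "B = R * D * transpose_mat R"
  proof -
    have "R * D * transpose_mat R = four_block_mat (e \<cdot>\<^sub>m 1\<^sub>m 1) ?O ?P B'"
      unfolding tR unfolding R_def D_def using Q'
      by (subst mult_four_block_mat[of _ 1 1 _ n _ n _ _ 1 _ n], auto,
          subst mult_four_block_mat[of _ 1 1 _ n _ n _ _ 1 _ n], auto)
    also have "\<dots> = B"
      using B B0 Bsym by (intro eq_matI) (auto simp: B'_def)
    finally show ?thesis by simp
  qed
  have "A = W * B * W"
  proof -
    have "W * B * W = (W * W) * A * (W * W)" unfolding B_def using W(1) A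
      by (simp add: assoc_mult_mat[of _ "Suc n" "Suc n" _ "Suc n" _ "Suc n"])
    then show ?thesis using W A by simp
  qed
  then have "A = (W * R) * D * transpose_mat (W * R)"
    unfolding BR using W(1,2) R D
    by (simp add: transpose_mult[of _ "Suc n" "Suc n" _ "Suc n"] assoc_mult_mat[of _ "Suc n" "Suc n" _ "Suc n" _ "Suc n"])
  moreover have "transpose_mat (W * R) * (W * R) = 1\<^sub>m (Suc n)"
  proof -
    have "transpose_mat (W * R) * (W * R) = transpose_mat R * ((W * W) * R)"
      using W(1,2) R
      by (simp add: transpose_mult[of _ "Suc n" "Suc n" _ "Suc n"] assoc_mult_mat[of _ "Suc n" "Suc n" _ "Suc n" _ "Suc n"])
    then show ?thesis using W(3) R RR by simp
  qed
  moreover have "diagonal_mat D"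
    using Q'(2,3) by (auto simp: D_def diagonal_mat_def)
  ultimately show ?case using W R D
    by (intro exI[of _ "W * R"] exI[of _ D]) auto
qed

section \<open>Singular values and orthogonal projections\<close>

text \<open>Vectors are functions on all of \<open>nat\<close> of which only the values below
  \<open>n\<close> count. Rows, projections and grid points can thus be formed without carrier
  conditions.\<close>

definition ip :: "nat \<Rightarrow> (nat \<Rightarrow> real) \<Rightarrow> (nat \<Rightarrow> real) \<Rightarrow> real" where
  "ip n u v = (\<Sum>j<n. u j * v j)"

text \<open>Zero vectors are allowed, because Gram--Schmidt below produces them for dependent input.\<close>

definition orthosystem :: "nat \<Rightarrow> nat set \<Rightarrow> (nat \<Rightarrow> nat \<Rightarrow> real) \<Rightarrow> bool" where
  "orthosystem n L p \<longleftrightarrow> finite L \<and> (\<forall>l\<in>L. ip n (p l) (p l) \<in> {0, 1}) \<and>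
     (\<forall>l\<in>L. \<forall>m\<in>L. l \<noteq> m \<longrightarrow> ip n (p l) (p m) = 0)"

text \<open>The squared distance to the span of an orthosystem.\<close>

definition resid :: "nat \<Rightarrow> nat set \<Rightarrow> (nat \<Rightarrow> nat \<Rightarrow> real) \<Rightarrow> (nat \<Rightarrow> real) \<Rightarrow> real" where
  "resid n L p r = ip n r r - (\<Sum>l\<in>L. (ip n r (p l))\<^sup>2)"

lemma ip_commute: "ip n u v = ip n v u"
  by (simp add: ip_def mult.commute)

lemma ip_self_nonneg: "ip n u u \<ge> 0"
  by (simp add: ip_def sum_nonneg)

lemma ip_diff_left: "ip n (\<lambda>j. u j - v j) w = ip n u w - ip n v w"
  by (simp add: ip_def algebra_simps sum_subtractf)

lemma ip_diff_right: "ip n w (\<lambda>j. u j - v j) = ip n w u - ip n w v"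
  by (simp add: ip_def algebra_simps sum_subtractf)

lemma ip_sum_left: "ip n (\<lambda>j. \<Sum>l\<in>L. c l * p l j) w = (\<Sum>l\<in>L. c l * ip n (p l) w)"
  unfolding ip_def sum_distrib_left sum_distrib_right
  by (subst sum.swap) (simp add: algebra_simps)

lemma ip_sum_right: "ip n w (\<lambda>j. \<Sum>l\<in>L. c l * p l j) = (\<Sum>l\<in>L. c l * ip n w (p l))"
  using ip_sum_left[of n c p L w] by (simp add: ip_commute)

lemma ip_eq_0_if_norm_0:
  assumes "ip n v v = 0" shows "ip n u v = 0"
proof -
  have "\<forall>j<n. v j = 0" using assms by (simp add: ip_def sum_nonneg_eq_0_iff)
  then show ?thesis by (simp add: ip_def)
qed

text \<open>Orthogonality leaves only the term with \<open>m = l\<close>. It cancels if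
  \<open>p l\<close> has norm 1; if \<open>p l\<close> has norm 0, then \<open>p l\<close> vanishes
  below \<open>n\<close> and every product with it is 0.\<close>

lemma ip_orthosystem_remainder:
  assumes "orthosystem n L p" and "l \<in> L"
  shows "ip n (\<lambda>j. r j - (\<Sum>m\<in>L. ip n r (p m) * p m j)) (p l) = 0"
proof -
  have "(\<Sum>m\<in>L. ip n r (p m) * ip n (p m) (p l)) = (\<Sum>m\<in>L. if m = l then ip n r (p l) else 0)"
  proof (intro sum.cong refl)
    fix m assume m: "m \<in> L"
    show "ip n r (p m) * ip n (p m) (p l) = (if m = l then ip n r (p l) else 0)"
    proof (cases "m = l")
      case True
      have "ip n (p l) (p l) = 0 \<or> ip n (p l) (p l) = 1"
        using assms by (auto simp: orthosystem_def)
      then show ?thesis using True ip_eq_0_if_norm_0[of n "p l" r] by auto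
    qed (use assms m in \<open>auto simp: orthosystem_def\<close>)
  qed
  then show ?thesis using assms
    by (simp add: ip_diff_left ip_sum_left orthosystem_def sum.delta)
qed

text \<open>Pythagoras: the remainder is orthogonal to the projection, so its squared length equals
  its inner product with \<open>r\<close>.\<close>

lemma resid_eq_norm_remainder:
  assumes "orthosystem n L p"
  defines "w \<equiv> (\<lambda>r j. r j - (\<Sum>m\<in>L. ip n r (p m) * p m j))"
  shows "resid n L p r = ip n (w r) (w r)"
proof -
  have "ip n (w r) (w r) = ip n (w r) r - ip n (w r) (\<lambda>j. \<Sum>m\<in>L. ip n r (p m) * p m j)"
    using ip_diff_right[of n "w r" r] by (simp add: w_def)
  also have "ip n (w r) (\<lambda>j. \<Sum>m\<in>L. ip n r (p m) * p m j) = 0"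
    unfolding ip_sum_right w_def using ip_orthosystem_remainder[OF assms(1)]
    by (intro sum.neutral) auto
  finally show ?thesis
    by (simp add: resid_def w_def ip_diff_left ip_sum_left power2_eq_square ip_commute)
qed

lemma resid_nonneg: "orthosystem n L p \<Longrightarrow> resid n L p r \<ge> 0"
  by (simp add: resid_eq_norm_remainder ip_self_nonneg)

section \<open>The trace of the Gram matrix on a subspace\<close>

lemma card_less_sorted_nth:
  fixes xs :: "real list"
  assumes "k < length xs"
  shows "card {j. j < length xs \<and> xs ! j < sort xs ! k} \<le> k"
proof -
  let ?P = "\<lambda>x. x < sort xs ! k"
  have "card {j. j < length xs \<and> ?P (xs ! j)} = length (filter ?P xs)"
    by (simp add: length_filter_conv_card)
  also have "\<dots> = size (filter_mset ?P (mset xs))" by (metis mset_filter size_mset)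
  also have "\<dots> = size (filter_mset ?P (mset (sort xs)))" by simp
  also have "\<dots> = length (filter ?P (sort xs))" by (metis mset_filter size_mset)
  also have "\<dots> = card {j. j < length (sort xs) \<and> ?P (sort xs ! j)}"
    by (simp only: length_filter_conv_card)
  \<comment> \<open>Sorting preserves the count, and in a sorted list only the first
    \<open>k\<close> positions can hold entries strictly below the one at position
    \<open>k\<close>.\<close>
  also have "\<dots> \<le> card {..<k}"
  proof (intro card_mono subsetI)
    fix j assume j: "j \<in> {j. j < length (sort xs) \<and> ?P (sort xs ! j)}"
    show "j \<in> {..<k}"
    proof (rule ccontr)
      assume "j \<notin> {..<k}"
      then have "sort xs ! k \<le> sort xs ! j" using j by (intro sorted_nth_mono) auto
      then show False using j by auto
    qed
  qed auto
  finally show ?thesis by simp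
qed

lemma gram_mat_index:
  fixes M :: "real mat"
  assumes "M \<in> carrier_mat N n" "a < n" "b < n"
  shows "(transpose_mat M * M) $$ (a,b) = (\<Sum>i<N. M $$ (i,a) * M $$ (i,b))"
  using assms by (auto simp: scalar_prod_def atLeast0LessThan)

lemma sum_sq_ip_rows:
  fixes M :: "real mat"
  assumes "M \<in> carrier_mat N n"
  shows "(\<Sum>i<N. (ip n (\<lambda>j. M $$ (i,j)) v)\<^sup>2)
    = (\<Sum>a<n. \<Sum>b<n. v a * v b * (transpose_mat M * M) $$ (a,b))"
proof -
  have "(\<Sum>i<N. (ip n (\<lambda>j. M $$ (i,j)) v)\<^sup>2)
      = (\<Sum>i<N. \<Sum>a<n. \<Sum>b<n. v a * v b * (M $$ (i,a) * M $$ (i,b)))"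
    by (simp add: ip_def power2_eq_square sum_product algebra_simps)
  also have "\<dots> = (\<Sum>a<n. \<Sum>b<n. \<Sum>i<N. v a * v b * (M $$ (i,a) * M $$ (i,b)))"
    by (subst sum.swap) (intro sum.cong refl sum.swap)
  also have "\<dots> = (\<Sum>a<n. \<Sum>b<n. v a * v b * (transpose_mat M * M) $$ (a,b))"
    by (intro sum.cong refl) (simp add: gram_mat_index[OF assms] sum_distrib_left)
  finally show ?thesis .
qed

lemma sum_sq_ip_rows_singular_vector:
  fixes M :: "real mat"
  assumes M: "M \<in> carrier_mat N n" and u: "unit_right_singular_vector M s u"
  shows "(\<Sum>i<N. (ip n (\<lambda>j. M $$ (i,j)) (\<lambda>j. u $ j))\<^sup>2) = s\<^sup>2"
    and "dim_vec u = n" and "ip n (\<lambda>j. u $ j) (\<lambda>j. u $ j) = 1"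
proof -
  let ?G = "transpose_mat M * M"
  have e: "u \<in> carrier_vec n" "?G *\<^sub>v u = s\<^sup>2 \<cdot>\<^sub>v u"
    using u M by (auto simp: unit_right_singular_vector_def eigenvector_def)
  then show d: "dim_vec u = n" by simp
  have "L2_set (\<lambda>i. u $ i) {..<n} = 1"
    using u d by (auto simp: unit_right_singular_vector_def l2_norm_def)
  then show 1: "ip n (\<lambda>j. u $ j) (\<lambda>j. u $ j) = 1"
    by (simp add: L2_set_def ip_def power2_eq_square)
  have G: "(\<Sum>b<n. ?G $$ (a,b) * u $ b) = s\<^sup>2 * u $ a" if "a < n" for a
  proof -
    have "(?G *\<^sub>v u) $ a = (\<Sum>b<n. ?G $$ (a,b) * u $ b)"
      using that M d by (auto simp: scalar_prod_def atLeast0LessThan intro!: sum.cong)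
    then show ?thesis using e that d by simp
  qed
  have "(\<Sum>i<N. (ip n (\<lambda>j. M $$ (i,j)) (\<lambda>j. u $ j))\<^sup>2) = (\<Sum>a<n. u $ a * (\<Sum>b<n. ?G $$ (a,b) * u $ b))"
    unfolding sum_sq_ip_rows[OF M] sum_distrib_left by (simp add: algebra_simps)
  also have "\<dots> = (\<Sum>a<n. u $ a * (s\<^sup>2 * u $ a))"
    by (intro sum.cong refl) (simp add: G)
  also have "\<dots> = s\<^sup>2 * ip n (\<lambda>j. u $ j) (\<lambda>j. u $ j)"
    by (simp add: ip_def sum_distrib_left algebra_simps)
  finally show "(\<Sum>i<N. (ip n (\<lambda>j. M $$ (i,j)) (\<lambda>j. u $ j))\<^sup>2) = s\<^sup>2" by (simp add: 1)
qed

lemma proots_linear_factors: "proots (\<Prod>a\<leftarrow>xs. [:- a, 1:]) = mset (xs :: real list)"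
proof (induction xs)
  case (Cons a xs)
  have "(\<Prod>a\<leftarrow>xs. [:- a, 1:]) \<noteq> (0 :: real poly)" by (auto simp: prod_list_zero_iff)
  then show ?case using Cons by (simp add: proots_mult del: mult_pCons_left)
qed simp

text \<open>
  The right-hand side is the trace of \<open>M\<^sup>T M\<close> on the orthogonal complement of \<open>p\<close>, the second
  factor on the left is the dimension of that complement minus \<open>k - 1\<close>.
\<close>

lemma kth_smallest_singular_value_le_resid:
  fixes M :: "real mat"
  assumes M: "M \<in> carrier_mat N n" and k: "1 \<le> k" "k \<le> n" and p: "orthosystem n L p"
  shows "(kth_smallest_singular_value M k)\<^sup>2 * (real n - (\<Sum>l\<in>L. ip n (p l) (p l)) - real (k - 1))
    \<le> (\<Sum>i<N. resid n L p (\<lambda>j. M $$ (i,j)))"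
proof -
  define G where "G = transpose_mat M * M"
  have G: "G \<in> carrier_mat n n" "transpose_mat G = G"
    using M by (auto simp: G_def transpose_mult[of _ n N _ n])
  obtain Q D where Q: "Q \<in> carrier_mat n n" "D \<in> carrier_mat n n" "diagonal_mat D"
    "transpose_mat Q * Q = 1\<^sub>m n" "G = Q * D * transpose_mat Q"
    using spectral_real_symmetric[OF G] by blast
  have QQ: "Q * transpose_mat Q = 1\<^sub>m n"
    using mat_mult_left_right_inverse[of "transpose_mat Q" n Q] Q by auto
  \<comment> \<open>The columns of \<open>Q\<close> are an orthonormal eigenbasis of
    \<open>G\<close>, with eigenvalues \<open>lam j\<close>.\<close>
  define e where "e j i = Q $$ (i,j)" for i j
  define lam where "lam j = D $$ (j,j)" for j
  have parseval0: "(\<Sum>j<n. e j a * e j b) = (if a = b then 1 else 0)" if "a < n" "b < n" for a b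
    using arg_cong[OF QQ, of "\<lambda>A. A $$ (a,b)"] that Q
    by (auto simp: e_def scalar_prod_def atLeast0LessThan)
  have e_unit: "ip n (e j) (e j) = 1" if "j < n" for j
    using arg_cong[OF Q(4), of "\<lambda>A. A $$ (j,j)"] that Q(1)
    by (auto simp: e_def ip_def scalar_prod_def atLeast0LessThan)
  have parseval: "(\<Sum>j<n. (ip n (e j) v)\<^sup>2) = ip n v v" for v
  proof -
    have "(\<Sum>j<n. (ip n (e j) v)\<^sup>2) = (\<Sum>j<n. \<Sum>a<n. \<Sum>b<n. v a * v b * (e j a * e j b))"
      by (simp add: ip_def power2_eq_square sum_product algebra_simps)
    also have "\<dots> = (\<Sum>a<n. \<Sum>b<n. \<Sum>j<n. v a * v b * (e j a * e j b))"
      by (subst sum.swap) (intro sum.cong refl sum.swap)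
    also have "\<dots> = (\<Sum>a<n. \<Sum>b<n. if a = b then v a * v b else 0)"
      by (intro sum.cong refl) (auto simp: sum_distrib_left[symmetric] parseval0)
    finally show ?thesis by (simp add: ip_def)
  qed
  have G_eq: "G $$ (a,b) = (\<Sum>j<n. lam j * (e j a * e j b))" if ab: "a < n" "b < n" for a b
  proof -
    have "(Q * D) $$ (a,j) = Q $$ (a,j) * lam j" if "j < n" for j
    proof -
      have "(Q * D) $$ (a,j) = (\<Sum>i<n. Q $$ (a,i) * D $$ (i,j))"
        using Q ab that by (auto simp: scalar_prod_def atLeast0LessThan)
      also have "\<dots> = (\<Sum>i<n. if i = j then Q $$ (a,j) * lam j else 0)"
        using Q that by (intro sum.cong refl) (auto simp: diagonal_mat_def lam_def)
      finally show ?thesis using that by simp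
    qed
    moreover have "G $$ (a,b) = (\<Sum>j<n. (Q * D) $$ (a,j) * Q $$ (b,j))"
    proof -
      define P where "P = Q * D"
      have "P \<in> carrier_mat n n" using Q by (simp add: P_def)
      then show ?thesis
        unfolding Q(5) P_def[symmetric] using Q(1) ab by (auto simp: scalar_prod_def atLeast0LessThan)
    qed
    ultimately show ?thesis by (simp add: e_def algebra_simps)
  qed
  have form: "(\<Sum>i<N. (ip n (\<lambda>j. M $$ (i,j)) v)\<^sup>2) = (\<Sum>j<n. lam j * (ip n (e j) v)\<^sup>2)" for v
  proof -
    have "(\<Sum>i<N. (ip n (\<lambda>j. M $$ (i,j)) v)\<^sup>2) =
        (\<Sum>a<n. \<Sum>b<n. \<Sum>j<n. lam j * (v a * v b * (e j a * e j b)))"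
      unfolding sum_sq_ip_rows[OF M] G_def[symmetric]
      by (intro sum.cong refl) (simp add: G_eq sum_distrib_left algebra_simps)
    also have "\<dots> = (\<Sum>j<n. \<Sum>a<n. \<Sum>b<n. lam j * (v a * v b * (e j a * e j b)))"
      by (subst (2) sum.swap) (intro sum.cong refl sum.swap)
    also have "\<dots> = (\<Sum>j<n. lam j * (ip n (e j) v)\<^sup>2)"
      by (simp add: ip_def power2_eq_square sum_product sum_distrib_left algebra_simps)
    finally show ?thesis .
  qed
  have lam_nonneg: "lam j \<ge> 0" if j: "j < n" for j
  proof -
    have ee: "ip n (e i) (e j) = (if i = j then 1 else 0)" if "i < n" for i
      using arg_cong[OF Q(4), of "\<lambda>A. A $$ (i,j)"] that j Q(1)
      by (auto simp: e_def ip_def scalar_prod_def atLeast0LessThan)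
    have "(\<Sum>i<n. lam i * (ip n (e i) (e j))\<^sup>2) = (\<Sum>i<n. if i = j then lam j else 0)"
      by (intro sum.cong refl) (auto simp: ee)
    then have "lam j = (\<Sum>i<n. lam i * (ip n (e i) (e j))\<^sup>2)" using j by simp
    also have "\<dots> \<ge> 0" unfolding form[symmetric] by (intro sum_nonneg) auto
    finally show ?thesis .
  qed
  \<comment> \<open>\<open>w j\<close> is the squared distance of the eigenvector \<open>e j\<close>
    from the span of \<open>p\<close>. The trace on the complement turns out to be the sum of the
    eigenvalues with these weights, which lie between 0 and 1 and add up to the dimension of the
    complement.\<close>
  define w where "w j = resid n L p (e j)" for j
  have w: "w j \<ge> 0" "w j \<le> 1" if "j < n" for j
    using resid_nonneg[OF p, of "e j"] e_unit[OF that] by (auto simp: w_def resid_def sum_nonneg)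
  have trace: "(\<Sum>i<N. ip n (\<lambda>j. M $$ (i,j)) (\<lambda>j. M $$ (i,j))) = (\<Sum>j<n. lam j)"
  proof -
    have "(\<Sum>i<N. ip n (\<lambda>j. M $$ (i,j)) (\<lambda>j. M $$ (i,j))) = (\<Sum>a<n. G $$ (a,a))"
      unfolding ip_def by (subst sum.swap) (simp add: G_def gram_mat_index[OF M])
    also have "\<dots> = (\<Sum>a<n. \<Sum>j<n. lam j * (e j a * e j a))" by (simp add: G_eq)
    also have "\<dots> = (\<Sum>j<n. lam j * ip n (e j) (e j))"
      unfolding ip_def sum_distrib_left by (rule sum.swap)
    finally show ?thesis by (simp add: e_unit)
  qed
  have "(\<Sum>i<N. resid n L p (\<lambda>j. M $$ (i,j))) = (\<Sum>j<n. lam j) - (\<Sum>l\<in>L. \<Sum>j<n. lam j * (ip n (e j) (p l))\<^sup>2)"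
    unfolding resid_def sum_subtractf trace by (subst sum.swap) (simp add: form)
  also have "\<dots> = (\<Sum>j<n. lam j * w j)"
    by (subst sum.swap) (simp add: w_def resid_def e_unit right_diff_distrib sum_subtractf sum_distrib_left)
  finally have main: "(\<Sum>i<N. resid n L p (\<lambda>j. M $$ (i,j))) = (\<Sum>j<n. lam j * w j)" .
  have sum_w: "(\<Sum>j<n. w j) = real n - (\<Sum>l\<in>L. ip n (p l) (p l))"
    unfolding w_def resid_def sum_subtractf
    by (subst sum.swap) (simp add: e_unit parseval)
  define xs where "xs = map (\<lambda>j. sqrt (lam j)) [0..<n]"
  define s where "s = kth_smallest_singular_value M k"
  have "char_poly G = char_poly D"
    by (rule char_poly_similar, rule similar_matI[of _ _ Q "transpose_mat Q" n]) (use Q G QQ in auto)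
  also have "\<dots> = (\<Prod>a\<leftarrow>diag_mat D. [:- a, 1:])"
    using Q by (intro char_poly_upper_triangular[of _ n]) (auto simp: diagonal_mat_def upper_triangular_def)
  finally have "proots (char_poly G) = mset (diag_mat D)" by (simp add: proots_linear_factors)
  moreover have "diag_mat D = map lam [0..<n]" using Q by (simp add: diag_mat_def lam_def[abs_def])
  ultimately have "singular_values M = sort xs"
    by (simp add: singular_values_def G_def[symmetric] xs_def o_def flip: mset_map)
  then have s: "s = sort xs ! (k - 1)" by (simp add: s_def kth_smallest_singular_value_def)
  have len: "length xs = n" by (simp add: xs_def)
  have "s \<in> set (sort xs)" unfolding s using k len by (intro nth_mem) auto
  then have s0: "s \<ge> 0" by (auto simp: xs_def lam_nonneg)
  \<comment> \<open>At most \<open>k - 1\<close> eigenvalues lie below \<open>s\<^sup>2\<close>, as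
    list positions start at 0. They carry total weight at most \<open>k - 1\<close>; all the
    remaining weight sits on eigenvalues that are at least \<open>s\<^sup>2\<close>.\<close>
  define J where "J = {j. j < n \<and> lam j < s\<^sup>2}"
  have "J \<subseteq> {j. j < length xs \<and> xs ! j < sort xs ! (k - 1)}"
    unfolding s[symmetric] using s0 by (auto simp: J_def xs_def lam_nonneg intro!: real_less_lsqrt)
  then have "card J \<le> card {j. j < length xs \<and> xs ! j < sort xs ! (k - 1)}"
    by (intro card_mono) auto
  also have "\<dots> \<le> k - 1" using k len by (intro card_less_sorted_nth) auto
  finally have cJ: "card J \<le> k - 1" .
  have finJ: "finite J" "J \<subseteq> {..<n}" by (auto simp: J_def)
  have "(\<Sum>j\<in>J. w j) \<le> (\<Sum>j\<in>J. 1)" using finJ w by (intro sum_mono) auto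
  then have "(\<Sum>j\<in>J. w j) \<le> real (k - 1)" using cJ by simp
  then have "s\<^sup>2 * (real n - (\<Sum>l\<in>L. ip n (p l) (p l)) - real (k - 1)) \<le> s\<^sup>2 * ((\<Sum>j<n. w j) - (\<Sum>j\<in>J. w j))"
    unfolding sum_w by (intro mult_left_mono) auto
  also have "\<dots> = (\<Sum>j\<in>{..<n} - J. s\<^sup>2 * w j)"
    using finJ by (simp add: sum_diff sum_distrib_left right_diff_distrib)
  also have "\<dots> \<le> (\<Sum>j\<in>{..<n} - J. lam j * w j)"
    using w by (intro sum_mono mult_right_mono) (auto simp: J_def)
  also have "\<dots> \<le> (\<Sum>j<n. lam j * w j)"
    using w lam_nonneg by (intro sum_mono2) auto
  finally show ?thesis by (simp add: main s_def)
qed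

text \<open>
  Gram--Schmidt orthonormalisation. If \<open>r i\<close> depends on its predecessors, then \<open>w\<close> vanishes on
  \<open>{..<n}\<close>, and so does the result since \<open>0 / 0 = 0\<close>.
\<close>

fun gs :: "nat \<Rightarrow> (nat \<Rightarrow> nat \<Rightarrow> real) \<Rightarrow> nat \<Rightarrow> nat \<Rightarrow> real" where
  "gs n r i = (let w = (\<lambda>j. r i j - (\<Sum>l<i. ip n (r i) (gs n r l) * gs n r l j))
     in (\<lambda>j. w j / sqrt (ip n w w)))"

declare gs.simps [simp del]

lemma ip_scale_left: "ip n (\<lambda>j. u j / c) v = ip n u v / c"
  by (simp add: ip_def sum_divide_distrib)

lemma ip_scale_right: "ip n v (\<lambda>j. u j / c) = ip n v u / c"
  by (simp add: ip_def sum_divide_distrib)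

text \<open>Normalisation makes the squared length of each new vector a quotient of a number by its
  own absolute value, which is 1, or 0 if the remainder vanishes.\<close>

lemma orthosystem_gs: "orthosystem n {..<m} (gs n r)"
proof (induction m)
  case (Suc m)
  define w where "w = (\<lambda>j. r m j - (\<Sum>l<m. ip n (r m) (gs n r l) * gs n r l j))"
  have g: "gs n r m = (\<lambda>j. w j / sqrt (ip n w w))"
    by (subst gs.simps) (simp add: w_def Let_def)
  have 0: "ip n (gs n r m) (gs n r l) = 0" if "l < m" for l
    using ip_orthosystem_remainder[OF Suc, of l "r m"] that
    by (simp add: g ip_scale_left w_def)
  have "ip n (gs n r m) (gs n r m) = ip n w w / \<bar>ip n w w\<bar>"
    by (simp add: g ip_scale_left ip_scale_right)
  then have "ip n (gs n r m) (gs n r m) \<in> {0, 1}"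
    using ip_self_nonneg[of n w] by auto
  then show ?case using Suc 0 unfolding orthosystem_def
    by (auto simp: less_Suc_eq ip_commute)
qed (simp add: orthosystem_def)

lemma resid_antimono:
  assumes "finite L'" "L \<subseteq> L'"
  shows "resid n L' p v \<le> resid n L p v"
  using assms by (auto simp: resid_def intro!: sum_mono2)

text \<open>The component of \<open>r i\<close> along \<open>gs n r i\<close> has exactly the
  squared length of the remainder left by the earlier vectors, so the distance is already 0 after
  step \<open>i\<close>. Further vectors can only lower it.\<close>

lemma resid_gs_eq_0:
  assumes "i < m" shows "resid n {..<m} (gs n r) (r i) = 0"
proof -
  define w where "w = (\<lambda>j. r i j - (\<Sum>l<i. ip n (r i) (gs n r l) * gs n r l j))"
  have g: "gs n r i = (\<lambda>j. w j / sqrt (ip n w w))"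
    by (subst gs.simps) (simp add: w_def Let_def)
  have w: "resid n {..<i} (gs n r) (r i) = ip n w w"
    using resid_eq_norm_remainder[OF orthosystem_gs] by (simp add: w_def)
  have "ip n w w = ip n (r i) w - ip n (\<lambda>j. \<Sum>l<i. ip n (r i) (gs n r l) * gs n r l j) w"
    using ip_diff_left[of n "r i" _ w] by (simp add: w_def)
  also have "ip n (\<lambda>j. \<Sum>l<i. ip n (r i) (gs n r l) * gs n r l j) w = 0"
    unfolding ip_sum_left w_def using ip_orthosystem_remainder[OF orthosystem_gs]
    by (intro sum.neutral) (auto simp: ip_commute)
  finally have "ip n (r i) w = ip n w w" by simp
  then have "(ip n (r i) (gs n r i))\<^sup>2 = ip n w w"
    using ip_self_nonneg[of n w]
    by (simp add: g ip_scale_right power_divide power2_eq_square)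
  then have "resid n {..<Suc i} (gs n r) (r i) = 0"
    using w by (simp add: resid_def)
  moreover have "resid n {..<m} (gs n r) (r i) \<le> resid n {..<Suc i} (gs n r) (r i)"
    using assms by (intro resid_antimono) auto
  ultimately show ?thesis
    using resid_nonneg[OF orthosystem_gs, of n m r "r i"] by linarith
qed

lemma ip_cong:
  assumes "\<And>j. j < n \<Longrightarrow> u j = u' j" "\<And>j. j < n \<Longrightarrow> v j = v' j"
  shows "ip n u v = ip n u' v'"
  using assms by (simp add: ip_def)

text \<open>Step \<open>i\<close> reads only the rows up to \<open>i\<close> and the coordinates
  below \<open>n\<close>. This allows rows to be replaced by restrictions to finite index sets, the
  form in which independence of blocks of entries is expressed.\<close>

lemma gs_cong:
  assumes "\<And>l j. l \<le> i \<Longrightarrow> j < n \<Longrightarrow> r l j = r' l j" "j < n"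
  shows "gs n r i j = gs n r' i j"
  using assms
proof (induction i arbitrary: j rule: less_induct)
  case (less i)
  define w where "w r = (\<lambda>j. r i j - (\<Sum>l<i. ip n (r i) (gs n r l) * gs n r l j))" for r
  have g: "gs n r i = (\<lambda>j. w r j / sqrt (ip n (w r) (w r)))" for r
    by (subst gs.simps) (simp add: w_def Let_def)
  have IH: "gs n r l j = gs n r' l j" if "l < i" "j < n" for l j using that less by simp
  have w: "w r j = w r' j" if "j < n" for j
    unfolding w_def using IH that less.prems
    by (intro arg_cong2[of _ _ _ _ minus] sum.cong refl arg_cong2[of _ _ _ _ times] ip_cong) auto
  then have "ip n (w r) (w r) = ip n (w r') (w r')" by (intro ip_cong)
  then show ?case using w less.prems by (simp add: g)
qed

lemma resid_cong:
  assumes "\<And>j. j < n \<Longrightarrow> v j = v' j" "\<And>l j. l \<in> L \<Longrightarrow> j < n \<Longrightarrow> p l j = p' l j"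
  shows "resid n L p v = resid n L p' v'"
  using assms by (simp add: resid_def ip_def)

text \<open>Gram--Schmidt is run on the first \<open>m\<close> rows followed by the rows in
  \<open>Bad\<close>, all of which then have distance 0 from the span. Each bad row costs at most
  one dimension, and the distances of the other rows only shrink, so their distances from the span
  of the first \<open>m\<close> rows still bound the trace.\<close>

lemma kth_smallest_singular_value_le_good_rows:
  fixes M :: "real mat"
  assumes M: "M \<in> carrier_mat N n" and k: "1 \<le> k" "k \<le> n"
    and Bad: "Bad \<subseteq> {m..<N}" and m: "m \<le> N"
  defines "r \<equiv> (\<lambda>i j. M $$ (i,j))"
  shows "(kth_smallest_singular_value M k)\<^sup>2 *
      (real n - (\<Sum>l<m. ip n (gs n r l) (gs n r l)) - real (card Bad) - real (k - 1))
    \<le> (\<Sum>i\<in>{m..<N} - Bad. resid n {..<m} (gs n r) (r i))"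
proof -
  have fin: "finite Bad" using Bad finite_subset by blast
  define b where "b = card Bad"
  obtain f where f: "bij_betw f {0..<b} Bad"
    using ex_bij_betw_nat_finite[OF fin] by (auto simp: b_def)
  \<comment> \<open>The input sequence: the first \<open>m\<close> rows, then the bad rows as
    enumerated by \<open>f\<close>.\<close>
  define r' where "r' l = (if l < m then r l else r (f (l - m)))" for l
  define p where "p = gs n r'"
  have p: "orthosystem n {..<m + b} p" unfolding p_def by (rule orthosystem_gs)
  have pm: "p l j = gs n r l j" if "l < m" "j < n" for l j
    unfolding p_def using that by (intro gs_cong) (auto simp: r'_def)
  have "(\<Sum>l<m + b. ip n (p l) (p l)) = (\<Sum>l<m. ip n (p l) (p l)) + (\<Sum>l\<in>{m..<m + b}. ip n (p l) (p l))"
    by (subst sum.union_disjoint[symmetric]) (auto intro!: sum.cong)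
  also have "(\<Sum>l\<in>{m..<m + b}. ip n (p l) (p l)) \<le> (\<Sum>l\<in>{m..<m + b}. 1)"
  proof (intro sum_mono)
    fix l assume "l \<in> {m..<m + b}"
    then have "ip n (p l) (p l) \<in> {0, 1}" using p by (simp add: orthosystem_def)
    then show "ip n (p l) (p l) \<le> 1" by auto
  qed
  finally have S: "(\<Sum>l<m + b. ip n (p l) (p l)) \<le> (\<Sum>l<m. ip n (gs n r l) (gs n r l)) + b"
    by (simp add: pm ip_def)
  have "(kth_smallest_singular_value M k)\<^sup>2 *
      (real n - (\<Sum>l<m. ip n (gs n r l) (gs n r l)) - real (card Bad) - real (k - 1))
    \<le> (kth_smallest_singular_value M k)\<^sup>2 * (real n - (\<Sum>l<m + b. ip n (p l) (p l)) - real (k - 1))"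
    using S by (intro mult_left_mono) (auto simp: b_def)
  also have "\<dots> \<le> (\<Sum>i<N. resid n {..<m + b} p (r i))"
    using kth_smallest_singular_value_le_resid[OF M k p] by (simp add: r_def)
  also have "\<dots> = (\<Sum>i\<in>{m..<N} - Bad. resid n {..<m + b} p (r i))"
  proof (intro sum.mono_neutral_right ballI)
    fix i assume i: "i \<in> {..<N} - ({m..<N} - Bad)"
    have "\<exists>l<m + b. r i = r' l"
    proof (cases "i < m")
      case True then show ?thesis by (intro exI[of _ i]) (simp add: r'_def)
    next
      case False
      then have "i \<in> Bad" using i by auto
      then obtain l where "l < b" "i = f l" using f by (auto simp: bij_betw_def)
      then show ?thesis by (intro exI[of _ "m + l"]) (simp add: r'_def)
    qed
    then show "resid n {..<m + b} p (r i) = 0" unfolding p_def using resid_gs_eq_0 by metis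
  qed auto
  also have "\<dots> \<le> (\<Sum>i\<in>{m..<N} - Bad. resid n {..<m} p (r i))"
    by (intro sum_mono resid_antimono) auto
  also have "\<dots> = (\<Sum>i\<in>{m..<N} - Bad. resid n {..<m} (gs n r) (r i))"
    by (intro sum.cong refl resid_cong) (auto simp: pm)
  finally show ?thesis .
qed

section \<open>Matrices with independent entries\<close>

context prob_space
begin

lemma Hoeffding_sum_ge:
  fixes Y :: "'b \<Rightarrow> 'a \<Rightarrow> real" and c d e :: real
  assumes I: "finite I" "I \<noteq> {}" and indep: "indep_vars (\<lambda>_. borel) Y I"
    and bd: "\<And>i \<omega>. i \<in> I \<Longrightarrow> 0 \<le> Y i \<omega> \<and> Y i \<omega> \<le> c" and c: "c > 0"
    and E: "\<And>i. i \<in> I \<Longrightarrow> expectation (Y i) \<le> e" and d: "d \<ge> 0"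
  shows "prob {\<omega>\<in>space M. (\<Sum>i\<in>I. Y i \<omega>) \<ge> real (card I) * (e + d)} \<le> exp (- 2 * real (card I) * d\<^sup>2 / c\<^sup>2)"
proof -
  interpret Hoeffding_ineq M I Y "\<lambda>_. 0" "\<lambda>_. c" "\<Sum>i\<in>I. expectation (Y i)"
    by unfold_locales (use I indep bd in auto)
  have card: "card I > 0" using I by (simp add: card_gt_0_iff)
  have "(\<Sum>i\<in>I. expectation (Y i)) \<le> real (card I) * e"
    using sum_mono[OF E] by simp
  then have "prob {\<omega>\<in>space M. (\<Sum>i\<in>I. Y i \<omega>) \<ge> real (card I) * (e + d)}
      \<le> prob {\<omega>\<in>space M. (\<Sum>i\<in>I. Y i \<omega>) \<ge> (\<Sum>i\<in>I. expectation (Y i)) + real (card I) * d}"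
    by (intro finite_measure_mono) (auto simp: algebra_simps)
  also have "\<dots> \<le> exp (- 2 * (real (card I) * d)\<^sup>2 / (\<Sum>i\<in>I. (c - 0)\<^sup>2))"
    using c d card by (intro Hoeffding_ineq_ge) auto
  also have "(real (card I) * d)\<^sup>2 / (\<Sum>i\<in>I. (c - 0)\<^sup>2) = real (card I) * d\<^sup>2 / c\<^sup>2"
    using card c by (simp add: power2_eq_square field_simps)
  then have "- 2 * (real (card I) * d)\<^sup>2 / (\<Sum>i\<in>I. (c - 0)\<^sup>2) = - 2 * real (card I) * d\<^sup>2 / c\<^sup>2"
    by (simp only: mult.assoc times_divide_eq_right[symmetric])
  finally show ?thesis .
qed

text \<open>The upper tail bound applied to \<open>c - Y i\<close>, which has the same
  range.\<close>

lemma Hoeffding_sum_le: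
  fixes Y :: "'b \<Rightarrow> 'a \<Rightarrow> real" and c d e :: real
  assumes I: "finite I" "I \<noteq> {}" and indep: "indep_vars (\<lambda>_. borel) Y I"
    and bd: "\<And>i \<omega>. i \<in> I \<Longrightarrow> 0 \<le> Y i \<omega> \<and> Y i \<omega> \<le> c" and c: "c > 0"
    and E: "\<And>i. i \<in> I \<Longrightarrow> expectation (Y i) \<ge> e" and d: "d \<ge> 0"
  shows "prob {\<omega>\<in>space M. (\<Sum>i\<in>I. Y i \<omega>) \<le> real (card I) * (e - d)} \<le> exp (- 2 * real (card I) * d\<^sup>2 / c\<^sup>2)"
proof -
  have rv: "Y i \<in> borel_measurable M" if "i \<in> I" for i
    using indep that by (auto simp: indep_vars_def)
  have indep': "indep_vars (\<lambda>_. borel) (\<lambda>i \<omega>. c - Y i \<omega>) I"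
    using indep_vars_compose2[OF indep, of "\<lambda>_ y. c - y"] by simp
  have int: "integrable M (Y i)" if "i \<in> I" for i
    using bd[OF that] rv[OF that] by (intro integrable_const_bound[of _ c]) auto
  have "prob {\<omega>\<in>space M. (\<Sum>i\<in>I. c - Y i \<omega>) \<ge> real (card I) * ((c - e) + d)} \<le> exp (- 2 * real (card I) * d\<^sup>2 / c\<^sup>2)"
  proof (rule Hoeffding_sum_ge[OF I indep' _ c _ d])
    show "0 \<le> c - Y i \<omega> \<and> c - Y i \<omega> \<le> c" if "i \<in> I" for i \<omega> using bd[OF that, of \<omega>] by auto
    show "expectation (\<lambda>\<omega>. c - Y i \<omega>) \<le> c - e" if "i \<in> I" for i
      using E[OF that] int[OF that] by (simp add: prob_space)
  qed
  also have "{\<omega>\<in>space M. (\<Sum>i\<in>I. c - Y i \<omega>) \<ge> real (card I) * ((c - e) + d)}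
      = {\<omega>\<in>space M. (\<Sum>i\<in>I. Y i \<omega>) \<le> real (card I) * (e - d)}"
    by (auto simp: sum_subtractf algebra_simps)
  finally show ?thesis .
qed

end

locale iid_entries = prob_space M for M :: "'a measure" +
  fixes x :: "nat \<Rightarrow> nat \<Rightarrow> 'a \<Rightarrow> real" and N n :: nat and \<mu> :: "real measure"
  assumes indep_entries: "indep_vars (\<lambda>_. borel) (\<lambda>(i, j). x i j) ({..<N} \<times> {..<n})"
    and distr_entry: "\<And>i j. i < N \<Longrightarrow> j < n \<Longrightarrow> distr M borel (x i j) = \<mu>"
    and mean_law: "(\<integral>t. t \<partial>\<mu>) = 0"
    and second_moment_law: "(\<integral>t. t\<^sup>2 \<partial>\<mu>) = 1"
begin

lemma rv_entry: "i < N \<Longrightarrow> j < n \<Longrightarrow> x i j \<in> borel_measurable M"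
  using indep_entries by (auto simp: indep_vars_def)

lemma entry_integral:
  fixes h :: "real \<Rightarrow> real"
  assumes "i < N" "j < n" "h \<in> borel_measurable borel"
  shows "expectation (\<lambda>\<omega>. h (x i j \<omega>)) = (\<integral>t. h t \<partial>\<mu>)"
  using assms rv_entry[OF assms(1,2)] distr_entry[OF assms(1,2), symmetric]
  by (simp add: integral_distr)

lemma entry_moments:
  assumes ij: "i < N" "j < n"
  shows "expectation (x i j) = 0" "expectation (\<lambda>\<omega>. (x i j \<omega>)\<^sup>2) = 1"
    "integrable M (\<lambda>\<omega>. (x i j \<omega>)\<^sup>2)" "integrable M (x i j)"
proof -
  show "expectation (x i j) = 0" using entry_integral[OF ij, of "\<lambda>t. t"] mean_law by simp
  show 2: "expectation (\<lambda>\<omega>. (x i j \<omega>)\<^sup>2) = 1"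
    using entry_integral[OF ij, of "\<lambda>t. t\<^sup>2"] second_moment_law by simp
  \<comment> \<open>A function that is not integrable has integral 0, so the value 1 forces
    integrability.\<close>
  show 3: "integrable M (\<lambda>\<omega>. (x i j \<omega>)\<^sup>2)"
    using 2 not_integrable_integral_eq by fastforce
  show "integrable M (x i j)"
    by (rule square_integrable_imp_integrable[OF rv_entry[OF ij] 3])
qed

lemma entry_covariance:
  assumes "i < N" "j < n" "k < n"
  shows "expectation (\<lambda>\<omega>. x i j \<omega> * x i k \<omega>) = (if j = k then 1 else 0)"
    and "integrable M (\<lambda>\<omega>. x i j \<omega> * x i k \<omega>)"
proof -
  have "integrable M (\<lambda>\<omega>. x i j \<omega> * x i k \<omega>) \<and>
      expectation (\<lambda>\<omega>. x i j \<omega> * x i k \<omega>) = (if j = k then 1 else 0)"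
  proof (cases "j = k")
    case True
    then show ?thesis using entry_moments(2,3)[OF assms(1,2)] by (simp add: power2_eq_square)
  next
    case False
    let ?I = "{(i, j), (i, k)}"
    let ?X = "\<lambda>(i, j). x i j"
    have indep: "indep_vars (\<lambda>_. borel) ?X ?I"
      by (rule indep_vars_subset[OF indep_entries]) (use assms in auto)
    have int: "\<And>p. p \<in> ?I \<Longrightarrow> integrable M (?X p)" using entry_moments assms by auto
    have "expectation (\<lambda>\<omega>. \<Prod>p\<in>?I. ?X p \<omega>) = (\<Prod>p\<in>?I. expectation (?X p))"
      by (rule indep_vars_lebesgue_integral[OF _ indep int]) auto
    moreover have "integrable M (\<lambda>\<omega>. \<Prod>p\<in>?I. ?X p \<omega>)"
      by (rule indep_vars_integrable[OF _ indep int]) auto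
    ultimately show ?thesis using False entry_moments assms by simp
  qed
  then show "expectation (\<lambda>\<omega>. x i j \<omega> * x i k \<omega>) = (if j = k then 1 else 0)"
    and "integrable M (\<lambda>\<omega>. x i j \<omega> * x i k \<omega>)" by auto
qed

lemma row_ip_moment:
  assumes i: "i < N"
  shows "expectation (\<lambda>\<omega>. (ip n (\<lambda>j. x i j \<omega>) v)\<^sup>2) = ip n v v"
    and "integrable M (\<lambda>\<omega>. (ip n (\<lambda>j. x i j \<omega>) v)\<^sup>2)"
proof -
  have e: "(ip n (\<lambda>j. x i j \<omega>) v)\<^sup>2 = (\<Sum>j<n. \<Sum>k<n. (v j * v k) * (x i j \<omega> * x i k \<omega>))" for \<omega>
    by (simp add: ip_def power2_eq_square sum_product algebra_simps)
  have int: "integrable M (\<lambda>\<omega>. (v j * v k) * (x i j \<omega> * x i k \<omega>))" if "j < n" "k < n" for j k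
    using entry_covariance(2)[OF i that] by simp
  show "integrable M (\<lambda>\<omega>. (ip n (\<lambda>j. x i j \<omega>) v)\<^sup>2)"
    unfolding e by (intro Bochner_Integration.integrable_sum int) auto
  have "expectation (\<lambda>\<omega>. (ip n (\<lambda>j. x i j \<omega>) v)\<^sup>2)
      = (\<Sum>j<n. \<Sum>k<n. (v j * v k) * expectation (\<lambda>\<omega>. x i j \<omega> * x i k \<omega>))"
  proof -
    have "expectation (\<lambda>\<omega>. (ip n (\<lambda>j. x i j \<omega>) v)\<^sup>2)
        = (\<Sum>j<n. expectation (\<lambda>\<omega>. \<Sum>k<n. (v j * v k) * (x i j \<omega> * x i k \<omega>)))"
      unfolding e by (intro Bochner_Integration.integral_sum Bochner_Integration.integrable_sum int) auto
    also have "\<dots> = (\<Sum>j<n. \<Sum>k<n. expectation (\<lambda>\<omega>. (v j * v k) * (x i j \<omega> * x i k \<omega>)))"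
      by (intro sum.cong refl Bochner_Integration.integral_sum int) auto
    finally show ?thesis by simp
  qed
  also have "\<dots> = (\<Sum>j<n. \<Sum>k<n. if j = k then v j * v k else 0)"
    by (intro sum.cong refl) (simp add: entry_covariance i)
  finally show "expectation (\<lambda>\<omega>. (ip n (\<lambda>j. x i j \<omega>) v)\<^sup>2) = ip n v v"
    by (simp add: ip_def)
qed

lemma row_norm_moment:
  assumes i: "i < N"
  shows "expectation (\<lambda>\<omega>. ip n (\<lambda>j. x i j \<omega>) (\<lambda>j. x i j \<omega>)) = n"
    and "integrable M (\<lambda>\<omega>. ip n (\<lambda>j. x i j \<omega>) (\<lambda>j. x i j \<omega>))"
  unfolding ip_def using i
  by (auto intro!: Bochner_Integration.integrable_sum simp: entry_covariance)

lemma row_resid_moment: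
  assumes i: "i < N" and L: "finite L"
  shows "expectation (\<lambda>\<omega>. resid n L p (\<lambda>j. x i j \<omega>)) = n - (\<Sum>l\<in>L. ip n (p l) (p l))"
    and "integrable M (\<lambda>\<omega>. resid n L p (\<lambda>j. x i j \<omega>))"
  unfolding resid_def using i L
  by (simp_all add: row_norm_moment row_ip_moment)

text \<open>The entries are grouped into the disjoint blocks \<open>{i} \<times> {..<n}\<close>. The
  assumption \<open>cong\<close> says that \<open>F i\<close> ignores coordinates from
  \<open>n\<close> on, so that a row may be exchanged with its restriction to the block.\<close>

lemma indep_rows:
  fixes F :: "nat \<Rightarrow> (nat \<Rightarrow> real) \<Rightarrow> real"
  assumes I: "I \<subseteq> {..<N}"
    and meas: "\<And>i. i \<in> I \<Longrightarrow>
      (\<lambda>f. F i (\<lambda>j. f (i, j))) \<in> borel_measurable (PiM ({i} \<times> {..<n}) (\<lambda>_. borel))"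
    and cong: "\<And>i r r'. (\<And>j. j < n \<Longrightarrow> r j = r' j) \<Longrightarrow> F i r = F i r'"
  shows "indep_vars (\<lambda>_. borel) (\<lambda>i \<omega>. F i (\<lambda>j. x i j \<omega>)) I"
proof -
  have "indep_vars (\<lambda>i. PiM ({i} \<times> {..<n}) (\<lambda>_. borel))
      (\<lambda>i \<omega>. restrict (\<lambda>p. (\<lambda>(i, j). x i j) p \<omega>) ({i} \<times> {..<n})) I"
    by (rule indep_vars_restrict[OF indep_entries]) (use I in \<open>auto simp: disjoint_family_on_def\<close>)
  from indep_vars_compose2[OF this, of "\<lambda>i f. F i (\<lambda>j. f (i, j))" "\<lambda>_. borel"] meas
  have "indep_vars (\<lambda>_. borel) (\<lambda>i \<omega>. F i (\<lambda>j. restrict (\<lambda>p. (\<lambda>(i, j). x i j) p \<omega>) ({i} \<times> {..<n}) (i, j))) I"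
    by simp
  moreover have "F i (\<lambda>j. restrict (\<lambda>p. (\<lambda>(i, j). x i j) p \<omega>) ({i} \<times> {..<n}) (i, j)) = F i (\<lambda>j. x i j \<omega>)" for i \<omega>
    by (rule cong) auto
  ultimately show ?thesis by simp
qed

end

section \<open>The upper bound on the small singular values\<close>

lemma measurable_ip:
  assumes "\<And>j. j < n \<Longrightarrow> (\<lambda>z. U z j) \<in> borel_measurable S" "\<And>j. j < n \<Longrightarrow> (\<lambda>z. V z j) \<in> borel_measurable S"
  shows "(\<lambda>z. ip n (U z) (V z)) \<in> borel_measurable S"
  unfolding ip_def using assms by (intro borel_measurable_sum borel_measurable_times) auto

lemma measurable_resid:
  assumes "\<And>l j. l \<in> L \<Longrightarrow> j < n \<Longrightarrow> (\<lambda>z. P z l j) \<in> borel_measurable S"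
    and "\<And>j. j < n \<Longrightarrow> (\<lambda>z. V z j) \<in> borel_measurable S"
  shows "(\<lambda>z. resid n L (P z) (V z)) \<in> borel_measurable S"
  unfolding resid_def using assms
  by (intro borel_measurable_diff borel_measurable_sum borel_measurable_power measurable_ip) auto

lemma measurable_gs:
  assumes "\<And>l j. l \<le> i \<Longrightarrow> j < n \<Longrightarrow> (\<lambda>z. R z l j) \<in> borel_measurable S" "j < n"
  shows "(\<lambda>z. gs n (R z) i j) \<in> borel_measurable S"
  using assms
proof (induction i arbitrary: j rule: less_induct)
  case (less i)
  define w where "w z = (\<lambda>j. R z i j - (\<Sum>l<i. ip n (R z i) (gs n (R z) l) * gs n (R z) l j))" for z
  have g: "gs n (R z) i j = w z j / sqrt (ip n (w z) (w z))" for z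
    by (subst gs.simps) (simp add: w_def Let_def)
  have IH: "(\<lambda>z. gs n (R z) l j) \<in> borel_measurable S" if "l < i" "j < n" for l j
    using that less by simp
  have w: "(\<lambda>z. w z j) \<in> borel_measurable S" if "j < n" for j
    unfolding w_def using IH less.prems(1) that
    by (intro borel_measurable_diff borel_measurable_sum borel_measurable_times measurable_ip) auto
  have "(\<lambda>z. ip n (w z) (w z)) \<in> borel_measurable S" by (intro measurable_ip w)
  then show ?case unfolding g using w[OF less.prems(2)] by measurable
qed

text \<open>By independence the joint law is a product. Fubini then integrates the bound, which
  holds for every frozen value of \<open>X\<close>, over the law of \<open>X\<close>.\<close>

lemma (in prob_space) prob_indep_pair_le:
  assumes indep: "indep_var S X T Y"
    and Q: "{z \<in> space (S \<Otimes>\<^sub>M T). Q (fst z) (snd z)} \<in> sets (S \<Otimes>\<^sub>M T)"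
    and le: "\<And>s. s \<in> space S \<Longrightarrow> prob {\<omega>\<in>space M. Q s (Y \<omega>)} \<le> \<delta>" and \<delta>: "\<delta> \<ge> 0"
  shows "prob {\<omega>\<in>space M. Q (X \<omega>) (Y \<omega>)} \<le> \<delta>"
proof -
  let ?A = "{z \<in> space (S \<Otimes>\<^sub>M T). Q (fst z) (snd z)}"
  from indep have rv[measurable]: "X \<in> measurable M S" "Y \<in> measurable M T"
    and D: "distr M S X \<Otimes>\<^sub>M distr M T Y = distr M (S \<Otimes>\<^sub>M T) (\<lambda>\<omega>. (X \<omega>, Y \<omega>))"
    by (auto simp: indep_var_distribution_eq)
  interpret DX: prob_space "distr M S X" by (intro prob_space_distr rv)
  interpret DY: prob_space "distr M T Y" by (intro prob_space_distr rv)
  have sp: "X \<omega> \<in> space S" "Y \<omega> \<in> space T" if "\<omega> \<in> space M" for \<omega>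
    using that rv by (auto simp: measurable_def)
  have "emeasure M {\<omega>\<in>space M. Q (X \<omega>) (Y \<omega>)} = emeasure (distr M (S \<Otimes>\<^sub>M T) (\<lambda>\<omega>. (X \<omega>, Y \<omega>))) ?A"
    using Q sp by (subst emeasure_distr) (auto simp: space_pair_measure intro!: arg_cong[of _ _ "emeasure M"])
  also have "\<dots> = (\<integral>\<^sup>+s. emeasure (distr M T Y) (Pair s -` ?A) \<partial>distr M S X)"
  proof -
    have "sets (distr M S X \<Otimes>\<^sub>M distr M T Y) = sets (S \<Otimes>\<^sub>M T)"
      by (intro sets_pair_measure_cong sets_distr)
    with Q have "?A \<in> sets (distr M S X \<Otimes>\<^sub>M distr M T Y)" by (simp only:)
    then show ?thesis unfolding D[symmetric] by (rule DY.emeasure_pair_measure_alt)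
  qed
  also have "\<dots> \<le> (\<integral>\<^sup>+s. ennreal \<delta> \<partial>distr M S X)"
  proof (rule nn_integral_mono)
    fix s assume "s \<in> space (distr M S X)"
    then have s: "s \<in> space S" by simp
    have "emeasure (distr M T Y) (Pair s -` ?A) = emeasure M (Y -` (Pair s -` ?A) \<inter> space M)"
      by (intro emeasure_distr rv sets_Pair1[OF Q])
    also have "Y -` (Pair s -` ?A) \<inter> space M = {\<omega>\<in>space M. Q s (Y \<omega>)}"
      using s sp by (auto simp: space_pair_measure)
    also have "emeasure M \<dots> \<le> ennreal \<delta>"
      using le[OF s] by (simp add: emeasure_eq_measure ennreal_leI)
    finally show "emeasure (distr M T Y) (Pair s -` ?A) \<le> ennreal \<delta>" .
  qed
  also have "\<dots> = ennreal \<delta>" by (simp add: DX.emeasure_space_1 del: emeasure_distr space_distr)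
  finally show ?thesis using \<delta> by (simp add: emeasure_eq_measure)
qed

context iid_entries
begin

text \<open>
  Truncating at \<open>B n\<close> makes Hoeffding's inequality applicable without assumptions on the tails.
  In the application \<open>p\<close> is the Gram--Schmidt system of the first \<open>m\<close> rows.
\<close>

definition atypical :: "nat \<Rightarrow> real \<Rightarrow> real \<Rightarrow> (nat \<Rightarrow> nat \<Rightarrow> real) \<Rightarrow> (nat \<Rightarrow> nat \<Rightarrow> real) \<Rightarrow> bool" where
  "atypical m B t p g \<longleftrightarrow>
     (\<Sum>i\<in>{m..<N}. of_bool (resid n {..<m} p (g i) > B * real n)) \<ge> real (card {m..<N}) * (1 / B + 1 / B) \<or>
     (\<Sum>i\<in>{m..<N}. if resid n {..<m} p (g i) > B * real n then 0 else resid n {..<m} p (g i))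
       \<ge> real (card {m..<N}) * (real n - (\<Sum>l<m. ip n (p l) (p l)) + t * real n)"

lemma atypical_cong:
  assumes "\<And>l j. l < m \<Longrightarrow> j < n \<Longrightarrow> p l j = p' l j"
    "\<And>i j. m \<le> i \<Longrightarrow> i < N \<Longrightarrow> j < n \<Longrightarrow> g i j = g' i j"
  shows "atypical m B t p g \<longleftrightarrow> atypical m B t p' g'"
proof -
  have "resid n {..<m} p (g i) = resid n {..<m} p' (g' i)" if "i \<in> {m..<N}" for i
    using that assms by (intro resid_cong) auto
  moreover have "ip n (p l) (p l) = ip n (p' l) (p' l)" if "l < m" for l
    using that assms by (intro ip_cong) auto
  ultimately show ?thesis unfolding atypical_def by (simp cong: if_cong)
qed

lemma measurable_atypical:
  assumes P: "\<And>l j. l < m \<Longrightarrow> j < n \<Longrightarrow> (\<lambda>z. P z l j) \<in> borel_measurable S"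
    and G: "\<And>i j. m \<le> i \<Longrightarrow> i < N \<Longrightarrow> j < n \<Longrightarrow> (\<lambda>z. G z i j) \<in> borel_measurable S"
  shows "{z \<in> space S. atypical m B t (P z) (G z)} \<in> sets S"
proof -
  define r where "r z i = resid n {..<m} (P z) (G z i)" for z i
  define q where "q z l = ip n (P z l) (P z l)" for z l
  have [measurable]: "(\<lambda>z. r z i) \<in> borel_measurable S" if "i \<in> {m..<N}" for i
    unfolding r_def using assms that by (intro measurable_resid) auto
  have [measurable]: "(\<lambda>z. q z l) \<in> borel_measurable S" if "l \<in> {..<m}" for l
    unfolding q_def using assms that by (intro measurable_ip) auto
  have [measurable]: "(\<lambda>z. \<Sum>i\<in>{m..<N}. of_bool (r z i > B * real n) :: real) \<in> borel_measurable S"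
    by (rule borel_measurable_sum) simp
  have [measurable]: "(\<lambda>z. \<Sum>i\<in>{m..<N}. if r z i > B * real n then 0 else r z i) \<in> borel_measurable S"
    by (rule borel_measurable_sum) simp
  have [measurable]: "(\<lambda>z. \<Sum>l<m. q z l) \<in> borel_measurable S"
    by (rule borel_measurable_sum) simp
  show ?thesis unfolding atypical_def r_def[symmetric] q_def[symmetric]
    by (intro sets.sets_Collect_disj borel_measurable_le; measurable)
qed

lemma prob_atypical_fixed:
  fixes B t :: real
  assumes p: "orthosystem n {..<m} p" and m: "m < N" and n: "n > 0" and B: "B > 0" and t: "t \<ge> 0"
  shows "prob {\<omega>\<in>space M. atypical m B t p (\<lambda>i j. x i j \<omega>)}
    \<le> exp (- 2 * real (N - m) / B\<^sup>2) + exp (- 2 * real (N - m) * t\<^sup>2 / B\<^sup>2)"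
proof -
  let ?r = "\<lambda>i \<omega>. resid n {..<m} p (\<lambda>j. x i j \<omega>)"
  let ?D = "real n - (\<Sum>l<m. ip n (p l) (p l))"
  define Y where "Y i \<omega> = (of_bool (?r i \<omega> > B * real n) :: real)" for i \<omega>
  define Z where "Z i \<omega> = (if ?r i \<omega> > B * real n then 0 else ?r i \<omega>)" for i \<omega>
  have r0: "?r i \<omega> \<ge> 0" for i \<omega> by (rule resid_nonneg[OF p])
  have row_meas: "(\<lambda>f. resid n {..<m} p (\<lambda>j. f (i, j))) \<in> borel_measurable (PiM ({i} \<times> {..<n}) (\<lambda>_. borel))" for i :: nat
    by (intro measurable_resid) auto
  have meas_r[measurable]: "?r i \<in> borel_measurable M" if "i < N" for i
    using rv_entry that by (intro measurable_resid) auto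
  \<comment> \<open>\<open>?D\<close> is nonnegative because it is the mean of a nonnegative squared
    distance.\<close>
  have D: "0 \<le> ?D" "?D \<le> n"
  proof -
    show "0 \<le> ?D" using row_resid_moment(1)[of m "{..<m}" p] m r0
      by (metis Bochner_Integration.integral_nonneg finite_lessThan)
    show "?D \<le> n" using ip_self_nonneg by (simp add: sum_nonneg)
  qed
  \<comment> \<open>The first \<open>1 / B\<close> bounds the mean by Markov's inequality, since the
    expected squared distance \<open>?D\<close> is at most \<open>n\<close>. The second
    \<open>1 / B\<close> is the deviation given to Hoeffding's inequality.\<close>
  have hY: "prob {\<omega>\<in>space M. (\<Sum>i\<in>{m..<N}. Y i \<omega>) \<ge> real (card {m..<N}) * (1 / B + 1 / B)}
      \<le> exp (- 2 * real (card {m..<N}) * (1 / B)\<^sup>2 / 1\<^sup>2)"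
  proof (rule Hoeffding_sum_ge)
    show "indep_vars (\<lambda>_. borel) Y {m..<N}"
      unfolding Y_def
    proof (rule indep_rows[where F = "\<lambda>i r. of_bool (resid n {..<m} p r > B * real n)"])
      fix i r r' assume "\<And>j. j < n \<Longrightarrow> r j = (r' j :: real)"
      then show "of_bool (resid n {..<m} p r > B * real n) = (of_bool (resid n {..<m} p r' > B * real n) :: real)"
        using resid_cong[of n r r' "{..<m}" p p] by simp
    qed (use row_meas in \<open>auto\<close>)
    show "expectation (Y i) \<le> 1 / B" if "i \<in> {m..<N}" for i
    proof -
      have i: "i < N" using that by simp
      have "expectation (Y i) \<le> expectation (\<lambda>\<omega>. ?r i \<omega> / (B * real n))"
      proof (rule integral_mono)
        show "integrable M (Y i)" unfolding Y_def using meas_r[OF i]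
          by (intro integrable_const_bound[of _ 1]) auto
        show "integrable M (\<lambda>\<omega>. ?r i \<omega> / (B * real n))"
          using row_resid_moment(2)[OF i, of "{..<m}" p] by simp
        show "Y i \<omega> \<le> ?r i \<omega> / (B * real n)" for \<omega>
          using r0[of i \<omega>] B n by (auto simp: Y_def field_simps)
      qed
      also have "\<dots> = ?D / (B * real n)" using row_resid_moment(1)[OF i, of "{..<m}" p] by simp
      also have "\<dots> \<le> n / (B * real n)" using D B n by (intro divide_right_mono) auto
      finally show ?thesis using n by simp
    qed
  qed (use m B in \<open>auto simp: Y_def\<close>)
  \<comment> \<open>Truncation lowers the mean, which stays at most \<open>?D\<close>. Range and
    deviation both scale with \<open>n\<close>, which therefore cancels in the exponent.\<close>
  have hZ: "prob {\<omega>\<in>space M. (\<Sum>i\<in>{m..<N}. Z i \<omega>) \<ge> real (card {m..<N}) * (?D + t * real n)}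
      \<le> exp (- 2 * real (card {m..<N}) * (t * real n)\<^sup>2 / (B * real n)\<^sup>2)"
  proof (rule Hoeffding_sum_ge)
    show "indep_vars (\<lambda>_. borel) Z {m..<N}"
      unfolding Z_def
    proof (rule indep_rows[where F = "\<lambda>i r. if resid n {..<m} p r > B * real n then 0 else resid n {..<m} p r"])
      fix i r r' assume "\<And>j. j < n \<Longrightarrow> r j = (r' j :: real)"
      then show "(if resid n {..<m} p r > B * real n then 0 else resid n {..<m} p r) =
          (if resid n {..<m} p r' > B * real n then 0 else resid n {..<m} p r')"
        using resid_cong[of n r r' "{..<m}" p p] by simp
    qed (use row_meas in \<open>auto\<close>)
    show "expectation (Z i) \<le> ?D" if "i \<in> {m..<N}" for i
    proof -
      have i: "i < N" using that by simp
      have "expectation (Z i) \<le> expectation (?r i)"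
      proof (rule integral_mono)
        show "integrable M (Z i)" unfolding Z_def using meas_r[OF i] r0 n B
          by (intro integrable_const_bound[of _ "B * real n"]) auto
        show "integrable M (?r i)" using row_resid_moment(2)[OF i, of "{..<m}" p] by simp
        show "Z i \<omega> \<le> ?r i \<omega>" for \<omega>
          using r0[of i \<omega>] by (auto simp: Z_def)
      qed
      then show ?thesis using row_resid_moment(1)[OF i, of "{..<m}" p] by simp
    qed
    show "0 \<le> Z i \<omega> \<and> Z i \<omega> \<le> B * real n" for i \<omega> using r0[of i \<omega>] B by (auto simp: Z_def)
  qed (use m B t n in auto)
  have eZ: "- 2 * real (card {m..<N}) * (t * real n)\<^sup>2 / (B * real n)\<^sup>2 = - 2 * real (N - m) * t\<^sup>2 / B\<^sup>2"
    using n B by (simp add: power_mult_distrib)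
  have eY: "- 2 * real (card {m..<N}) * (1 / B)\<^sup>2 / 1\<^sup>2 = - 2 * real (N - m) / B\<^sup>2"
    by (simp add: power_divide)
  have union: "prob {\<omega>\<in>space M. atypical m B t p (\<lambda>i j. x i j \<omega>)}
    \<le> prob {\<omega>\<in>space M. (\<Sum>i\<in>{m..<N}. Y i \<omega>) \<ge> real (card {m..<N}) * (1 / B + 1 / B)} +
      prob {\<omega>\<in>space M. (\<Sum>i\<in>{m..<N}. Z i \<omega>) \<ge> real (card {m..<N}) * (?D + t * real n)}"
  proof -
    have [measurable]: "Y i \<in> borel_measurable M" "Z i \<in> borel_measurable M" if "i \<in> {m..<N}" for i
      using that meas_r[of i] unfolding Y_def Z_def by auto
    have eq: "{\<omega>\<in>space M. atypical m B t p (\<lambda>i j. x i j \<omega>)} =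
       {\<omega>\<in>space M. (\<Sum>i\<in>{m..<N}. Y i \<omega>) \<ge> real (card {m..<N}) * (1 / B + 1 / B)} \<union>
       {\<omega>\<in>space M. (\<Sum>i\<in>{m..<N}. Z i \<omega>) \<ge> real (card {m..<N}) * (?D + t * real n)}"
      by (auto simp: atypical_def Y_def Z_def)
    show ?thesis unfolding eq by (rule measure_Un_le; measurable)
  qed
  show ?thesis
    by (rule order.trans[OF union add_mono[OF hY[unfolded eY] hZ[unfolded eZ]]])
qed

text \<open>The Gram--Schmidt system of the first \<open>m\<close> rows is independent of the later
  rows. Conditioning on the first \<open>m\<close> rows reduces the claim to a fixed
  orthosystem.\<close>

lemma prob_atypical:
  fixes B t :: real
  assumes m: "m < N" and n: "n > 0" and B: "B > 0" and t: "t \<ge> 0"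
  shows "prob {\<omega>\<in>space M. atypical m B t (gs n (\<lambda>i j. x i j \<omega>)) (\<lambda>i j. x i j \<omega>)}
    \<le> exp (- 2 * real (N - m) / B\<^sup>2) + exp (- 2 * real (N - m) * t\<^sup>2 / B\<^sup>2)" (is "_ \<le> ?\<delta>")
proof -
  let ?I = "{..<m} \<times> {..<n}" and ?J = "{m..<N} \<times> {..<n}"
  let ?S = "PiM ?I (\<lambda>_. borel :: real measure)" and ?T = "PiM ?J (\<lambda>_. borel :: real measure)"
  let ?X = "\<lambda>\<omega>. restrict (\<lambda>q. (\<lambda>(i, j). x i j) q \<omega>) ?I"
  let ?Y = "\<lambda>\<omega>. restrict (\<lambda>q. (\<lambda>(i, j). x i j) q \<omega>) ?J"
  let ?Q = "\<lambda>f g. atypical m B t (gs n (\<lambda>i j. f (i, j))) (\<lambda>i j. g (i, j))"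
  have "prob {\<omega>\<in>space M. ?Q (?X \<omega>) (?Y \<omega>)} \<le> ?\<delta>"
  proof (rule prob_indep_pair_le[where Q = ?Q and S = ?S and T = ?T and X = ?X and Y = ?Y])
    show "indep_var ?S ?X ?T ?Y"
      by (rule indep_var_restrict[OF indep_entries]) (use m in auto)
    show "{z \<in> space (?S \<Otimes>\<^sub>M ?T). ?Q (fst z) (snd z)} \<in> sets (?S \<Otimes>\<^sub>M ?T)"
    proof (intro measurable_atypical measurable_gs)
      fix i j assume "m \<le> i" "i < N" "j < n"
      then have "(\<lambda>f. f (i, j)) \<in> borel_measurable ?T" by (intro measurable_component_singleton) auto
      then show "(\<lambda>z. snd z (i, j)) \<in> borel_measurable (?S \<Otimes>\<^sub>M ?T)"
        by (rule measurable_compose[OF measurable_snd])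
    next
      fix l l' j assume "l < m" "l' \<le> l" "j < n"
      then have "(\<lambda>f. f (l', j)) \<in> borel_measurable ?S" by (intro measurable_component_singleton) auto
      then show "(\<lambda>z. fst z (l', j)) \<in> borel_measurable (?S \<Otimes>\<^sub>M ?T)"
        by (rule measurable_compose[OF measurable_fst])
    qed auto
    fix f assume "f \<in> space ?S"
    have "?Q f (?Y \<omega>) \<longleftrightarrow> atypical m B t (gs n (\<lambda>i j. f (i, j))) (\<lambda>i j. x i j \<omega>)" for \<omega>
      by (rule atypical_cong) auto
    then show "prob {\<omega>\<in>space M. ?Q f (?Y \<omega>)} \<le> ?\<delta>"
      using prob_atypical_fixed[OF orthosystem_gs m n B t] by simp
  qed auto
  moreover have "?Q (?X \<omega>) (?Y \<omega>) \<longleftrightarrow> atypical m B t (gs n (\<lambda>i j. x i j \<omega>)) (\<lambda>i j. x i j \<omega>)" for \<omega>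
    by (intro atypical_cong gs_cong) auto
  ultimately show ?thesis by simp
qed

end

text \<open>\<open>D\<close> is the dimension of the complement, \<open>b\<close> the number of
  dimensions given up, \<open>Nm\<close> the number of rows still acting. As
  \<open>N \<le> 2 * a * n\<close>, the \<open>n / 3\<close> rows saved amount to at least
  \<open>2 * c * N\<close>. The errors of relative size \<open>c / 2\<close> on both sides are
  absorbed by \<open>(1 - 2 * c) * (1 + c / 2) \<le> (1 - c) * (1 - c / 2)\<close>.\<close>

lemma upper_bound_arith:
  fixes s2 D Nm N n b c a :: real
  assumes a: "a > 1" and c: "c = 1 / (12 * a)" and N: "0 < N" "N \<le> 2 * a * n"
    and Nm: "0 \<le> Nm" "Nm \<le> N - n / 3" and D: "D \<ge> n / 2" and b: "b \<le> c / 4 * n"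
    and le: "s2 * (D - b) \<le> Nm * (D + c / 4 * n)" and s2: "s2 \<ge> 0"
  shows "s2 \<le> (1 - c) * N"
proof -
  have n: "n > 0" using N a by (smt (verit) mult_nonneg_nonpos)
  have c01: "0 < c" "c < 1 / 12" unfolding c using a by (auto simp: field_simps)
  have Dpos: "D > 0" using D n by simp
  have "2 * c * N \<le> n / 3" using N a unfolding c by (simp add: field_simps)
  then have Nm': "Nm \<le> (1 - 2 * c) * N" using Nm by (simp add: algebra_simps)
  have cn: "c / 4 * n \<le> c / 2 * D" using D c01 by (simp add: mult_left_mono)
  have "s2 * ((1 - c / 2) * D) \<le> s2 * (D - b)"
    using cn b s2 by (intro mult_left_mono) (auto simp: algebra_simps)
  also have "\<dots> \<le> Nm * (D + c / 4 * n)" by (rule le)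
  also have "\<dots> \<le> ((1 - 2 * c) * N) * ((1 + c / 2) * D)"
    using Nm' cn Nm Dpos c01 n N by (intro mult_mono) (auto simp: algebra_simps)
  finally have "(s2 * (1 - c / 2)) * D \<le> ((1 - 2 * c) * N * (1 + c / 2)) * D"
    by (simp add: algebra_simps)
  then have "s2 * (1 - c / 2) \<le> N * ((1 - 2 * c) * (1 + c / 2))"
    using Dpos by (simp add: mult.commute mult.left_commute)
  also have "\<dots> \<le> N * ((1 - c) * (1 - c / 2))"
    using N by (intro mult_left_mono) (auto simp: algebra_simps)
  also have "\<dots> = ((1 - c) * N) * (1 - c / 2)" by simp
  finally show ?thesis using c01 by simp
qed

context iid_entries
begin

text \<open>The rows at squared distance above \<open>B * n\<close> are taken as the bad rows. There
  are at most \<open>(N - m) * (2 / B)\<close> of them, and the distances of the others add up to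
  the truncated sum.\<close>

lemma not_atypical_imp_singular_value_le:
  fixes Mx :: "real mat"
  assumes Mx: "Mx \<in> carrier_mat N n" and k: "1 \<le> k" "k \<le> n" and m: "m < N" and B: "B > 0"
  defines "r \<equiv> (\<lambda>i j. Mx $$ (i, j))"
  assumes typical: "\<not> atypical m B t (gs n r) r"
  defines "D \<equiv> real n - (\<Sum>l<m. ip n (gs n r l) (gs n r l))"
  shows "(kth_smallest_singular_value Mx k)\<^sup>2 * (D - (real (N - m) * (2 / B) + real (k - 1)))
    \<le> real (N - m) * (D + t * real n)"
proof -
  define Bad where "Bad = {i\<in>{m..<N}. resid n {..<m} (gs n r) (r i) > B * real n}"
  have "real (card Bad) = (\<Sum>i\<in>{m..<N}. of_bool (resid n {..<m} (gs n r) (r i) > B * real n))"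
    by (simp add: Bad_def Int_def)
  also have "\<dots> \<le> real (N - m) * (2 / B)" using typical by (simp add: atypical_def)
  finally have Bad: "real (card Bad) \<le> real (N - m) * (2 / B)" .
  have "(kth_smallest_singular_value Mx k)\<^sup>2 * (D - (real (N - m) * (2 / B) + real (k - 1)))
      \<le> (kth_smallest_singular_value Mx k)\<^sup>2 * (D - real (card Bad) - real (k - 1))"
    using Bad by (intro mult_left_mono) auto
  also have "\<dots> \<le> (\<Sum>i\<in>{m..<N} - Bad. resid n {..<m} (gs n r) (r i))"
    unfolding D_def r_def
    by (intro kth_smallest_singular_value_le_good_rows Mx k) (use m in \<open>auto simp: Bad_def\<close>)
  also have "\<dots> = (\<Sum>i\<in>{m..<N}. if resid n {..<m} (gs n r) (r i) > B * real n then 0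
      else resid n {..<m} (gs n r) (r i))"
    by (intro sum.mono_neutral_cong_left) (auto simp: Bad_def)
  also have "\<dots> \<le> real (N - m) * (D + t * real n)"
    using typical by (simp add: atypical_def D_def)
  finally show ?thesis .
qed

text \<open>One event serves all small \<open>k\<close>, because being typical concerns only the
  span of the first half of the rows and the distances of the other rows from it.\<close>

lemma small_singular_values_event:
  fixes X :: "'a \<Rightarrow> real mat" and a :: real
  assumes a: "a > 1" and n: "2 \<le> n" "n \<le> N" and N: "real N \<le> 2 * a * real n"
    and X: "\<And>\<omega>. \<omega> \<in> space M \<Longrightarrow> X \<omega> \<in> carrier_mat N n"
    and x: "\<And>i j \<omega>. x i j \<omega> = X \<omega> $$ (i, j)"
  defines "c \<equiv> 1 / (12 * a)"
  shows "\<exists>E\<in>events. 1 - prob E \<le> 2 * exp (- (c\<^sup>2 / (128 * a))\<^sup>2 * real n) \<and>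
    (\<forall>\<omega>\<in>E. \<forall>k. 1 \<le> k \<and> real k \<le> c / 8 * real n \<longrightarrow>
      (kth_smallest_singular_value (X \<omega>) k)\<^sup>2 \<le> (1 - c) * real N)"
proof -
  \<comment> \<open>With this choice there are at most \<open>c / 8 * n\<close> bad rows, which
    leaves another \<open>c / 8 * n\<close> dimensions for \<open>k\<close>.\<close>
  define B where "B = 32 * a / c"
  define t where "t = c / 4"
  define m where "m = n div 2"
  have c: "c > 0" "c < 1 / 12" using a by (auto simp: c_def field_simps)
  have B: "B > 0" using a c by (simp add: B_def)
  have t: "t > 0" "t < 1" using c by (auto simp: t_def)
  \<comment> \<open>At least half of the dimensions remain, while at most \<open>N - n / 3\<close>
    rows still act. The bound \<open>n \<le> 3 * m\<close> uses \<open>n \<ge> 2\<close>.\<close>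
  have m: "m < N" "n \<le> 3 * m" "2 * m \<le> n" using n unfolding m_def by linarith+
  let ?bad = "{\<omega>\<in>space M. atypical m B t (gs n (\<lambda>i j. x i j \<omega>)) (\<lambda>i j. x i j \<omega>)}"
  have bad: "?bad \<in> events"
    using m by (intro measurable_atypical measurable_gs rv_entry) auto
  define E where "E = space M - ?bad"
  have E: "E \<in> events" using bad by (simp add: E_def)
  have gam: "t\<^sup>2 / B\<^sup>2 = (c\<^sup>2 / (128 * a))\<^sup>2"
    using a c by (simp add: t_def B_def field_simps power2_eq_square)
  have Nm: "2 * real (N - m) \<ge> real n" using m n by linarith
  have 1: "- 2 * real (N - m) * t\<^sup>2 / B\<^sup>2 \<le> - (c\<^sup>2 / (128 * a))\<^sup>2 * real n"
  proof -
    have "(t\<^sup>2 / B\<^sup>2) * real n \<le> (t\<^sup>2 / B\<^sup>2) * (2 * real (N - m))" by (intro mult_left_mono Nm) auto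
    then show ?thesis unfolding gam[symmetric] by (simp add: mult.commute mult.left_commute)
  qed
  have "2 * real (N - m) * t\<^sup>2 / B\<^sup>2 \<le> 2 * real (N - m) / B\<^sup>2"
    using t by (intro divide_right_mono) (auto intro!: mult_left_le power_le_one)
  then have 2: "- 2 * real (N - m) / B\<^sup>2 \<le> - (c\<^sup>2 / (128 * a))\<^sup>2 * real n" using 1 by simp
  have "1 - prob E = prob ?bad" unfolding E_def using bad by (simp add: prob_compl)
  also have "\<dots> \<le> exp (- 2 * real (N - m) / B\<^sup>2) + exp (- 2 * real (N - m) * t\<^sup>2 / B\<^sup>2)"
    by (rule prob_atypical) (use m n B t in auto)
  also have "\<dots> \<le> exp (- (c\<^sup>2 / (128 * a))\<^sup>2 * real n) + exp (- (c\<^sup>2 / (128 * a))\<^sup>2 * real n)"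
    using 1 2 by (intro add_mono) auto
  finally have pE: "1 - prob E \<le> 2 * exp (- (c\<^sup>2 / (128 * a))\<^sup>2 * real n)" by simp
  have "(kth_smallest_singular_value (X \<omega>) k)\<^sup>2 \<le> (1 - c) * real N"
    if \<omega>: "\<omega> \<in> E" and k: "1 \<le> k" "real k \<le> c / 8 * real n" for \<omega> k
  proof -
    let ?r = "\<lambda>i j. X \<omega> $$ (i, j)"
    let ?D = "real n - (\<Sum>l<m. ip n (gs n ?r l) (gs n ?r l))"
    have kn: "k \<le> n"
    proof -
      have "c / 8 * real n \<le> 1 * real n" using c by (intro mult_right_mono) auto
      then show ?thesis using k by linarith
    qed
    have "(\<Sum>l<m. ip n (gs n ?r l) (gs n ?r l)) \<le> (\<Sum>l<m. 1)"
    proof (rule sum_mono)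
      fix l assume "l \<in> {..<m}"
      then have "ip n (gs n ?r l) (gs n ?r l) \<in> {0, 1}"
        using orthosystem_gs[of n m ?r] by (simp add: orthosystem_def)
      then show "ip n (gs n ?r l) (gs n ?r l) \<le> 1" by auto
    qed
    then have D: "?D \<ge> real n / 2" using m by simp
    show ?thesis
    proof (rule upper_bound_arith[OF a c_def[THEN meta_eq_to_obj_eq]])
      show "(kth_smallest_singular_value (X \<omega>) k)\<^sup>2 * (?D - (real (N - m) * (2 / B) + real (k - 1)))
          \<le> real (N - m) * (?D + c / 4 * real n)"
        unfolding t_def[symmetric]
        by (rule not_atypical_imp_singular_value_le) (use \<omega> X k kn m B in \<open>auto simp: E_def x\<close>)
      have "real (N - m) * (2 / B) \<le> (2 * a * real n) * (2 / B)"
        using N B by (intro mult_right_mono) auto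
      also have "\<dots> = c / 8 * real n" using a c by (simp add: B_def)
      finally show "real (N - m) * (2 / B) + real (k - 1) \<le> c / 4 * real n" using k by simp
    qed (use n N D m in auto)
  qed
  then show ?thesis using E pE by blast
qed

end

section \<open>The lower bound on vectors of small \<open>l\<^sup>1\<close> norm\<close>

text \<open>Multiplied by \<open>exp z\<close>, the claim follows from the Taylor lower bound for
  \<open>exp z\<close>, because \<open>(1 - z + z^2/2) (1 + z + z^2/2) = 1 + z^4/4\<close>.\<close>

lemma exp_minus_le_quadratic:
  fixes z :: real
  assumes "z \<ge> 0" shows "exp (- z) \<le> 1 - z + z\<^sup>2 / 2"
proof -
  have "1 \<le> 1 + (z\<^sup>2)\<^sup>2 / 4" by simp
  also have "\<dots> = (1 - z + z\<^sup>2 / 2) * (1 + z + z\<^sup>2 / 2)"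
    by (simp add: algebra_simps power2_eq_square)
  also have "\<dots> \<le> (1 - z + z\<^sup>2 / 2) * exp z"
  proof (rule mult_left_mono)
    show "1 + z + z\<^sup>2 / 2 \<le> exp z" using exp_lower_Taylor_quadratic[OF assms] by simp
    have "1 - z + z\<^sup>2 / 2 = ((1 - z)\<^sup>2 + 1) / 2" by (simp add: algebra_simps power2_eq_square)
    then show "0 \<le> 1 - z + z\<^sup>2 / 2" by (simp only:) simp
  qed
  finally show ?thesis by (simp add: exp_minus field_simps)
qed

lemma one_minus_cos_le: "1 - cos y \<le> (y :: real)\<^sup>2 / 2"
proof -
  have "1 - cos y = 2 * (sin (y / 2))\<^sup>2" using cos_double_sin[of "y / 2"] by simp
  also have "\<dots> \<le> 2 * (y / 2)\<^sup>2"
    using abs_sin_x_le_abs_x[of "y / 2"] unfolding abs_le_square_iff by simp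
  finally show ?thesis by (simp add: power2_eq_square)
qed

lemma abs_cos_diff_le: "\<bar>cos u - cos v\<bar> \<le> \<bar>u - v\<bar>" for u v :: real
proof -
  have "\<bar>cos u - cos v\<bar> = 2 * \<bar>sin ((u + v) / 2)\<bar> * \<bar>sin ((v - u) / 2)\<bar>"
    by (simp add: cos_diff_cos abs_mult)
  also have "\<dots> \<le> 2 * 1 * \<bar>(v - u) / 2\<bar>"
    by (intro mult_mono abs_sin_x_le_abs_x) auto
  finally show ?thesis by simp
qed

text \<open>A bounded Lipschitz minorant of the square whose expectation factorises over independent summands.\<close>

definition trunc_sq :: "real \<Rightarrow> real \<Rightarrow> real" where
  "trunc_sq t y = 2 * (1 - cos (t * y)) / t\<^sup>2"

lemma trunc_sq_bounds:
  assumes "t > 0"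
  shows "0 \<le> trunc_sq t y" "trunc_sq t y \<le> 4 / t\<^sup>2" "trunc_sq t y \<le> y\<^sup>2"
proof -
  show "0 \<le> trunc_sq t y" by (simp add: trunc_sq_def)
  have "2 * (1 - cos (t * y)) \<le> 4" using cos_ge_minus_one[of "t * y"] by (smt (verit))
  then show "trunc_sq t y \<le> 4 / t\<^sup>2"
    unfolding trunc_sq_def by (rule divide_right_mono) simp
  show "trunc_sq t y \<le> y\<^sup>2"
    using one_minus_cos_le[of "t * y"] assms by (simp add: trunc_sq_def field_simps power_mult_distrib)
qed

lemma trunc_sq_lipschitz:
  assumes "t > 0"
  shows "\<bar>trunc_sq t u - trunc_sq t v\<bar> \<le> 2 / t * \<bar>u - v\<bar>"
proof -
  have "\<bar>trunc_sq t u - trunc_sq t v\<bar> = 2 / t\<^sup>2 * \<bar>cos (t * v) - cos (t * u)\<bar>"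
  proof -
    have "trunc_sq t u - trunc_sq t v = 2 / t\<^sup>2 * (cos (t * v) - cos (t * u))"
      using assms by (simp add: trunc_sq_def field_simps)
    then show ?thesis by (simp only: abs_mult) simp
  qed
  also have "\<dots> \<le> 2 / t\<^sup>2 * \<bar>t * v - t * u\<bar>"
    by (intro mult_left_mono abs_cos_diff_le) auto
  also have "\<bar>t * v - t * u\<bar> = t * \<bar>u - v\<bar>"
    using assms by (simp add: right_diff_distrib[symmetric] abs_mult abs_minus_commute)
  finally show ?thesis using assms by (simp add: power2_eq_square)
qed

section \<open>The characteristic function of a symmetric law with unit second moment\<close>

locale unit_symmetric_law = real_distribution \<mu> for \<mu> :: "real measure" +
  assumes symmetric: "distr \<mu> borel (\<lambda>t. - t) = \<mu>"
    and second_moment: "(\<integral>t. t\<^sup>2 \<partial>\<mu>) = 1"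
begin

lemma prob_UNIV: "prob UNIV = 1"
  using prob_space by simp

lemma integrable_cos: "integrable \<mu> (\<lambda>t. cos (s * t))"
  by (rule integrable_const_bound[of _ 1]) auto

definition cos_transform :: "real \<Rightarrow> real" where
  "cos_transform s = (\<integral>t. cos (s * t) \<partial>\<mu>)"

lemma integral_odd_eq_0:
  fixes h :: "real \<Rightarrow> real"
  assumes "h \<in> borel_measurable borel" "\<And>t. h (- t) = - h t"
  shows "(\<integral>t. h t \<partial>\<mu>) = 0"
proof -
  have "(\<integral>t. h t \<partial>\<mu>) = (\<integral>t. h t \<partial>distr \<mu> borel (\<lambda>t. - t))" by (simp add: symmetric)
  also have "\<dots> = (\<integral>t. h (- t) \<partial>\<mu>)" using assms by (intro integral_distr) auto
  finally show ?thesis by (simp add: assms)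
qed

lemma integrable_square: "integrable \<mu> (\<lambda>t. t\<^sup>2)"
  using second_moment not_integrable_integral_eq by fastforce

text \<open>The imaginary part is the integral of an odd function and vanishes by symmetry.\<close>

lemma char_eq_cos_transform: "char \<mu> s = complex_of_real (cos_transform s)"
proof -
  have int: "integrable \<mu> (\<lambda>t. iexp (s * t))" by (rule integrable_iexp) auto
  have "Re (char \<mu> s) = cos_transform s"
    using int by (simp add: char_def cos_transform_def integral_Re[symmetric] Re_exp)
  moreover have "Im (char \<mu> s) = 0"
    using int by (simp add: char_def integral_Im[symmetric] Im_exp integral_odd_eq_0)
  ultimately show ?thesis by (simp add: complex_eq_iff)
qed

lemma one_minus_cos_transform_le: "1 - cos_transform s \<le> s\<^sup>2 / 2"
proof -
  have "1 - cos_transform s = (\<integral>t. 1 - cos (s * t) \<partial>\<mu>)"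
    unfolding cos_transform_def
    by (subst Bochner_Integration.integral_diff) (auto simp: integrable_cos prob_UNIV)
  also have "\<dots> \<le> (\<integral>t. s\<^sup>2 / 2 * t\<^sup>2 \<partial>\<mu>)"
  proof (rule integral_mono)
    show "1 - cos (s * t) \<le> s\<^sup>2 / 2 * t\<^sup>2" for t
      using one_minus_cos_le[of "s * t"] by (simp add: power_mult_distrib)
  qed (use integrable_square integrable_cos in auto)
  finally show ?thesis by (simp add: second_moment)
qed

text \<open>Counterexamples \<open>s k\<close> tending to 0 are impossible:
  \<open>2 (1 - cos (s t)) / s^2\<close> tends to \<open>t^2\<close> as \<open>s\<close> tends to 0
  and is dominated by \<open>t^2\<close>. By dominated convergence the integrals tend to 1, yet each
  would be at most \<open>1 - \<tau>\<close>.\<close>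

lemma one_minus_cos_transform_ge:
  assumes "\<tau> > 0"
  obtains s0 where "s0 > 0" "\<And>s. \<bar>s\<bar> \<le> s0 \<Longrightarrow> 1 - cos_transform s \<ge> (1 - \<tau>) * s\<^sup>2 / 2"
proof -
  have "\<exists>s0>0. \<forall>s. \<bar>s\<bar> \<le> s0 \<longrightarrow> 1 - cos_transform s \<ge> (1 - \<tau>) * s\<^sup>2 / 2"
  proof (rule ccontr)
    assume *: "\<not> ?thesis"
    have "\<exists>s. \<bar>s\<bar> \<le> 1 / real (Suc k) \<and> 1 - cos_transform s < (1 - \<tau>) * s\<^sup>2 / 2" for k
      using * by (meson not_le zero_less_divide_1_iff of_nat_0_less_iff zero_less_Suc)
    then obtain s where s: "\<And>k. \<bar>s k\<bar> \<le> 1 / real (Suc k)" "\<And>k. 1 - cos_transform (s k) < (1 - \<tau>) * (s k)\<^sup>2 / 2"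
      by metis
    \<comment> \<open>At 0 both sides of the inequality are 0, so a strict violation cannot occur
      there and division by \<open>(s k)\<^sup>2\<close> is harmless.\<close>
    have nz: "s k \<noteq> 0" for k using s(2)[of k] by (auto simp: cos_transform_def prob_UNIV)
    have lim: "s \<longlonglongrightarrow> 0"
      by (rule Lim_null_comparison[OF _ LIMSEQ_inverse_real_of_nat]) (use s(1) in \<open>auto simp: divide_inverse\<close>)
    have "filterlim s (at 0) sequentially"
      using lim nz by (simp add: filterlim_at)
    moreover have "((\<lambda>s. 2 * (1 - cos (s * t)) / s\<^sup>2) \<longlongrightarrow> t\<^sup>2) (at 0)" for t :: real
      by real_asymp (simp_all add: power2_eq_square)
    ultimately have pw: "(\<lambda>k. 2 * (1 - cos (s k * t)) / (s k)\<^sup>2) \<longlonglongrightarrow> t\<^sup>2" for t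
      using filterlim_compose by blast
    have "(\<lambda>k. \<integral>t. 2 * (1 - cos (s k * t)) / (s k)\<^sup>2 \<partial>\<mu>) \<longlonglongrightarrow> (\<integral>t. t\<^sup>2 \<partial>\<mu>)"
    proof (rule integral_dominated_convergence[where w = "\<lambda>t. t\<^sup>2"])
      show "AE t in \<mu>. norm (2 * (1 - cos (s k * t)) / (s k)\<^sup>2) \<le> t\<^sup>2" for k
        using one_minus_cos_le[of "s k * _"] nz[of k]
        by (intro AE_I2) (simp add: field_simps power_mult_distrib)
    qed (use pw integrable_square in auto)
    moreover have "(\<integral>t. 2 * (1 - cos (s k * t)) / (s k)\<^sup>2 \<partial>\<mu>) \<le> 1 - \<tau>" for k
    proof -
      have "(\<integral>t. 1 - cos (s k * t) \<partial>\<mu>) = 1 - cos_transform (s k)"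
        unfolding cos_transform_def
        by (subst Bochner_Integration.integral_diff) (auto simp: integrable_cos prob_UNIV)
      moreover have "(\<lambda>t. 2 * (1 - cos (s k * t)) / (s k)\<^sup>2) = (\<lambda>t. 2 / (s k)\<^sup>2 * (1 - cos (s k * t)))" by auto
      ultimately have "(\<integral>t. 2 * (1 - cos (s k * t)) / (s k)\<^sup>2 \<partial>\<mu>) = 2 / (s k)\<^sup>2 * (1 - cos_transform (s k))"
        by (simp only: integral_mult_right_zero)
      then show ?thesis using s(2)[of k] nz[of k] by (simp add: field_simps)
    qed
    ultimately have "(\<integral>t. t\<^sup>2 \<partial>\<mu>) \<le> 1 - \<tau>" by (intro LIMSEQ_le_const2) auto
    then show False using assms second_moment by simp
  qed
  then show thesis using that by blast
qed

end

locale iid_symmetric_entries = iid_entries M x N n \<mu> + law: unit_symmetric_law \<mu>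
  for M :: "'a measure" and x N n \<mu>
begin

text \<open>The cosine of a sum does not factorise, but the complex exponential does. The cosine is
  recovered as its real part, and each factor is real by symmetry of the law.\<close>

lemma expectation_cos_row:
  assumes i: "i < N"
  shows "expectation (\<lambda>\<omega>. cos (t * ip n (\<lambda>j. x i j \<omega>) v)) = (\<Prod>j<n. law.cos_transform (t * v j))"
proof -
  define I where "I = Pair i ` {..<n}"
  define Y where "Y p \<omega> = (\<lambda>(i, j). x i j) p \<omega> * v (snd p)" for p \<omega>
  have "indep_vars (\<lambda>_. borel) (\<lambda>(i, j). x i j) I"
    by (rule indep_vars_subset[OF indep_entries]) (use i in \<open>auto simp: I_def\<close>)
  from indep_vars_compose2[OF this, of "\<lambda>p y. y * v (snd p)" "\<lambda>_. borel"]
  have indep: "indep_vars (\<lambda>_. borel) Y I" by (simp add: Y_def[abs_def])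
  have reindex: "sum f I = (\<Sum>j<n. f (i, j))" "prod g I = (\<Prod>j<n. g (i, j))" for f :: "_ \<Rightarrow> real" and g :: "_ \<Rightarrow> complex"
    by (simp_all add: I_def sum.reindex prod.reindex inj_on_def)
  have rvY[measurable]: "Y p \<in> borel_measurable M" if "p \<in> I" for p
    using indep that by (auto simp: indep_vars_def)
  have "char (distr M borel (\<lambda>\<omega>. \<Sum>p\<in>I. Y p \<omega>)) t = (\<Prod>p\<in>I. char (distr M borel (Y p)) t)"
    by (rule char_distr_sum[OF indep])
  also have "\<dots> = (\<Prod>j<n. char (distr M borel (Y (i, j))) t)" by (rule reindex)
  also have "\<dots> = (\<Prod>j<n. complex_of_real (law.cos_transform (t * v j)))"
  proof (rule prod.cong[OF refl])
    fix j assume "j \<in> {..<n}"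
    then have j: "j < n" by simp
    have "char (distr M borel (Y (i, j))) t = (CLINT \<omega>|M. iexp (t * Y (i, j) \<omega>))"
      unfolding char_def using j by (intro integral_distr) (auto simp: I_def)
    also have "\<dots> = (CLINT \<omega>|M. iexp ((t * v j) * x i j \<omega>))" by (simp add: Y_def mult_ac)
    also have "\<dots> = (CLINT y|distr M borel (x i j). iexp ((t * v j) * y))"
      using rv_entry[OF i j] by (subst integral_distr) auto
    also have "\<dots> = char \<mu> (t * v j)" by (simp add: char_def distr_entry[OF i j])
    finally show "char (distr M borel (Y (i, j))) t = complex_of_real (law.cos_transform (t * v j))"
      by (simp add: law.char_eq_cos_transform)
  qed
  finally have *: "char (distr M borel (\<lambda>\<omega>. \<Sum>p\<in>I. Y p \<omega>)) t = complex_of_real (\<Prod>j<n. law.cos_transform (t * v j))"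
    by simp
  have S[measurable]: "(\<lambda>\<omega>. \<Sum>p\<in>I. Y p \<omega>) \<in> borel_measurable M" by (intro borel_measurable_sum rvY)
  have "char (distr M borel (\<lambda>\<omega>. \<Sum>p\<in>I. Y p \<omega>)) t = (CLINT \<omega>|M. iexp (t * (\<Sum>p\<in>I. Y p \<omega>)))"
    unfolding char_def by (intro integral_distr) auto
  moreover have "integrable M (\<lambda>\<omega>. iexp (t * (\<Sum>p\<in>I. Y p \<omega>)))"
    by (intro integrable_const_bound[of _ 1]) auto
  ultimately have "Re (char (distr M borel (\<lambda>\<omega>. \<Sum>p\<in>I. Y p \<omega>)) t) = expectation (\<lambda>\<omega>. cos (t * (\<Sum>p\<in>I. Y p \<omega>)))"
    by (simp add: integral_Re[symmetric] Re_exp)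
  then show ?thesis unfolding * by (simp add: ip_def Y_def reindex del: of_real_prod)
qed

text \<open>Each factor of the product is at most \<open>exp (- (1 - \<tau>) (t v_j)^2 / 2)\<close>,
  so the product is at most \<open>exp (- z)\<close>. Expanding to second order gives the main term,
  with the quadratic term as the loss.\<close>

lemma expectation_trunc_sq_row_ge:
  assumes i: "i < N" and t: "t > 0" and \<tau>: "0 < \<tau>" "\<tau> < 1" and s0: "s0 \<le> 1"
    and psi: "\<And>s. \<bar>s\<bar> \<le> s0 \<Longrightarrow> 1 - law.cos_transform s \<ge> (1 - \<tau>) * s\<^sup>2 / 2"
    and v: "\<And>j. j < n \<Longrightarrow> \<bar>t * v j\<bar> \<le> s0"
  shows "expectation (\<lambda>\<omega>. trunc_sq t (ip n (\<lambda>j. x i j \<omega>) v)) \<ge> (1 - \<tau>) * ip n v v - t\<^sup>2 * (ip n v v)\<^sup>2 / 4"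
proof -
  let ?q = "ip n v v"
  define z where "z = (1 - \<tau>) * t\<^sup>2 * ?q / 2"
  have q: "?q \<ge> 0" by (rule ip_self_nonneg)
  have z: "z \<ge> 0" using \<tau> q by (simp add: z_def)
  have "(\<Prod>j<n. law.cos_transform (t * v j)) \<le> (\<Prod>j<n. exp (- ((1 - \<tau>) * (t * v j)\<^sup>2 / 2)))"
  proof (rule prod_mono)
    fix j assume "j \<in> {..<n}"
    then have j: "\<bar>t * v j\<bar> \<le> s0" using v by simp
    \<comment> \<open>Factors can be compared one by one only if they are nonnegative. Arguments of
      modulus at most 1 make each at least 1/2.\<close>
    have "(t * v j)\<^sup>2 \<le> 1" using j s0 by (simp add: abs_square_le_1)
    then have "0 \<le> law.cos_transform (t * v j)" using law.one_minus_cos_transform_le[of "t * v j"] by simp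
    moreover have "law.cos_transform (t * v j) \<le> 1 + (- ((1 - \<tau>) * (t * v j)\<^sup>2 / 2))" using psi[OF j] by simp
    moreover have "\<dots> \<le> exp (- ((1 - \<tau>) * (t * v j)\<^sup>2 / 2))" by (rule exp_ge_add_one_self)
    ultimately show "0 \<le> law.cos_transform (t * v j) \<and> law.cos_transform (t * v j) \<le> exp (- ((1 - \<tau>) * (t * v j)\<^sup>2 / 2))"
      by linarith
  qed
  also have "\<dots> = exp (- z)"
    by (simp add: exp_sum[symmetric] z_def ip_def sum_negf sum_distrib_left sum_divide_distrib
        power_mult_distrib power2_eq_square algebra_simps)
  also have "\<dots> \<le> 1 - z + z\<^sup>2 / 2" by (rule exp_minus_le_quadratic[OF z])
  finally have P: "1 - (\<Prod>j<n. law.cos_transform (t * v j)) \<ge> z - z\<^sup>2 / 2" by simp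
  have [measurable]: "(\<lambda>\<omega>. ip n (\<lambda>j. x i j \<omega>) v) \<in> borel_measurable M"
    unfolding ip_def using rv_entry[OF i] by (intro borel_measurable_sum) auto
  have "expectation (\<lambda>\<omega>. trunc_sq t (ip n (\<lambda>j. x i j \<omega>) v))
      = expectation (\<lambda>\<omega>. 2 / t\<^sup>2 * (1 - cos (t * ip n (\<lambda>j. x i j \<omega>) v)))"
    by (simp add: trunc_sq_def)
  also have "\<dots> = 2 / t\<^sup>2 * (1 - (\<Prod>j<n. law.cos_transform (t * v j)))"
    unfolding expectation_cos_row[OF i, symmetric] integral_mult_right_zero
    by (subst Bochner_Integration.integral_diff) (auto intro!: integrable_const_bound[of _ 1] simp: prob_space)
  also have "\<dots> \<ge> 2 / t\<^sup>2 * (z - z\<^sup>2 / 2)" using P by (intro mult_left_mono) auto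
  also have "2 / t\<^sup>2 * (z - z\<^sup>2 / 2) = (1 - \<tau>) * ?q - (1 - \<tau>)\<^sup>2 * (t\<^sup>2 * ?q\<^sup>2 / 4)"
    using t by (simp add: z_def field_simps power2_eq_square)
  also have "\<dots> \<ge> (1 - \<tau>) * ?q - 1 * (t\<^sup>2 * ?q\<^sup>2 / 4)"
    using \<tau> by (intro diff_left_mono mult_right_mono power_le_one) auto
  finally show ?thesis by simp
qed

end

section \<open>Rounding to a grid and counting grid points\<close>

lemma convex_combination_le_cases:
  fixes p X Y Z :: real
  assumes "0 \<le> p" "p \<le> 1" "(1 - p) * X + p * Y \<le> Z"
  shows "X \<le> Z \<or> Y \<le> Z"
proof (rule ccontr)
  assume "\<not> ?thesis"
  then have XY: "X - Z > 0" "Y - Z > 0" by auto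
  have "(1 - p) * (X - Z) + p * (Y - Z) > 0"
  proof (cases "p = 0")
    case False
    then have "p * (Y - Z) > 0" using XY assms by simp
    moreover have "(1 - p) * (X - Z) \<ge> 0" using XY assms by simp
    ultimately show ?thesis by linarith
  qed (use XY in simp)
  then show False using assms by (simp add: algebra_simps)
qed

text \<open>Rounding \<open>u / g\<close> up with probability equal to its fractional part
  \<open>p\<close>, and down otherwise, is unbiased: the linear term averages to 0, the square to
  \<open>g^2 p (1 - p)\<close>, and the absolute value to \<open>\<bar>u\<bar>\<close>. One of the
  two outcomes is no worse than the average.\<close>

lemma round_coordinate:
  fixes S0 S1 S2 g l u :: real
  assumes g: "g > 0" and S2: "S2 \<ge> 0" and l: "l \<ge> 0"
  shows "\<exists>k :: int. \<bar>g * k - u\<bar> \<le> g \<and>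
    S0 + 2 * S1 * (g * k - u) + S2 * (g * k - u)\<^sup>2 + l * (g * \<bar>real_of_int (k)\<bar>) \<le> S0 + g\<^sup>2 * S2 + l * \<bar>u\<bar>"
proof -
  define f where "f = \<lfloor>u / g\<rfloor>"
  define p where "p = u / g - f"
  have p: "0 \<le> p" "p \<le> 1" unfolding p_def f_def by linarith+
  have u: "u = g * (f + p)" using g by (simp add: p_def)
  let ?X = "S0 + 2 * S1 * (g * f - u) + S2 * (g * f - u)\<^sup>2 + l * (g * \<bar>real_of_int f\<bar>)"
  let ?Y = "S0 + 2 * S1 * (g * (f + 1) - u) + S2 * (g * (f + 1) - u)\<^sup>2 + l * (g * \<bar>real_of_int f + 1\<bar>)"
  let ?Z = "S0 + g\<^sup>2 * S2 + l * \<bar>u\<bar>"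
  \<comment> \<open>The absolute value is linear between consecutive integers, since 0 never lies
    strictly between them.\<close>
  have abs: "(1 - p) * \<bar>real_of_int f\<bar> + p * \<bar>real_of_int f + 1\<bar> = \<bar>f + p\<bar>"
  proof (cases "f \<ge> 0")
    case True then show ?thesis using p by (simp add: algebra_simps)
  next
    case False
    then have f: "real_of_int f + 1 \<le> 0" by linarith
    then have "\<bar>real_of_int f\<bar> = - f" "\<bar>real_of_int f + 1\<bar> = - (f + 1)" "\<bar>f + p\<bar> = - (f + p)"
      using p by linarith+
    then show ?thesis by (simp only:) (simp add: algebra_simps)
  qed
  have "(1 - p) * ?X + p * ?Y = S0 + g\<^sup>2 * S2 * (p * (1 - p))
      + l * g * ((1 - p) * \<bar>real_of_int f\<bar> + p * \<bar>real_of_int f + 1\<bar>)"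
    unfolding u by (simp add: algebra_simps power2_eq_square)
  also have "l * g * ((1 - p) * \<bar>real_of_int f\<bar> + p * \<bar>real_of_int f + 1\<bar>) = l * \<bar>u\<bar>"
    unfolding abs u using g by (simp add: abs_mult)
  also have "S0 + g\<^sup>2 * S2 * (p * (1 - p)) + l * \<bar>u\<bar> \<le> ?Z"
    using p S2 by (simp add: mult_left_le mult_le_one)
  finally have avg: "(1 - p) * ?X + p * ?Y \<le> ?Z" .
  have "?X \<le> ?Z \<or> ?Y \<le> ?Z"
    by (rule convex_combination_le_cases[OF p avg])
  moreover have "\<bar>g * f - u\<bar> \<le> g" "\<bar>g * (f + 1) - u\<bar> \<le> g"
  proof -
    have "g * f - u = - (g * p)" "g * (f + 1) - u = g * (1 - p)" unfolding u by (simp_all add: algebra_simps)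
    then show "\<bar>g * f - u\<bar> \<le> g" "\<bar>g * (f + 1) - u\<bar> \<le> g"
      using g p by (simp_all add: abs_mult mult_left_le)
  qed
  ultimately show ?thesis
    by (elim disjE) (intro exI[of _ f], simp, intro exI[of _ "f + 1"], simp add: algebra_simps)
qed

text \<open>Derandomised rounding: rounding each coordinate at random without bias does not increase
  the expected left-hand side, so some choice achieves the bound.\<close>

lemma round_to_grid:
  fixes g l :: real and u :: "nat \<Rightarrow> real" and r :: "'i \<Rightarrow> nat \<Rightarrow> real"
  assumes g: "g > 0" and l: "l \<ge> 0" and R: "finite R"
  shows "\<exists>k :: nat \<Rightarrow> int. (\<forall>j<n. \<bar>g * k j - u j\<bar> \<le> g) \<and>
    (\<Sum>i\<in>R. (ip n (r i) (\<lambda>j. g * k j - u j))\<^sup>2) + l * (\<Sum>j<n. g * \<bar>real_of_int (k j)\<bar>)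
      \<le> g\<^sup>2 * (\<Sum>i\<in>R. ip n (r i) (r i)) + l * (\<Sum>j<n. \<bar>u j\<bar>)"
proof (induction n)
  case 0
  then show ?case by (simp add: ip_def)
next
  case (Suc n)
  from Suc.IH obtain k :: "nat \<Rightarrow> int" where k: "\<forall>j<n. \<bar>g * k j - u j\<bar> \<le> g"
    "(\<Sum>i\<in>R. (ip n (r i) (\<lambda>j. g * k j - u j))\<^sup>2) + l * (\<Sum>j<n. g * \<bar>real_of_int (k j)\<bar>)
      \<le> g\<^sup>2 * (\<Sum>i\<in>R. ip n (r i) (r i)) + l * (\<Sum>j<n. \<bar>u j\<bar>)"
    by (elim exE conjE) (rule that)
  let ?T = "\<lambda>i. ip n (r i) (\<lambda>j. g * k j - u j)"
  have "0 \<le> (\<Sum>i\<in>R. (r i n)\<^sup>2)" by (intro sum_nonneg) auto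
  \<comment> \<open>As a function of the displacement in coordinate \<open>n\<close>, the sum of
    squares is a quadratic polynomial with these coefficients, determined by the coordinates already
    rounded.\<close>
  from round_coordinate[OF g this l, of "u n" "\<Sum>i\<in>R. (?T i)\<^sup>2" "\<Sum>i\<in>R. ?T i * r i n"]
  obtain z :: int where z: "\<bar>g * z - u n\<bar> \<le> g"
    "(\<Sum>i\<in>R. (?T i)\<^sup>2) + 2 * (\<Sum>i\<in>R. ?T i * r i n) * (g * z - u n) + (\<Sum>i\<in>R. (r i n)\<^sup>2) * (g * z - u n)\<^sup>2
       + l * (g * \<bar>real_of_int (z)\<bar>) \<le> (\<Sum>i\<in>R. (?T i)\<^sup>2) + g\<^sup>2 * (\<Sum>i\<in>R. (r i n)\<^sup>2) + l * \<bar>u n\<bar>"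
    by (elim exE conjE) (rule that)
  define k' where "k' = k(n := z)"
  have ip': "ip (Suc n) (r i) (\<lambda>j. g * k' j - u j) = ?T i + r i n * (g * z - u n)" for i
    by (simp add: ip_def k'_def)
  have "(\<Sum>i\<in>R. (ip (Suc n) (r i) (\<lambda>j. g * k' j - u j))\<^sup>2)
      = (\<Sum>i\<in>R. (?T i)\<^sup>2) + 2 * (\<Sum>i\<in>R. ?T i * r i n) * (g * z - u n) + (\<Sum>i\<in>R. (r i n)\<^sup>2) * (g * z - u n)\<^sup>2"
    unfolding ip' power2_sum
    by (simp add: sum.distrib sum_distrib_left sum_distrib_right power_mult_distrib mult_ac)
  moreover have "(\<Sum>j<Suc n. g * \<bar>real_of_int (k' j)\<bar>) = (\<Sum>j<n. g * \<bar>real_of_int (k j)\<bar>) + g * \<bar>real_of_int (z)\<bar>"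
    by (simp add: k'_def)
  moreover have "(\<Sum>i\<in>R. ip (Suc n) (r i) (r i)) = (\<Sum>i\<in>R. ip n (r i) (r i)) + (\<Sum>i\<in>R. (r i n)\<^sup>2)"
    by (simp add: ip_def sum.distrib power2_eq_square)
  ultimately have "(\<Sum>i\<in>R. (ip (Suc n) (r i) (\<lambda>j. g * k' j - u j))\<^sup>2) + l * (\<Sum>j<Suc n. g * \<bar>real_of_int (k' j)\<bar>)
      \<le> g\<^sup>2 * (\<Sum>i\<in>R. ip (Suc n) (r i) (r i)) + l * (\<Sum>j<Suc n. \<bar>u j\<bar>)"
    using z(2) k(2) by (simp add: algebra_simps)
  moreover have "\<forall>j<Suc n. \<bar>g * k' j - u j\<bar> \<le> g"
    using k(1) z(1) by (auto simp: k'_def less_Suc_eq)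
  ultimately show ?case by (intro exI[of _ k'] conjI)
qed

text \<open>Integer vectors; extensionality in \<open>PiE\<close> makes the set finite.\<close>

definition l1_grid :: "nat \<Rightarrow> real \<Rightarrow> (nat \<Rightarrow> int) set" where
  "l1_grid n L = {k \<in> {..<n} \<rightarrow>\<^sub>E {- \<lfloor>L\<rfloor>..\<lfloor>L\<rfloor>}. (\<Sum>j<n. \<bar>real_of_int (k j)\<bar>) \<le> L}"

lemma finite_l1_grid: "finite (l1_grid n L)"
proof -
  have "finite ({..<n} \<rightarrow>\<^sub>E {- \<lfloor>L\<rfloor>..\<lfloor>L\<rfloor>})" by (intro finite_PiE) auto
  then show ?thesis unfolding l1_grid_def by (rule finite_subset[rotated]) auto
qed

lemma restrict_in_l1_grid:
  assumes "(\<Sum>j<n. \<bar>real_of_int (k j)\<bar>) \<le> L"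
  shows "restrict k {..<n} \<in> l1_grid n L"
proof -
  have "- \<lfloor>L\<rfloor> \<le> k j \<and> k j \<le> \<lfloor>L\<rfloor>" if "j < n" for j
  proof -
    have "\<bar>real_of_int (k j)\<bar> \<le> (\<Sum>j<n. \<bar>real_of_int (k j)\<bar>)" using that by (intro member_le_sum) auto
    then have "\<bar>k j\<bar> \<le> \<lfloor>L\<rfloor>" using assms by (simp add: le_floor_iff)
    then show ?thesis by linarith
  qed
  then have "restrict k {..<n} \<in> {..<n} \<rightarrow>\<^sub>E {- \<lfloor>L\<rfloor>..\<lfloor>L\<rfloor>}" by (simp add: restrict_PiE_iff)
  then show ?thesis using assms by (simp add: l1_grid_def)
qed

text \<open>The subtracted term strengthens the claim so that the induction closes: it absorbs the
  two new summands because \<open>4 * q \<le> 2\<close>.\<close>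

lemma two_sided_geometric_sum_le:
  fixes q :: real
  assumes "0 \<le> q" "q \<le> 1 / 2"
  shows "(\<Sum>k\<in>{- int K..int K}. q ^ nat \<bar>k\<bar>) \<le> 1 + 4 * q - 4 * q ^ Suc K"
proof (induction K)
  case (Suc K)
  have "{- int (Suc K)..int (Suc K)} = insert (- int (Suc K)) (insert (int (Suc K)) {- int K..int K})" by auto
  then have "(\<Sum>k\<in>{- int (Suc K)..int (Suc K)}. q ^ nat \<bar>k\<bar>) = 2 * q ^ Suc K + (\<Sum>k\<in>{- int K..int K}. q ^ nat \<bar>k\<bar>)"
    by (simp add: nat_add_distrib del: power_Suc)
  also have "\<dots> \<le> 2 * q ^ Suc K + (1 + 4 * q - 4 * q ^ Suc K)" using Suc by simp
  also have "4 * q ^ Suc (Suc K) \<le> 2 * q ^ Suc K"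
  proof -
    have "q ^ Suc K * (4 * q) \<le> q ^ Suc K * 2" using assms by (intro mult_left_mono) auto
    then show ?thesis by (simp add: mult_ac)
  qed
  then have "2 * q ^ Suc K + (1 + 4 * q - 4 * q ^ Suc K) \<le> 1 + 4 * q - 4 * q ^ Suc (Suc K)" by simp
  finally show ?case .
qed simp

text \<open>Exponential weights: every grid point has \<open>exp (s (L - |k|_1)) \<ge> 1\<close>.
  Once the constraint on the sum is dropped, the weights factorise over coordinates, and each
  geometric series is at most \<open>1 + 4 * exp (- s)\<close>.\<close>

lemma card_l1_grid_le:
  assumes s: "s \<ge> 1" and L: "L \<ge> 0"
  shows "real (card (l1_grid n L)) \<le> exp (s * L + 4 * exp (- s) * real n)"
proof -
  define K where "K = nat \<lfloor>L\<rfloor>"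
  have K: "\<lfloor>L\<rfloor> = int K" using L by (simp add: K_def)
  let ?P = "{..<n} \<rightarrow>\<^sub>E {- \<lfloor>L\<rfloor>..\<lfloor>L\<rfloor>}"
  have fin: "finite ?P" by (intro finite_PiE) auto
  have q: "exp (- s) \<le> 1 / 2"
  proof -
    have "2 \<le> exp s" using exp_ge_add_one_self[of s] s by linarith
    then show ?thesis by (simp add: exp_minus field_simps)
  qed
  have "real (card (l1_grid n L)) = (\<Sum>k\<in>l1_grid n L. 1)" by simp
  also have "\<dots> \<le> (\<Sum>k\<in>l1_grid n L. exp (s * L) * (\<Prod>j<n. exp (- s) ^ nat \<bar>k j\<bar>))"
  proof (rule sum_mono)
    fix k assume "k \<in> l1_grid n L"
    then have "s * (\<Sum>j<n. \<bar>real_of_int (k j)\<bar>) \<le> s * L" using s by (simp add: l1_grid_def)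
    moreover have "(\<Prod>j<n. exp (- s) ^ nat \<bar>k j\<bar>) = exp (- (s * (\<Sum>j<n. \<bar>real_of_int (k j)\<bar>)))"
      by (simp add: exp_of_nat_mult[symmetric] exp_sum[symmetric] sum_distrib_left sum_negf[symmetric] mult_ac)
    ultimately show "1 \<le> exp (s * L) * (\<Prod>j<n. exp (- s) ^ nat \<bar>k j\<bar>)"
      by (simp add: exp_add[symmetric])
  qed
  also have "\<dots> \<le> (\<Sum>k\<in>?P. exp (s * L) * (\<Prod>j<n. exp (- s) ^ nat \<bar>k j\<bar>))"
  proof (rule sum_mono2[OF fin])
    show "l1_grid n L \<subseteq> ?P" unfolding l1_grid_def by blast
    show "0 \<le> exp (s * L) * (\<Prod>j<n. exp (- s) ^ nat \<bar>k j\<bar>)" for k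
      by (intro mult_nonneg_nonneg prod_nonneg) auto
  qed
  also have "\<dots> = exp (s * L) * (\<Prod>j<n. \<Sum>z\<in>{- int K..int K}. exp (- s) ^ nat \<bar>z\<bar>)"
    unfolding K by (subst prod_sum_PiE) (auto simp: sum_distrib_left)
  also have "\<dots> \<le> exp (s * L) * (\<Prod>j<n. exp (4 * exp (- s)))"
  proof (intro mult_left_mono prod_mono conjI sum_nonneg)
    fix j
    have "(\<Sum>z\<in>{- int K..int K}. exp (- s) ^ nat \<bar>z\<bar>) \<le> 1 + 4 * exp (- s) - 4 * exp (- s) ^ Suc K"
      by (rule two_sided_geometric_sum_le) (use q in auto)
    also have "\<dots> \<le> 1 + 4 * exp (- s)" by simp
    also have "\<dots> \<le> exp (4 * exp (- s))" by (rule exp_ge_add_one_self)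
    finally show "(\<Sum>z\<in>{- int K..int K}. exp (- s) ^ nat \<bar>z\<bar>) \<le> exp (4 * exp (- s))" .
  qed auto
  also have "\<dots> = exp (s * L + 4 * exp (- s) * real n)"
    by (simp add: exp_of_nat_mult[symmetric] exp_add[symmetric] mult_ac)
  finally show ?thesis .
qed

section \<open>From grid points to all vectors of small norm\<close>

lemma ip_Cauchy_Schwarz: "(ip n u v)\<^sup>2 \<le> ip n u u * ip n v v"
  using Cauchy_Schwarz_ineq_sum[of u v "{..<n}"] by (simp add: ip_def power2_eq_square)

lemma ip_add_self: "ip n (\<lambda>j. u j + d j) (\<lambda>j. u j + d j) = ip n u u + 2 * ip n u d + ip n d d"
  by (simp add: ip_def algebra_simps sum.distrib sum_distrib_left)

text \<open>The deterministic net argument: \<open>u\<close> is rounded with the rows of squared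
  length at most \<open>B * n\<close> under control. The long rows are few and lose at most
  \<open>4 / t\<^sup>2\<close> each; the loss on the others is bounded by the Lipschitz
  constant.\<close>

lemma sum_sq_ip_ge_grid:
  fixes r :: "nat \<Rightarrow> nat \<Rightarrow> real" and u :: "nat \<Rightarrow> real"
  assumes n: "n > 0" and t: "t > 0" and B: "B > 0" and h: "0 < h" "h \<le> 1" and \<kappa>: "\<kappa> > 0" and N: "N > 0"
    and bad: "real (card {i\<in>{..<N}. ip n (r i) (r i) > B * real n}) \<le> real N * (2 / B)"
    and u: "ip n u u = 1" "(\<Sum>j<n. \<bar>u j\<bar>) \<le> \<kappa> * sqrt (real n)"
    and grid: "\<And>k. k \<in> l1_grid n (2 * \<kappa> * real n / h) \<Longrightarrow>
       1 - 2 * h \<le> ip n (\<lambda>j. h / sqrt (real n) * k j) (\<lambda>j. h / sqrt (real n) * k j) \<Longrightarrow>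
       ip n (\<lambda>j. h / sqrt (real n) * k j) (\<lambda>j. h / sqrt (real n) * k j) \<le> 4 \<Longrightarrow>
       real N * e \<le> (\<Sum>i<N. trunc_sq t (ip n (r i) (\<lambda>j. h / sqrt (real n) * k j)))"
  shows "real N * (e - 8 / (t\<^sup>2 * B) - 2 / t * (h * sqrt (2 * B))) \<le> (\<Sum>i<N. (ip n (r i) u)\<^sup>2)"
proof -
  define g where "g = h / sqrt (real n)"
  have g: "g > 0" using n h by (simp add: g_def)
  have g2: "g\<^sup>2 * real n = h\<^sup>2" using n by (simp add: g_def power_divide)
  define R where "R = {i\<in>{..<N}. ip n (r i) (r i) \<le> B * real n}"
  have R: "finite R" "R \<subseteq> {..<N}" by (auto simp: R_def)
  \<comment> \<open>This weight makes \<open>l * \<kappa> * sqrt n\<close> equal to the budget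
    \<open>h^2 * B * N\<close> of the squared errors. One inequality then bounds the squared errors
    by twice that budget and the \<open>l1\<close> norm of the rounded vector by
    \<open>2 * \<kappa> * sqrt n\<close>.\<close>
  define l where "l = h\<^sup>2 * B * real N / (\<kappa> * sqrt (real n))"
  have l: "l > 0" using h B N \<kappa> n by (simp add: l_def)
  obtain k :: "nat \<Rightarrow> int" where k: "\<forall>j<n. \<bar>g * k j - u j\<bar> \<le> g"
    "(\<Sum>i\<in>R. (ip n (r i) (\<lambda>j. g * k j - u j))\<^sup>2) + l * (\<Sum>j<n. g * \<bar>real_of_int (k j)\<bar>)
      \<le> g\<^sup>2 * (\<Sum>i\<in>R. ip n (r i) (r i)) + l * (\<Sum>j<n. \<bar>u j\<bar>)"
    using round_to_grid[OF g less_imp_le[OF l] R(1), of n u r] by (elim exE conjE) (rule that)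
  let ?d = "\<lambda>j. g * k j - u j"
  let ?\<theta> = "\<lambda>j. g * k j"
  have "(\<Sum>i\<in>R. ip n (r i) (r i)) \<le> (\<Sum>i\<in>R. B * real n)" by (intro sum_mono) (auto simp: R_def)
  also have "\<dots> = real (card R) * (B * real n)" by simp
  also have "\<dots> \<le> real N * (B * real n)"
    using card_mono[OF _ R(2)] B by (intro mult_right_mono) auto
  finally have "g\<^sup>2 * (\<Sum>i\<in>R. ip n (r i) (r i)) \<le> g\<^sup>2 * (real N * (B * real n))" by (intro mult_left_mono) auto
  also have "\<dots> = (g\<^sup>2 * real n) * B * real N" by simp
  finally have "g\<^sup>2 * (\<Sum>i\<in>R. ip n (r i) (r i)) \<le> h\<^sup>2 * B * real N" unfolding g2 .
  moreover have "l * (\<Sum>j<n. \<bar>u j\<bar>) \<le> l * (\<kappa> * sqrt (real n))" using u l by (intro mult_left_mono) auto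
  moreover have l\<kappa>: "l * (\<kappa> * sqrt (real n)) = h\<^sup>2 * B * real N" using \<kappa> n by (simp add: l_def)
  ultimately have bound: "(\<Sum>i\<in>R. (ip n (r i) ?d)\<^sup>2) + l * (\<Sum>j<n. g * \<bar>real_of_int (k j)\<bar>) \<le> 2 * h\<^sup>2 * B * real N"
    using k(2) by linarith
  have S1: "(\<Sum>i\<in>R. (ip n (r i) ?d)\<^sup>2) \<ge> 0" by (intro sum_nonneg) auto
  have S2: "l * (\<Sum>j<n. g * \<bar>real_of_int (k j)\<bar>) \<ge> 0" using l g by (intro mult_nonneg_nonneg sum_nonneg) auto
  have "l * (\<Sum>j<n. g * \<bar>real_of_int (k j)\<bar>) \<le> l * (2 * \<kappa> * sqrt (real n))"
    using bound S1 l\<kappa> by simp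
  then have "(\<Sum>j<n. g * \<bar>real_of_int (k j)\<bar>) \<le> 2 * \<kappa> * sqrt (real n)"
    by (rule mult_left_le_imp_le[OF _ l])
  then have "g * (\<Sum>j<n. \<bar>real_of_int (k j)\<bar>) \<le> 2 * \<kappa> * sqrt (real n)"
    by (simp add: sum_distrib_left)
  then have "(\<Sum>j<n. \<bar>real_of_int (k j)\<bar>) \<le> 2 * \<kappa> * sqrt (real n) / g"
    using g by (simp add: field_simps)
  also have "2 * \<kappa> * sqrt (real n) / g = 2 * \<kappa> * real n / h"
    using n h by (simp add: g_def field_simps)
  finally have "restrict k {..<n} \<in> l1_grid n (2 * \<kappa> * real n / h)" by (rule restrict_in_l1_grid)
  note grid1 = grid[OF this, folded g_def]
  \<comment> \<open>The grid contains only the extensional version of \<open>k\<close>; inner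
    products see only the indices below \<open>n\<close>.\<close>
  have same: "ip n v (\<lambda>j. g * restrict k {..<n} j) = ip n v ?\<theta>" for v
    by (intro ip_cong) auto
  have same2: "ip n (\<lambda>j. g * restrict k {..<n} j) (\<lambda>j. g * restrict k {..<n} j) = ip n ?\<theta> ?\<theta>"
    by (intro ip_cong) auto
  have dd: "ip n ?d ?d \<le> h\<^sup>2"
  proof -
    have "ip n ?d ?d \<le> (\<Sum>j<n. g\<^sup>2)"
      unfolding ip_def
    proof (rule sum_mono)
      fix j assume "j \<in> {..<n}"
      then have "\<bar>?d j\<bar> \<le> \<bar>g\<bar>" using k(1) g by simp
      then show "?d j * ?d j \<le> g\<^sup>2" by (simp add: abs_le_square_iff power2_eq_square)
    qed
    then show ?thesis using g2 by (simp add: mult.commute)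
  qed
  have dd0: "ip n ?d ?d \<ge> 0" by (rule ip_self_nonneg)
  have "(ip n u ?d)\<^sup>2 \<le> h\<^sup>2" using ip_Cauchy_Schwarz[of n u ?d] dd u by simp
  then have ud: "\<bar>ip n u ?d\<bar> \<le> h" using h by (simp add: abs_le_square_iff[symmetric])
  have q: "ip n ?\<theta> ?\<theta> = 1 + 2 * ip n u ?d + ip n ?d ?d"
    using ip_add_self[of n u ?d] u by simp
  have h1: "h\<^sup>2 \<le> 1" using h by (simp add: power_le_one)
  have q1: "1 - 2 * h \<le> ip n ?\<theta> ?\<theta>" using q ud dd0 by linarith
  have q2: "ip n ?\<theta> ?\<theta> \<le> 4" using q ud dd h1 h by linarith
  have main: "real N * e \<le> (\<Sum>i<N. trunc_sq t (ip n (r i) ?\<theta>))"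
    using grid1[unfolded same2, OF q1 q2] unfolding same .
  \<comment> \<open>The rounding bounds squares, whereas the Lipschitz estimate needs absolute
    values; Cauchy--Schwarz over the rows connects the two.\<close>
  have "(\<Sum>i\<in>R. \<bar>ip n (r i) ?d\<bar>)\<^sup>2 \<le> (\<Sum>i\<in>R. (ip n (r i) ?d)\<^sup>2) * real (card R)"
    using Cauchy_Schwarz_ineq_sum[of "\<lambda>i. \<bar>ip n (r i) ?d\<bar>" "\<lambda>_. 1" R] by simp
  also have "\<dots> \<le> (2 * h\<^sup>2 * B * real N) * real N"
    using card_mono[OF _ R(2)] bound S1 S2 B by (intro mult_mono) auto
  also have "\<dots> = (real N * (h * sqrt (2 * B)))\<^sup>2"
  proof -
    have "(real N * (h * sqrt (2 * B)))\<^sup>2 = (real N)\<^sup>2 * (h\<^sup>2 * (2 * B))"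
    proof -
      have "(sqrt (2 * B))\<^sup>2 = 2 * B" using B by simp
      then show ?thesis by (simp only: power_mult_distrib)
    qed
    moreover have "2 * h\<^sup>2 * B * real N * real N = (real N)\<^sup>2 * (h\<^sup>2 * (2 * B))"
      by (simp add: power2_eq_square)
    ultimately show ?thesis by (simp only:)
  qed
  finally have dsum: "(\<Sum>i\<in>R. \<bar>ip n (r i) ?d\<bar>) \<le> real N * (h * sqrt (2 * B))"
    by (rule power2_le_imp_le) (use h B in auto)
  have "real N * e \<le> (\<Sum>i\<in>R. trunc_sq t (ip n (r i) ?\<theta>)) + (\<Sum>i\<in>{..<N} - R. trunc_sq t (ip n (r i) ?\<theta>))"
    using main sum.subset_diff[OF R(2), of "\<lambda>i. trunc_sq t (ip n (r i) ?\<theta>)"] by simp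
  also have "(\<Sum>i\<in>{..<N} - R. trunc_sq t (ip n (r i) ?\<theta>)) \<le> (\<Sum>i\<in>{..<N} - R. 4 / t\<^sup>2)"
    by (intro sum_mono trunc_sq_bounds t)
  also have "\<dots> \<le> (real N * (2 / B)) * (4 / t\<^sup>2)"
  proof -
    have "{..<N} - R = {i\<in>{..<N}. ip n (r i) (r i) > B * real n}" by (auto simp: R_def)
    then have "real (card ({..<N} - R)) \<le> real N * (2 / B)" using bad by simp
    then show ?thesis by (simp only: sum_constant) (intro mult_right_mono, auto)
  qed
  also have "(\<Sum>i\<in>R. trunc_sq t (ip n (r i) ?\<theta>)) \<le> (\<Sum>i\<in>R. (ip n (r i) u)\<^sup>2 + 2 / t * \<bar>ip n (r i) ?d\<bar>)"
  proof (rule sum_mono)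
    fix i
    have "ip n (r i) ?d = ip n (r i) ?\<theta> - ip n (r i) u" by (rule ip_diff_right)
    then show "trunc_sq t (ip n (r i) ?\<theta>) \<le> (ip n (r i) u)\<^sup>2 + 2 / t * \<bar>ip n (r i) ?d\<bar>"
      using add_mono[OF trunc_sq_bounds(3)[OF t, of "ip n (r i) u"]
          abs_le_D1[OF trunc_sq_lipschitz[OF t, of "ip n (r i) ?\<theta>" "ip n (r i) u"]]]
      by (simp only:)
  qed
  also have "\<dots> = (\<Sum>i\<in>R. (ip n (r i) u)\<^sup>2) + 2 / t * (\<Sum>i\<in>R. \<bar>ip n (r i) ?d\<bar>)"
    by (simp add: sum.distrib sum_distrib_left)
  also have "2 / t * (\<Sum>i\<in>R. \<bar>ip n (r i) ?d\<bar>) \<le> 2 / t * (real N * (h * sqrt (2 * B)))"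
    using dsum t by (intro mult_left_mono) auto
  also have "(\<Sum>i\<in>R. (ip n (r i) u)\<^sup>2) \<le> (\<Sum>i<N. (ip n (r i) u)\<^sup>2)"
    using R by (intro sum_mono2) auto
  finally show ?thesis using t B by (simp add: field_simps)
qed

section \<open>Concentration at grid points and the union bound\<close>

context iid_symmetric_entries
begin

lemma measurable_row_ip: "i < N \<Longrightarrow> (\<lambda>\<omega>. ip n (\<lambda>j. x i j \<omega>) v) \<in> borel_measurable M"
  unfolding ip_def using rv_entry by (intro borel_measurable_sum borel_measurable_times) auto

text \<open>Hoeffding's inequality with range \<open>4 / t\<^sup>2\<close> and deviation
  \<open>\<tau>\<close>. A squared length of at most 4 keeps the coordinates below 2 in modulus, so
  \<open>2 * t \<le> s0\<close> puts all arguments in the range of \<open>psi\<close>, and it bounds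
  the quadratic loss by \<open>4 * t\<^sup>2\<close>.\<close>

lemma prob_trunc_sum_le:
  assumes N: "N > 0" and t: "t > 0" and \<tau>: "0 < \<tau>" "\<tau> < 1" and s0: "s0 \<le> 1" "2 * t \<le> s0" and h: "0 \<le> h"
    and psi: "\<And>s. \<bar>s\<bar> \<le> s0 \<Longrightarrow> 1 - law.cos_transform s \<ge> (1 - \<tau>) * s\<^sup>2 / 2"
    and v: "1 - 2 * h \<le> ip n v v" "ip n v v \<le> 4"
  shows "prob {\<omega>\<in>space M. (\<Sum>i<N. trunc_sq t (ip n (\<lambda>j. x i j \<omega>) v)) \<le> real N * ((1 - \<tau> - 2 * h - 4 * t\<^sup>2) - \<tau>)}
    \<le> exp (- (\<tau>\<^sup>2 * t ^ 4 / 8) * real N)"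
proof -
  have H: "prob {\<omega>\<in>space M. (\<Sum>i\<in>{..<N}. trunc_sq t (ip n (\<lambda>j. x i j \<omega>) v)) \<le> real (card {..<N}) * ((1 - \<tau> - 2 * h - 4 * t\<^sup>2) - \<tau>)}
    \<le> exp (- 2 * real (card {..<N}) * \<tau>\<^sup>2 / (4 / t\<^sup>2)\<^sup>2)"
  proof (rule Hoeffding_sum_le)
    show "indep_vars (\<lambda>_. borel) (\<lambda>i \<omega>. trunc_sq t (ip n (\<lambda>j. x i j \<omega>) v)) {..<N}"
    proof (rule indep_rows[where F = "\<lambda>i r. trunc_sq t (ip n r v)"])
      fix i
      have "(\<lambda>f. ip n (\<lambda>j. f (i, j)) v) \<in> borel_measurable (PiM ({i} \<times> {..<n}) (\<lambda>_. borel))"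
        unfolding ip_def by (intro borel_measurable_sum borel_measurable_times measurable_component_singleton) auto
      then show "(\<lambda>f. trunc_sq t (ip n (\<lambda>j. f (i, j)) v)) \<in> borel_measurable (PiM ({i} \<times> {..<n}) (\<lambda>_. borel))"
        unfolding trunc_sq_def by measurable
    next
      fix r r' assume "\<And>j. j < n \<Longrightarrow> r j = (r' j :: real)"
      then show "trunc_sq t (ip n r v) = trunc_sq t (ip n r' v)" using ip_cong[of n r r' v v] by simp
    qed auto
    fix i assume "i \<in> {..<N}"
    then have i: "i < N" by simp
    have q: "0 \<le> ip n v v" by (rule ip_self_nonneg)
    have "(1 - \<tau>) * ip n v v - t\<^sup>2 * (ip n v v)\<^sup>2 / 4 \<le> expectation (\<lambda>\<omega>. trunc_sq t (ip n (\<lambda>j. x i j \<omega>) v))"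
    proof (rule expectation_trunc_sq_row_ge[OF i t \<tau> s0(1) psi])
      fix j assume j: "j < n"
      have "v j * v j \<le> ip n v v" unfolding ip_def using j by (intro member_le_sum) auto
      then have "(v j)\<^sup>2 \<le> 2\<^sup>2" using v by (simp add: power2_eq_square)
      then have "\<bar>v j\<bar> \<le> 2" using abs_le_square_iff[of "v j" 2] by simp
      then have "t * \<bar>v j\<bar> \<le> t * 2" using t by (intro mult_left_mono) auto
      moreover have "\<bar>t * v j\<bar> = t * \<bar>v j\<bar>" using t by (simp add: abs_mult)
      ultimately show "\<bar>t * v j\<bar> \<le> s0" using s0 by linarith
    qed
    moreover have "(1 - \<tau>) * ip n v v \<ge> 1 - \<tau> - 2 * h"
    proof -
      have "(1 - \<tau>) * (1 - 2 * h) \<le> (1 - \<tau>) * ip n v v" using v \<tau> by (intro mult_left_mono) auto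
      moreover have "(1 - \<tau>) * (1 - 2 * h) = 1 - \<tau> - 2 * h + 2 * (\<tau> * h)" by (simp add: algebra_simps)
      moreover have "\<tau> * h \<ge> 0" using \<tau> h by simp
      ultimately show ?thesis by linarith
    qed
    moreover have "t\<^sup>2 * (ip n v v)\<^sup>2 / 4 \<le> 4 * t\<^sup>2"
    proof -
      have "(ip n v v)\<^sup>2 \<le> 4\<^sup>2" using q v by (intro power_mono) auto
      then have "t\<^sup>2 * (ip n v v)\<^sup>2 \<le> t\<^sup>2 * 16" by (intro mult_left_mono) auto
      then show ?thesis by simp
    qed
    ultimately show "1 - \<tau> - 2 * h - 4 * t\<^sup>2 \<le> expectation (\<lambda>\<omega>. trunc_sq t (ip n (\<lambda>j. x i j \<omega>) v))" by linarith
  qed (use N t \<tau> trunc_sq_bounds[OF t] in auto)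
  have eq: "- 2 * real (card {..<N}) * \<tau>\<^sup>2 / (4 / t\<^sup>2)\<^sup>2 = - (\<tau>\<^sup>2 * t ^ 4 / 8) * real N"
    by (simp add: power_divide power_mult[symmetric])
  show ?thesis using H[unfolded eq] by simp
qed

text \<open>A row has mean squared length \<open>n\<close>, so Markov's inequality gives probability
  \<open>1 / B\<close> per row; the other \<open>1 / B\<close> is the deviation.\<close>

lemma prob_many_long_rows:
  assumes N: "N > 0" and n: "n > 0" and B: "B > 0"
  shows "prob {\<omega>\<in>space M. (\<Sum>i<N. of_bool (ip n (\<lambda>j. x i j \<omega>) (\<lambda>j. x i j \<omega>) > B * real n)) \<ge> real N * (2 / B)}
    \<le> exp (- 2 * real N / B\<^sup>2)"
proof -
  let ?q = "\<lambda>i \<omega>. ip n (\<lambda>j. x i j \<omega>) (\<lambda>j. x i j \<omega>)"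
  define Y where "Y i \<omega> = (of_bool (?q i \<omega> > B * real n) :: real)" for i \<omega>
  have meas[measurable]: "?q i \<in> borel_measurable M" if "i < N" for i
    using row_norm_moment(2)[OF that] by (rule borel_measurable_integrable)
  have "prob {\<omega>\<in>space M. (\<Sum>i\<in>{..<N}. Y i \<omega>) \<ge> real (card {..<N}) * (1 / B + 1 / B)}
    \<le> exp (- 2 * real (card {..<N}) * (1 / B)\<^sup>2 / 1\<^sup>2)"
  proof (rule Hoeffding_sum_ge)
    show "indep_vars (\<lambda>_. borel) Y {..<N}"
      unfolding Y_def
    proof (rule indep_rows[where F = "\<lambda>i r. of_bool (ip n r r > B * real n)"])
      fix i
      have [measurable]: "(\<lambda>f. ip n (\<lambda>j. f (i, j)) (\<lambda>j. f (i, j))) \<in> borel_measurable (PiM ({i} \<times> {..<n}) (\<lambda>_. borel))"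
        unfolding ip_def by (intro borel_measurable_sum borel_measurable_times measurable_component_singleton) auto
      show "(\<lambda>f. of_bool (ip n (\<lambda>j. f (i, j)) (\<lambda>j. f (i, j)) > B * real n) :: real)
          \<in> borel_measurable (PiM ({i} \<times> {..<n}) (\<lambda>_. borel))"
        by measurable
    next
      fix r r' assume "\<And>j. j < n \<Longrightarrow> r j = (r' j :: real)"
      then have "ip n r r = ip n r' r'" by (intro ip_cong) auto
      then show "of_bool (ip n r r > B * real n) = (of_bool (ip n r' r' > B * real n) :: real)" by simp
    qed auto
    show "expectation (Y i) \<le> 1 / B" if "i \<in> {..<N}" for i
    proof -
      have i: "i < N" using that by simp
      have "expectation (Y i) \<le> expectation (\<lambda>\<omega>. ?q i \<omega> / (B * real n))"
      proof (rule integral_mono)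
        show "integrable M (Y i)" unfolding Y_def using meas[OF i]
          by (intro integrable_const_bound[of _ 1]) auto
        show "integrable M (\<lambda>\<omega>. ?q i \<omega> / (B * real n))" using row_norm_moment(2)[OF i] by simp
        show "Y i \<omega> \<le> ?q i \<omega> / (B * real n)" for \<omega>
          using ip_self_nonneg[of n "\<lambda>j. x i j \<omega>"] B n by (auto simp: Y_def field_simps)
      qed
      then show ?thesis using row_norm_moment(1)[OF i] n by simp
    qed
  qed (use N B in \<open>auto simp: Y_def\<close>)
  then show ?thesis by (simp add: Y_def power_divide)
qed

text \<open>Each grid point fails with probability at most \<open>exp (- \<gamma> n)\<close>, and
  there are at most \<open>exp (\<gamma> n / 2)\<close> of them, so the union bound leaves
  \<open>exp (- \<gamma> n / 2)\<close>. The second exponential pays for too many long rows.\<close>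

lemma spread_lower_bound_event:
  assumes n: "1 \<le> n" "n \<le> N" and c: "0 < c" "c \<le> 1" and \<tau>: "\<tau> = c / 10" and t: "t > 0" "4 * t\<^sup>2 \<le> c / 5"
    and s0: "s0 \<le> 1" "2 * t \<le> s0"
    and psi: "\<And>s. \<bar>s\<bar> \<le> s0 \<Longrightarrow> 1 - law.cos_transform s \<ge> (1 - \<tau>) * s\<^sup>2 / 2"
    and B: "B = 40 / (t\<^sup>2 * c)" and h: "0 < h" "h \<le> c / 10" "2 / t * (h * sqrt (2 * B)) \<le> c / 5"
    and \<gamma>: "\<gamma> = \<tau>\<^sup>2 * t ^ 4 / 8" and s: "s \<ge> 1" "4 * exp (- s) \<le> \<gamma> / 4" and \<kappa>: "\<kappa> = \<gamma> * h / (8 * s)"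
  shows "\<exists>E\<in>events. 1 - prob E \<le> exp (- (\<gamma> / 2) * real n) + exp (- (2 / B\<^sup>2) * real n) \<and>
    (\<forall>\<omega>\<in>E. \<forall>u. ip n u u = 1 \<and> (\<Sum>j<n. \<bar>u j\<bar>) \<le> \<kappa> * sqrt (real n) \<longrightarrow>
      (1 - c) * real N \<le> (\<Sum>i<N. (ip n (\<lambda>j. x i j \<omega>) u)\<^sup>2))"
proof -
  have \<tau>': "0 < \<tau>" "\<tau> < 1" using c \<tau> by auto
  have B0: "B > 0" unfolding B using t c by simp
  have \<gamma>0: "\<gamma> > 0" unfolding \<gamma> using \<tau>' t by simp
  have \<kappa>0: "\<kappa> > 0" unfolding \<kappa> using \<gamma>0 h s by simp
  have N: "N > 0" using n by simp
  define e where "e = (1 - \<tau> - 2 * h - 4 * t\<^sup>2) - \<tau>"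
  define \<theta> where "\<theta> k = (\<lambda>j. h / sqrt (real n) * real_of_int (k j))" for k :: "nat \<Rightarrow> int"
  define G where "G = {k \<in> l1_grid n (2 * \<kappa> * real n / h). 1 - 2 * h \<le> ip n (\<theta> k) (\<theta> k) \<and> ip n (\<theta> k) (\<theta> k) \<le> 4}"
  have G: "finite G" "card G \<le> card (l1_grid n (2 * \<kappa> * real n / h))"
    unfolding G_def using finite_l1_grid by (auto intro!: card_mono)
  let ?q = "\<lambda>i \<omega>. ip n (\<lambda>j. x i j \<omega>) (\<lambda>j. x i j \<omega>)"
  let ?A = "\<lambda>k. {\<omega>\<in>space M. (\<Sum>i<N. trunc_sq t (ip n (\<lambda>j. x i j \<omega>) (\<theta> k))) \<le> real N * e}"
  let ?L = "{\<omega>\<in>space M. (\<Sum>i<N. of_bool (?q i \<omega> > B * real n)) \<ge> real N * (2 / B)}"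
  have A_meas: "?A k \<in> events" for k
  proof -
    have [measurable]: "(\<lambda>\<omega>. \<Sum>i<N. trunc_sq t (ip n (\<lambda>j. x i j \<omega>) (\<theta> k))) \<in> borel_measurable M"
      unfolding trunc_sq_def using measurable_row_ip by (intro borel_measurable_sum) simp
    show ?thesis by measurable
  qed
  have L_meas: "?L \<in> events"
  proof -
    have [measurable]: "?q i \<in> borel_measurable M" if "i < N" for i
      using row_norm_moment(2)[OF that] by (rule borel_measurable_integrable)
    have [measurable]: "(\<lambda>\<omega>. \<Sum>i<N. of_bool (?q i \<omega> > B * real n) :: real) \<in> borel_measurable M"
      by (rule borel_measurable_sum) simp
    show ?thesis by measurable
  qed
  have UA: "(\<Union>k\<in>G. ?A k) \<in> events" using A_meas G by (intro sets.finite_UN) auto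
  define V where "V = (\<Union>k\<in>G. ?A k) \<union> ?L"
  have V: "V \<in> events" unfolding V_def by (rule sets.Un[OF UA L_meas])
  define E where "E = space M - V"
  have E: "E \<in> events" unfolding E_def by (rule sets.compl_sets[OF V])
  have pA: "prob (?A k) \<le> exp (- \<gamma> * real n)" if "k \<in> G" for k
  proof -
    have "prob (?A k) \<le> exp (- (\<tau>\<^sup>2 * t ^ 4 / 8) * real N)"
      unfolding e_def using prob_trunc_sum_le[OF N t(1) \<tau>' s0 _ psi, of h "\<theta> k"] that h by (auto simp: G_def)
    also have "\<dots> \<le> exp (- \<gamma> * real n)" using n \<gamma>0 unfolding \<gamma>[symmetric] by (simp add: mult_left_mono)
    finally show ?thesis .
  qed
  \<comment> \<open>The choice of \<open>\<kappa>\<close> makes the first term of the exponent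
    \<open>\<gamma> / 4 * n\<close>; the choice of \<open>s\<close> bounds the second by the same
    amount.\<close>
  have cardG: "real (card G) \<le> exp (\<gamma> / 2 * real n)"
  proof -
    have "real (card G) \<le> real (card (l1_grid n (2 * \<kappa> * real n / h)))" using G by simp
    also have "\<dots> \<le> exp (s * (2 * \<kappa> * real n / h) + 4 * exp (- s) * real n)"
      by (rule card_l1_grid_le) (use s \<kappa>0 h in auto)
    also have "s * (2 * \<kappa> * real n / h) = \<gamma> / 4 * real n"
      using h s by (simp add: \<kappa>)
    also have "exp (\<gamma> / 4 * real n + 4 * exp (- s) * real n) \<le> exp (\<gamma> / 4 * real n + \<gamma> / 4 * real n)"
      using mult_right_mono[OF s(2), of "real n"] by simp
    finally show ?thesis by (simp add: algebra_simps)
  qed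
  have "prob (\<Union>k\<in>G. ?A k) \<le> (\<Sum>k\<in>G. prob (?A k))"
    using A_meas G by (intro finite_measure_subadditive_finite) auto
  also have "\<dots> \<le> real (card G) * exp (- \<gamma> * real n)"
    using sum_mono[of G "\<lambda>k. prob (?A k)" "\<lambda>_. exp (- \<gamma> * real n)"] pA by simp
  also have "\<dots> \<le> exp (\<gamma> / 2 * real n) * exp (- \<gamma> * real n)"
    using cardG by (intro mult_right_mono) auto
  also have "\<dots> = exp (- (\<gamma> / 2) * real n)" by (simp add: exp_add[symmetric])
  finally have pUA: "prob (\<Union>k\<in>G. ?A k) \<le> exp (- (\<gamma> / 2) * real n)" .
  have "prob ?L \<le> exp (- 2 * real N / B\<^sup>2)" by (rule prob_many_long_rows) (use N n B0 in auto)
  also have "\<dots> \<le> exp (- (2 / B\<^sup>2) * real n)"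
    using n B0 by (simp add: divide_right_mono)
  finally have pL: "prob ?L \<le> exp (- (2 / B\<^sup>2) * real n)" .
  have "prob V \<le> exp (- (\<gamma> / 2) * real n) + exp (- (2 / B\<^sup>2) * real n)"
    unfolding V_def by (rule order.trans[OF measure_Un_le[OF UA L_meas] add_mono[OF pUA pL]])
  then have pE: "1 - prob E \<le> exp (- (\<gamma> / 2) * real n) + exp (- (2 / B\<^sup>2) * real n)"
    unfolding E_def prob_compl[OF V] by simp
  have "(1 - c) * real N \<le> (\<Sum>i<N. (ip n (\<lambda>j. x i j \<omega>) u)\<^sup>2)"
    if \<omega>: "\<omega> \<in> E" and u: "ip n u u = 1" "(\<Sum>j<n. \<bar>u j\<bar>) \<le> \<kappa> * sqrt (real n)" for \<omega> u
  proof -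
    have sp: "\<omega> \<in> space M" using \<omega> by (simp add: E_def)
    have "real N * (e - 8 / (t\<^sup>2 * B) - 2 / t * (h * sqrt (2 * B))) \<le> (\<Sum>i<N. (ip n (\<lambda>j. x i j \<omega>) u)\<^sup>2)"
    proof (rule sum_sq_ip_ge_grid[OF _ t(1) B0 h(1) _ \<kappa>0 N _ u])
      have "real (card {i\<in>{..<N}. ?q i \<omega> > B * real n}) = (\<Sum>i<N. of_bool (?q i \<omega> > B * real n))"
        by (simp add: Int_def)
      also have "\<dots> \<le> real N * (2 / B)" using \<omega> sp by (simp add: E_def V_def)
      finally show "real (card {i\<in>{..<N}. ?q i \<omega> > B * real n}) \<le> real N * (2 / B)" .
    next
      fix k assume "k \<in> l1_grid n (2 * \<kappa> * real n / h)"
       "1 - 2 * h \<le> ip n (\<lambda>j. h / sqrt (real n) * k j) (\<lambda>j. h / sqrt (real n) * k j)"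
       "ip n (\<lambda>j. h / sqrt (real n) * k j) (\<lambda>j. h / sqrt (real n) * k j) \<le> 4"
      then have "k \<in> G" by (simp add: G_def \<theta>_def)
      then have "\<omega> \<notin> ?A k" using \<omega> unfolding E_def V_def by blast
      then show "real N * e \<le> (\<Sum>i<N. trunc_sq t (ip n (\<lambda>j. x i j \<omega>) (\<lambda>j. h / sqrt (real n) * k j)))"
        using sp by (simp add: \<theta>_def)
    qed (use n h c in auto)
    \<comment> \<open>The loss \<open>c\<close> is split into five shares of \<open>c / 5\<close>:
      \<open>2 * \<tau>\<close>, \<open>2 * h\<close>, \<open>4 * t\<^sup>2\<close>, the long rows
      and the rounding error.\<close>
    moreover have "1 - c \<le> e - 8 / (t\<^sup>2 * B) - 2 / t * (h * sqrt (2 * B))"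
    proof -
      have "8 / (t\<^sup>2 * B) = c / 5" using t c by (simp add: B)
      then show ?thesis using h(2,3) t(2) unfolding e_def \<tau> by linarith
    qed
    then have "(1 - c) * real N \<le> real N * (e - 8 / (t\<^sup>2 * B) - 2 / t * (h * sqrt (2 * B)))"
      by (subst mult.commute) (rule mult_left_mono, auto)
    ultimately show ?thesis by linarith
  qed
  then show ?thesis using E pE by (intro bexI[of _ E]) auto
qed

end

text \<open>The parameters are fixed in the order \<open>\<tau>\<close>, \<open>s0\<close>,
  \<open>t\<close>, \<open>B\<close>, \<open>h\<close>, \<open>\<gamma>'\<close>, \<open>s\<close>,
  \<open>\<kappa>\<close>, each from \<open>c\<close>, the law and the earlier ones only. Hence
  \<open>\<kappa>\<close> and \<open>\<gamma>\<close> are uniform in the dimensions.\<close>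

lemma (in unit_symmetric_law) spread_lower_bound:
  assumes c: "0 < c" "c \<le> 1"
  obtains \<kappa> \<gamma> :: real where "\<kappa> > 0" "\<gamma> > 0"
    "\<And>(M :: 'a measure) x N n. iid_symmetric_entries M x N n \<mu> \<Longrightarrow> 1 \<le> n \<Longrightarrow> n \<le> N \<Longrightarrow>
      \<exists>E\<in>sets M. 1 - measure M E \<le> 2 * exp (- \<gamma> * real n) \<and>
        (\<forall>\<omega>\<in>E. \<forall>u. ip n u u = 1 \<and> (\<Sum>j<n. \<bar>u j\<bar>) \<le> \<kappa> * sqrt (real n) \<longrightarrow>
          (1 - c) * real N \<le> (\<Sum>i<N. (ip n (\<lambda>j. x i j \<omega>) u)\<^sup>2))"
proof -
  define \<tau> where "\<tau> = c / 10"
  have \<tau>: "\<tau> > 0" using c by (simp add: \<tau>_def)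
  obtain s1 where s1: "s1 > 0" "\<And>s. \<bar>s\<bar> \<le> s1 \<Longrightarrow> 1 - cos_transform s \<ge> (1 - \<tau>) * s\<^sup>2 / 2"
    using one_minus_cos_transform_ge[OF \<tau>] by blast
  define s0 where "s0 = min s1 1"
  define t where "t = min (s0 / 2) (c / 5)"
  have t: "t > 0" "2 * t \<le> s0" using s1 c by (auto simp: t_def s0_def)
  have t2: "4 * t\<^sup>2 \<le> c / 5"
  proof -
    have "t * t \<le> (c / 5) * (1 / 5)" using t c by (intro mult_mono) (auto simp: t_def)
    then show ?thesis using c by (simp add: power2_eq_square)
  qed
  define B where "B = 40 / (t\<^sup>2 * c)"
  have B: "B > 0" using t c by (simp add: B_def)
  define h where "h = min (c / 10) (c / 5 * t / (2 * sqrt (2 * B)))"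
  have h: "h > 0" "h \<le> c / 10" using t c B by (auto simp: h_def)
  have h2: "2 / t * (h * sqrt (2 * B)) \<le> c / 5"
  proof -
    have "h \<le> c / 5 * t / (2 * sqrt (2 * B))" by (simp add: h_def)
    then have "h * (2 * sqrt (2 * B)) \<le> c / 5 * t"
      using B by (subst (asm) pos_le_divide_eq) auto
    then show ?thesis using t by (simp add: field_simps)
  qed
  define \<gamma>' where "\<gamma>' = \<tau>\<^sup>2 * t ^ 4 / 8"
  have \<gamma>': "\<gamma>' > 0" using \<tau> t by (simp add: \<gamma>'_def)
  \<comment> \<open>Large enough that the entropy per coordinate, \<open>4 * exp (- s)\<close>, is
    at most \<open>\<gamma>' / 4\<close>.\<close>
  define s where "s = max 1 (- ln (\<gamma>' / 16))"
  have s: "s \<ge> 1" "4 * exp (- s) \<le> \<gamma>' / 4"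
  proof -
    have "exp (- s) \<le> exp (ln (\<gamma>' / 16))" by (simp add: s_def)
    then show "4 * exp (- s) \<le> \<gamma>' / 4" using \<gamma>' by simp
  qed (simp add: s_def)
  define \<kappa> where "\<kappa> = \<gamma>' * h / (8 * s)"
  define \<gamma> where "\<gamma> = min (\<gamma>' / 2) (2 / B\<^sup>2)"
  show ?thesis
  proof (rule that)
    show "\<kappa> > 0" using \<gamma>' h s by (simp add: \<kappa>_def)
    show "\<gamma> > 0" using \<gamma>' B by (simp add: \<gamma>_def)
    fix M :: "'a measure" and x and N n :: nat
    assume "iid_symmetric_entries M x N n \<mu>" and n: "1 \<le> n" "n \<le> N"
    then interpret E: iid_symmetric_entries M x N n \<mu> by simp
    have sum_le: "exp (- (\<gamma>' / 2) * real n) + exp (- (2 / B\<^sup>2) * real n) \<le> 2 * exp (- \<gamma> * real n)"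
    proof -
      have "exp (- (\<gamma>' / 2) * real n) + exp (- (2 / B\<^sup>2) * real n) \<le> exp (- \<gamma> * real n) + exp (- \<gamma> * real n)"
      proof -
        have "\<gamma> * real n \<le> \<gamma>' / 2 * real n" "\<gamma> * real n \<le> 2 / B\<^sup>2 * real n"
          by (intro mult_right_mono; simp add: \<gamma>_def)+
        then show ?thesis by (intro add_mono) simp_all
      qed
      then show ?thesis by simp
    qed
    have "\<exists>E\<in>sets M. 1 - measure M E \<le> exp (- (\<gamma>' / 2) * real n) + exp (- (2 / B\<^sup>2) * real n) \<and>
        (\<forall>\<omega>\<in>E. \<forall>u. ip n u u = 1 \<and> (\<Sum>j<n. \<bar>u j\<bar>) \<le> \<kappa> * sqrt (real n) \<longrightarrow>
          (1 - c) * real N \<le> (\<Sum>i<N. (ip n (\<lambda>j. x i j \<omega>) u)\<^sup>2))"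
      by (rule E.spread_lower_bound_event[OF n c \<tau>_def t(1) t2 _ t(2) s1(2) B_def h h2 \<gamma>'_def s \<kappa>_def])
        (simp_all add: s0_def)
    then show "\<exists>E\<in>sets M. 1 - measure M E \<le> 2 * exp (- \<gamma> * real n) \<and>
        (\<forall>\<omega>\<in>E. \<forall>u. ip n u u = 1 \<and> (\<Sum>j<n. \<bar>u j\<bar>) \<le> \<kappa> * sqrt (real n) \<longrightarrow>
          (1 - c) * real N \<le> (\<Sum>i<N. (ip n (\<lambda>j. x i j \<omega>) u)\<^sup>2))"
    proof (rule bexE)
      fix F assume F: "F \<in> sets M" "1 - measure M F \<le> exp (- (\<gamma>' / 2) * real n) + exp (- (2 / B\<^sup>2) * real n) \<and>
        (\<forall>\<omega>\<in>F. \<forall>u. ip n u u = 1 \<and> (\<Sum>j<n. \<bar>u j\<bar>) \<le> \<kappa> * sqrt (real n) \<longrightarrow>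
          (1 - c) * real N \<le> (\<Sum>i<N. (ip n (\<lambda>j. x i j \<omega>) u)\<^sup>2))"
      show ?thesis
        by (rule bexI[of _ F], rule conjI[OF order.trans[OF conjunct1[OF F(2)] sum_le] conjunct2[OF F(2)]], rule F(1))
    qed
  qed
qed

section \<open>Delocalization\<close>

text \<open>Cauchy--Schwarz separately on \<open>I\<close>, where the vector has norm at most
  \<open>\<delta>\<close>, and on its complement, which has at most \<open>\<epsilon> * n\<close>
  elements and norm at most 1.\<close>

lemma sum_abs_le_if_concentrated:
  fixes u :: "real vec"
  assumes u: "dim_vec u = n" "l2_norm u = 1" and I: "I \<subseteq> {..<n}" "real (card I) \<ge> (1 - \<epsilon>) * real n"
    and small: "l2_norm (subvector u I) \<le> \<delta>" and \<delta>: "\<delta> \<ge> 0"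
  shows "(\<Sum>j<n. \<bar>u $ j\<bar>) \<le> (\<delta> + sqrt \<epsilon>) * sqrt (real n)"
proof -
  have cs: "(\<Sum>j\<in>A. \<bar>u $ j\<bar>) \<le> sqrt (real (card A)) * L2_set (\<lambda>j. u $ j) A" for A
    using L2_set_mult_ineq[of "\<lambda>_. 1" "\<lambda>j. u $ j" A] by (simp add: L2_set_def)
  have finI: "finite I" using I finite_subset by blast
  have cI: "card I \<le> n" using card_mono[OF _ I(1)] by simp
  have "(\<Sum>j\<in>I. \<bar>u $ j\<bar>) \<le> sqrt (real n) * \<delta>"
  proof -
    have "L2_set (\<lambda>j. u $ j) I \<le> \<delta>" using small I u by (simp add: l2_norm_subvector)
    then have "sqrt (real (card I)) * L2_set (\<lambda>j. u $ j) I \<le> sqrt (real n) * \<delta>"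
      using cI \<delta> by (intro mult_mono L2_set_nonneg) auto
    with cs[of I] show ?thesis by (rule order.trans)
  qed
  moreover have "(\<Sum>j\<in>{..<n} - I. \<bar>u $ j\<bar>) \<le> sqrt (\<epsilon> * real n) * 1"
  proof -
    have "L2_set (\<lambda>j. u $ j) ({..<n} - I) \<le> L2_set (\<lambda>j. u $ j) {..<n}"
      unfolding L2_set_def by (intro real_sqrt_le_mono sum_mono2) auto
    then have "L2_set (\<lambda>j. u $ j) ({..<n} - I) \<le> 1" using u by (simp add: l2_norm_def)
    moreover have "real (card ({..<n} - I)) \<le> \<epsilon> * real n"
      using I cI finI by (simp add: card_Diff_subset algebra_simps)
    ultimately have "sqrt (real (card ({..<n} - I))) * L2_set (\<lambda>j. u $ j) ({..<n} - I) \<le> sqrt (\<epsilon> * real n) * 1"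
      by (intro mult_mono) (auto intro: order.trans[OF _ real_sqrt_le_mono])
    with cs[of "{..<n} - I"] show ?thesis by (rule order.trans)
  qed
  moreover have "(\<Sum>j<n. \<bar>u $ j\<bar>) = (\<Sum>j\<in>{..<n} - I. \<bar>u $ j\<bar>) + (\<Sum>j\<in>I. \<bar>u $ j\<bar>)"
    by (rule sum.subset_diff[OF I(1)]) simp
  ultimately show ?thesis by (simp add: real_sqrt_mult algebra_simps)
qed

lemma iid_matrix_imp_iid_symmetric_entries:
  assumes "unit_symmetric_law \<mu>" "iid_matrix \<Omega> \<mu> N n X"
  shows "iid_symmetric_entries \<Omega> (\<lambda>i j \<omega>. X \<omega> $$ (i, j)) N n \<mu>"
proof -
  interpret law: unit_symmetric_law \<mu> by fact
  interpret prob_space \<Omega> using assms(2) by (simp add: iid_matrix_def)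
  have "(\<integral>t. t \<partial>\<mu>) = 0" by (rule law.integral_odd_eq_0) auto
  then show ?thesis
    using assms(2) law.second_moment
    by unfold_locales (auto simp: iid_matrix_def)
qed

text \<open>A concentrated singular vector has small \<open>l1\<close> norm, so \<open>lower\<close>
  puts the squared singular value above \<open>(1 - c / 2) * N\<close>, against
  \<open>upper\<close>. Since \<open>sqrt\<close> is monotone, one \<open>\<kappa>\<close> handles
  every \<open>e\<close> below \<open>\<epsilon>\<^sub>a\<close>.\<close>

lemma delocalized_if_bounds:
  fixes A :: "real mat"
  assumes A: "A \<in> carrier_mat N n" and N: "N > 0"
    and \<epsilon>: "0 < \<epsilon>\<^sub>a" and \<delta>: "0 < \<delta>\<^sub>a" and \<kappa>: "\<delta>\<^sub>a + sqrt \<epsilon>\<^sub>a \<le> \<kappa>" and c: "c > 0"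
    and upper: "(kth_smallest_singular_value A k)\<^sup>2 \<le> (1 - c) * real N"
    and lower: "\<And>u. ip n u u = 1 \<Longrightarrow> (\<Sum>j<n. \<bar>u j\<bar>) \<le> \<kappa> * sqrt (real n) \<Longrightarrow>
      (1 - c / 2) * real N \<le> (\<Sum>i<N. (ip n (\<lambda>j. A $$ (i, j)) u)\<^sup>2)"
  shows "singular_vector_delocalized \<epsilon>\<^sub>a \<delta>\<^sub>a n A k"
  unfolding singular_vector_delocalized_def
proof (intro allI impI)
  fix e u I
  assume e: "0 < e \<and> e < \<epsilon>\<^sub>a" and u: "unit_right_singular_vector A (kth_smallest_singular_value A k) u"
    and I: "I \<subseteq> {..<n}" "int (card I) = \<lceil>(1 - e) * real n\<rceil>"
  note sv = sum_sq_ip_rows_singular_vector[OF A u]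
  show "\<delta>\<^sub>a \<le> l2_norm (subvector u I)"
  proof (rule ccontr)
    assume "\<not> ?thesis"
    then have small: "l2_norm (subvector u I) \<le> \<delta>\<^sub>a" by simp
    have "(1 - e) * real n \<le> real_of_int (int (card I))" unfolding I(2) by (rule le_of_int_ceiling)
    then have cI: "real (card I) \<ge> (1 - e) * real n" by simp
    have "l2_norm u = 1" using u by (simp add: unit_right_singular_vector_def)
    from sum_abs_le_if_concentrated[OF sv(2) this I(1) cI small] \<delta>
    have "(\<Sum>j<n. \<bar>u $ j\<bar>) \<le> (\<delta>\<^sub>a + sqrt e) * sqrt (real n)" by simp
    also have "\<dots> \<le> \<kappa> * sqrt (real n)"
    proof (rule mult_right_mono)
      have "sqrt e \<le> sqrt \<epsilon>\<^sub>a" using e by simp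
      then show "\<delta>\<^sub>a + sqrt e \<le> \<kappa>" using \<kappa> by linarith
    qed simp
    finally have "(1 - c / 2) * real N \<le> (kth_smallest_singular_value A k)\<^sup>2"
      using lower[of "\<lambda>j. u $ j"] sv(1,3) by simp
    then have "(1 - c / 2) * real N \<le> (1 - c) * real N" using upper by linarith
    then show False using N c by simp
  qed
qed

theorem corollary1p11:
  fixes a \<alpha> K :: real
    and \<mu> :: "real measure"
    and \<Omega> :: "nat \<Rightarrow> 'w measure"
    and X :: "nat \<Rightarrow> 'w \<Rightarrow> real mat"
  assumes "a > 1"
    and "\<alpha> > 2"
    and "real_distribution \<mu>"
    and "power_law_tail \<mu> \<alpha>"
    and "(\<integral>x. x\<^sup>2 \<partial>\<mu>) = 1"
    and "symmetric_law \<mu>"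
    and "\<And>n. iid_matrix (\<Omega> n) \<mu> (nat \<lceil>a * real n\<rceil>) n (X n)"
    and "K > 0"
  shows "\<exists>\<epsilon>\<^sub>a \<delta>\<^sub>a. 0 < \<epsilon>\<^sub>a \<and> \<epsilon>\<^sub>a < 1/2 \<and> 0 < \<delta>\<^sub>a \<and> \<delta>\<^sub>a < 1/2 \<and>
    holds_with_prob_1_minus_O \<Omega> K (\<lambda>n \<omega>. singular_vector_delocalized \<epsilon>\<^sub>a \<delta>\<^sub>a n (X n \<omega>) 1) \<and>
    (\<forall>k :: nat \<Rightarrow> nat. (\<forall>n\<ge>1. 1 \<le> k n) \<longrightarrow> (\<lambda>n. real (k n)) \<in> o(\<lambda>n. real n) \<longrightarrow>
      holds_with_prob_1_minus_O \<Omega> K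
        (\<lambda>n \<omega>. singular_vector_delocalized \<epsilon>\<^sub>a \<delta>\<^sub>a n (X n \<omega>) (k n)))"
proof -
  have law: "unit_symmetric_law \<mu>"
    using assms(3,5,6) by (simp add: unit_symmetric_law_def unit_symmetric_law_axioms_def symmetric_law_def)
  define c where "c = 1 / (12 * a)"
  have c: "0 < c" "c < 1 / 12" using assms(1) by (auto simp: c_def field_simps)
  define N where "N n = nat \<lceil>a * real n\<rceil>" for n
  define x where "x n i j \<omega> = X n \<omega> $$ (i, j)" for n i j \<omega>
  have entries: "iid_symmetric_entries (\<Omega> n) (x n) (N n) n \<mu>" for n
    using iid_matrix_imp_iid_symmetric_entries[OF law assms(7)[of n]] by (simp add: x_def[abs_def] N_def)
  have carrier: "X n \<omega> \<in> carrier_mat (N n) n" if "\<omega> \<in> space (\<Omega> n)" for n \<omega>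
    using assms(7)[of n] that by (simp add: iid_matrix_def N_def)
  have N: "n \<le> N n" "real (N n) \<le> 2 * a * real n" if "n \<ge> 1" for n
  proof -
    have an: "real n \<le> a * real n" "1 \<le> a * real n"
      using assms(1) that mult_mono[of 1 a 1 "real n"] by auto
    then show "n \<le> N n" unfolding N_def by linarith
    have "real (N n) \<le> a * real n + 1" using an unfolding N_def by linarith
    then show "real (N n) \<le> 2 * a * real n" using an by linarith
  qed
  \<comment> \<open>Half the constant of the upper bound is used here, which leaves a strict gap
    between the two bounds.\<close>
  obtain \<kappa> \<gamma> where \<kappa>: "\<kappa> > 0" and \<gamma>: "\<gamma> > 0" and lower:
    "\<And>(M :: 'w measure) x N n. iid_symmetric_entries M x N n \<mu> \<Longrightarrow> 1 \<le> n \<Longrightarrow> n \<le> N \<Longrightarrow>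
      \<exists>E\<in>sets M. 1 - measure M E \<le> 2 * exp (- \<gamma> * real n) \<and>
        (\<forall>\<omega>\<in>E. \<forall>u. ip n u u = 1 \<and> (\<Sum>j<n. \<bar>u j\<bar>) \<le> \<kappa> * sqrt (real n) \<longrightarrow>
          (1 - c / 2) * real N \<le> (\<Sum>i<N. (ip n (\<lambda>j. x i j \<omega>) u)\<^sup>2))"
    using unit_symmetric_law.spread_lower_bound[OF law, of "c / 2", where 'a = 'w] c by auto
  define \<gamma>2 where "\<gamma>2 = (c\<^sup>2 / (128 * a))\<^sup>2"
  have \<gamma>2: "\<gamma>2 > 0" using c assms(1) by (simp add: \<gamma>2_def)
  \<comment> \<open>Half of \<open>\<kappa>\<close> goes to \<open>sqrt \<epsilon>\<close> and half
    to \<open>\<delta>\<close>; the caps \<open>1 / 4\<close> keep both below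
    \<open>1 / 2\<close>.\<close>
  define \<epsilon> where "\<epsilon> = min ((\<kappa> / 2)\<^sup>2) (1 / 4)"
  define \<delta> where "\<delta> = min (\<kappa> / 2) (1 / 4)"
  have \<epsilon>: "0 < \<epsilon>" "\<epsilon> < 1 / 2" using \<kappa> by (auto simp: \<epsilon>_def)
  have \<delta>: "0 < \<delta>" "\<delta> < 1 / 2" using \<kappa> by (auto simp: \<delta>_def)
  have "sqrt \<epsilon> \<le> \<kappa> / 2" by (rule real_le_lsqrt) (use \<kappa> in \<open>auto simp: \<epsilon>_def\<close>)
  moreover have "\<delta> \<le> \<kappa> / 2" by (simp add: \<delta>_def)
  ultimately have \<delta>\<epsilon>: "\<delta> + sqrt \<epsilon> \<le> \<kappa>" by linarith
  define good where "good n k \<longleftrightarrow> 2 \<le> n \<and> 1 \<le> k \<and> real k \<le> c / 8 * real n" for n k :: nat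
  have event: "\<exists>E\<in>sets (\<Omega> n). 1 - measure (\<Omega> n) E \<le> 2 * exp (- \<gamma> * real n) + 2 * exp (- \<gamma>2 * real n) \<and>
      (\<forall>\<omega>\<in>E. singular_vector_delocalized \<epsilon> \<delta> n (X n \<omega>) k)" if g: "good n k" for n k
  proof -
    interpret iid_symmetric_entries "\<Omega> n" "x n" "N n" n \<mu> by (rule entries)
    have n: "1 \<le> n" "2 \<le> n" using g by (auto simp: good_def)
    obtain E1 where E1: "E1 \<in> events" "1 - prob E1 \<le> 2 * exp (- \<gamma> * real n)"
      "\<And>\<omega> u. \<omega> \<in> E1 \<Longrightarrow> ip n u u = 1 \<Longrightarrow> (\<Sum>j<n. \<bar>u j\<bar>) \<le> \<kappa> * sqrt (real n) \<Longrightarrow>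
          (1 - c / 2) * real (N n) \<le> (\<Sum>i<N n. (ip n (\<lambda>j. x n i j \<omega>) u)\<^sup>2)"
      using lower[OF entries n(1) N(1)[OF n(1)]] by blast
    obtain E2 where E2: "E2 \<in> events" "1 - prob E2 \<le> 2 * exp (- \<gamma>2 * real n)"
      "\<And>\<omega> k. \<omega> \<in> E2 \<Longrightarrow> 1 \<le> k \<Longrightarrow> real k \<le> c / 8 * real n \<Longrightarrow>
          (kth_smallest_singular_value (X n \<omega>) k)\<^sup>2 \<le> (1 - c) * real (N n)"
      using small_singular_values_event[OF assms(1) n(2) N[OF n(1)] carrier x_def]
      unfolding c_def[symmetric] \<gamma>2_def[symmetric] by blast
    have "1 - prob (E1 \<inter> E2) \<le> (1 - prob E1) + (1 - prob E2)"
    proof -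
      have "prob (E1 \<union> E2) = prob E1 + prob E2 - prob (E1 \<inter> E2)"
        using E1(1) E2(1) by (simp add: finite_measure_Union' finite_measure_Diff' Int_commute)
      then show ?thesis using prob_le_1[of "E1 \<union> E2"] by linarith
    qed
    then have "1 - prob (E1 \<inter> E2) \<le> 2 * exp (- \<gamma> * real n) + 2 * exp (- \<gamma>2 * real n)"
      using E1(2) E2(2) by linarith
    moreover have "singular_vector_delocalized \<epsilon> \<delta> n (X n \<omega>) k" if \<omega>: "\<omega> \<in> E1 \<inter> E2" for \<omega>
    proof (rule delocalized_if_bounds[OF carrier _ \<epsilon>(1) \<delta>(1) \<delta>\<epsilon> c(1)])
      show "\<omega> \<in> space (\<Omega> n)" using \<omega> E1(1) sets.sets_into_space by blast
      show "(kth_smallest_singular_value (X n \<omega>) k)\<^sup>2 \<le> (1 - c) * real (N n)"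
        using E2(3) \<omega> g by (simp add: good_def)
      show "(1 - c / 2) * real (N n) \<le> (\<Sum>i<N n. (ip n (\<lambda>j. X n \<omega> $$ (i, j)) u)\<^sup>2)"
        if "ip n u u = 1" "(\<Sum>j<n. \<bar>u j\<bar>) \<le> \<kappa> * sqrt (real n)" for u
        using E1(3)[OF _ that] \<omega> by (simp add: x_def)
    qed (use n N(1)[OF n(1)] in linarith)+
    ultimately show ?thesis using E1(1) E2(1) by (intro bexI[of _ "E1 \<inter> E2"]) auto
  qed
  have main: "holds_with_prob_1_minus_O \<Omega> K (\<lambda>n \<omega>. singular_vector_delocalized \<epsilon> \<delta> n (X n \<omega>) (k n))"
    if k: "\<forall>n\<ge>1. 1 \<le> k n" "(\<lambda>n. real (k n)) \<in> o(\<lambda>n. real n)" for k :: "nat \<Rightarrow> nat"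
  proof -
    \<comment> \<open>Where \<open>good\<close> fails, the empty event is taken. For
      \<open>k = o(n)\<close> this concerns only finitely many \<open>n\<close> and does not affect
      the asymptotic bound.\<close>
    have "\<forall>n. \<exists>E\<in>sets (\<Omega> n). (\<forall>\<omega>\<in>E. singular_vector_delocalized \<epsilon> \<delta> n (X n \<omega>) (k n)) \<and>
       (good n (k n) \<longrightarrow> 1 - measure (\<Omega> n) E \<le> 2 * exp (- \<gamma> * real n) + 2 * exp (- \<gamma>2 * real n))"
    proof
      fix n
      show "\<exists>E\<in>sets (\<Omega> n). (\<forall>\<omega>\<in>E. singular_vector_delocalized \<epsilon> \<delta> n (X n \<omega>) (k n)) \<and>
         (good n (k n) \<longrightarrow> 1 - measure (\<Omega> n) E \<le> 2 * exp (- \<gamma> * real n) + 2 * exp (- \<gamma>2 * real n))"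
      proof (cases "good n (k n)")
        case True
        then show ?thesis using event[OF True] by blast
      next
        case False
        then show ?thesis by (intro bexI[of _ "{}"]) auto
      qed
    qed
    then obtain E where E: "\<And>n. E n \<in> sets (\<Omega> n)"
      "\<And>n \<omega>. \<omega> \<in> E n \<Longrightarrow> singular_vector_delocalized \<epsilon> \<delta> n (X n \<omega>) (k n)"
      "\<And>n. good n (k n) \<Longrightarrow> 1 - measure (\<Omega> n) (E n) \<le> 2 * exp (- \<gamma> * real n) + 2 * exp (- \<gamma>2 * real n)"
      by metis
    have "\<forall>\<^sub>F n in sequentially. norm (real (k n)) \<le> c / 8 * norm (real n)"
      using landau_o.smallD[OF k(2), of "c / 8"] c by simp
    then have "\<forall>\<^sub>F n in sequentially. good n (k n)"
      using eventually_ge_at_top[of 2]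
      by eventually_elim (use k(1) in \<open>auto simp: good_def\<close>)
    then have "\<forall>\<^sub>F n in sequentially. norm (1 - measure (\<Omega> n) (E n))
        \<le> norm (2 * exp (- \<gamma> * real n) + 2 * exp (- \<gamma>2 * real n))"
    proof eventually_elim
      case (elim n)
      interpret iid_symmetric_entries "\<Omega> n" "x n" "N n" n \<mu> by (rule entries)
      show ?case using E(3)[OF elim] prob_le_1[of "E n"] by simp
    qed
    then have "(\<lambda>n. 1 - measure (\<Omega> n) (E n)) \<in> O(\<lambda>n. 2 * exp (- \<gamma> * real n) + 2 * exp (- \<gamma>2 * real n))"
      by (intro landau_o.big_mono)
    also have "(\<lambda>n. 2 * exp (- \<gamma> * real n) + 2 * exp (- \<gamma>2 * real n)) \<in> O(\<lambda>n. real n powr (- K))"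
    proof (rule sum_in_bigo)
      show "(\<lambda>n. 2 * exp (- \<gamma> * real n)) \<in> O(\<lambda>n. real n powr (- K))" using \<gamma> by real_asymp
      show "(\<lambda>n. 2 * exp (- \<gamma>2 * real n)) \<in> O(\<lambda>n. real n powr (- K))" using \<gamma>2 by real_asymp
    qed
    finally show ?thesis using E(1,2) unfolding holds_with_prob_1_minus_O_def by blast
  qed
  \<comment> \<open>The smallest singular value is the case of constant
    \<open>k = 1\<close>.\<close>
  have "(\<lambda>n. real 1) \<in> o(\<lambda>n. real n)" by real_asymp
  then have "holds_with_prob_1_minus_O \<Omega> K (\<lambda>n \<omega>. singular_vector_delocalized \<epsilon> \<delta> n (X n \<omega>) 1)"
    using main[of "\<lambda>_. 1"] by simp
  then show ?thesis using main \<epsilon> \<delta> by blast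
qed

end
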